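(* Let $K$ be a field, $m\ge1$, and suppose $\delta,\delta_L,\delta_R,\kappa_L,\kappa_R,\kappa_{LR}\in K$ are units. Consider the prestandard module $\mathcal S_{2m}(l)$ of $b^\phi_{2m}(\delta,\delta_L,\delta_R,\kappa_L,\kappa_R,\kappa_{LR})$, where $l\in\Lambda^\phi_m=\{-m,-m+1,\dots,m-1\}$ and $l=\pm x$ with $x>0$. Define the integer $\epsilon$ by: $\epsilon=1$ if $m-x$ is odd; $\epsilon=2$ if $m-x$ is even and $l>0$; $\epsilon=0$ if $m-x$ is even and $l<0$; and let $k=(m-(x+\epsilon))/2$. Then the dimension of $\mathcal S_{2m}(l)$ is $$\sum_{i=0}^{k}\binom{m}{i}.$$
   Context: Affine symmetric Temperley--Lieb algebra $b^\phi_{2m}$ over a commutative ring $K$. Consider the cylinder $S^1\times[0,1]$ ($S^1\subset\mathbb C$ the unit circle) with reflection $\iota(z,t)=(\bar z,t)$; $\{1\}\times[0,1]$ and $\{-1\}\times[0,1]$ are the $0$-reflection line and $1$-reflection line. On the northern edge $S^1\times\{1\}$ fix vertices $\pm1,\dots,\pm m$, with $1,\dots,m$ in this order on the open half circle from the point $1$ to the point $-1$, and $-i=\iota(i)$; on the southern edge $S^1\times\{0\}$ fix vertices $\pm i'$ below them. A symmetric pseudodiagram is a picture of finitely many pairwise disjoint simple arcs (lines) and simple closed curves (loops) in the cylinder, invariant as a set under $\iota$, loops in the interior and arcs touching the boundary exactly at their endpoints, each of the $4m$ vertices being an endpoint of exactly one arc, taken up to isotopy through such symmetric pictures fixing the boundary.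 Its regions are two-coloured black/white (changing across each curve), the region containing the northern point $(1,1)$ being white; it is colouring composable (CC) if the region containing the southern point $(1,0)$ is also white. $CC_{2m}$ is the set of CC symmetric pseudodiagrams, composed by stacking (first factor above). For $D\in CC_{2m}$ let $k_D$ be the product of: $\delta$ for each mirror pair of contractible loops not crossing the reflection lines; $\delta_L$ (resp. $\kappa_L$) for each contractible loop astride the $0$-reflection line with white (resp. black) immediate interior; $\delta_R$ (resp. $\kappa_R$) for each contractible loop astride the $1$-reflection line whose immediate interior has colour white (resp. black) if $m$ is even and black (resp. white) if $m$ is odd; and $\kappa_{LR}^{\lfloor p/2\rfloor}$, where $p$ is the number of noncontractible loops. Let $r(D)$ be obtained from $D$ by deleting all contractible loops, and deleting noncontractible loops in adjacent pairs until at most one remains. $B^\phi_{2m}$ is the set of elements of $CC_{2m}$ with no contractible loops and at most one noncontractible loop; $b^\phi_{2m}(\delta,\delta_L,\delta_R,\kappa_L,\kappa_R,\kappa_{LR})$ has $K$-basis $B^\phi_{2m}$ and product $dd'=k_Dr(D)$, $D$ the concatenation of $d$ and $d'$. A propagating line of $d\in B^\phi_{2m}$ is a line joining a northern to a southern vertex; there are $2\#(d)$ of them. If $\#(d)>0$ there is a unique mirror pair of propagating lines closest to the $0$-reflection line, and the inner region of $d$ is the unique region touching both lines of this pair and containing a segment of the $0$-reflection line. $B^\phi_{2m}[0]$ is the set of $d$ with $\#(d)=0$; for $l>0$, $B^\phi_{2m}[+l]$ (resp. $B^\phi_{2m}[-l]$) is the set of $d$ with $\#(d)=l$ and black (resp.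 white) inner region. Let $T_j$ be the span of all diagrams $d$ with $\#(d)\le j$ ($T_{-1}=0$). $\mathcal S_{2m}(l)=(b^\phi_{2m}d+T_{|l|-1})/T_{|l|-1}$ for any $d\in B^\phi_{2m}[l]$; when the parameters are units this is independent of $d$ up to isomorphism. *)

theory Defs
  imports
    "HOL-Algebra.AbelCoset"
    "HOL-Library.Disjoint_Sets"
    "HOL-Library.Poly_Mapping"
    "Jordan_Normal_Form.VS_Connect"
begin

section \<open>Symmetric pseudodiagrams\<close>

text \<open>
  A symmetric picture is determined by its intersection with the closed half cylinder between the
  two reflection lines. This half cylinder is a rectangle, with north-west corner \<open>(1,1)\<close>,
  north-east corner \<open>(-1,1)\<close>, south-west corner \<open>(1,0)\<close> and south-east corner \<open>(-1,0)\<close>; the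
  0-reflection line is its west side and the 1-reflection line its east side. A curve of the
  picture either avoids the reflection lines and is disjoint from its mirror image, or is its own
  mirror image and is cut in halves by the reflection lines: an arc (from \<open>i\<close> to \<open>-i\<close>) crosses them
  once, a loop crosses them twice. So the half picture consists of disjoint curves, each of which
  is an arc between two boundary points of the rectangle or is a closed curve in its interior:

  \<^item> north or south to north or south: one line of a mirror pair of lines;

  \<^item> north or south to west (east): half of a line crossing the 0-reflection (1-reflection) line;

  \<^item> west to west (east to east): half of a contractible loop astride the 0-reflection
    (1-reflection) line;

  \<^item> west to east: half of a noncontractible loop;

  \<^item> closed curve: one loop of a mirror pair of contractible loops not crossing the lines.

  Isotopies of symmetric pictures keep the vertices fixed and let the crossing points slide along
  the reflection lines. Hence the arcs are recorded up to isotopy by a noncrossing perfect matching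
  of the boundary points, where \<open>West j\<close> and \<open>East j\<close> are the \<open>j\<close>-th crossing points on the
  0- and 1-reflection line, counted from 1 and from north to south. Of the closed curves only the
  number of mirror pairs is recorded: neither the factor nor the reduction of a pseudodiagram
  depends on where they lie.
\<close>

datatype bpoint = North nat | East nat | South nat | West nat

datatype pseudodiagram =
  Pseudodiagram (wests: nat) (easts: nat) (arcs: "bpoint set set") (loop_pairs: nat)

definition points :: "nat \<Rightarrow> pseudodiagram \<Rightarrow> bpoint set" where
  "points m D = North ` {1..m} \<union> East ` {1..easts D} \<union> South ` {1..m} \<union> West ` {1..wests D}"

text \<open>The boundary points are numbered clockwise, starting from the north-west corner.\<close>

fun pos :: "nat \<Rightarrow> pseudodiagram \<Rightarrow> bpoint \<Rightarrow> nat" where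
  "pos m D (North i) = i"
| "pos m D (East j) = m + j"
| "pos m D (South i) = 2 * m + easts D + 1 - i"
| "pos m D (West j) = 2 * m + easts D + wests D + 1 - j"

definition crossing :: "nat \<Rightarrow> pseudodiagram \<Rightarrow> bpoint set \<Rightarrow> bpoint set \<Rightarrow> bool" where
  "crossing m D c c' \<longleftrightarrow> (\<exists>a\<in>c. \<exists>b\<in>c'. \<exists>a'\<in>c. \<exists>b'\<in>c'.
     pos m D a < pos m D b \<and> pos m D b < pos m D a' \<and> pos m D a' < pos m D b')"

definition sym_pseudodiagram :: "nat \<Rightarrow> pseudodiagram \<Rightarrow> bool" where
  "sym_pseudodiagram m D \<longleftrightarrow>
     partition_on (points m D) (arcs D) \<and>
     (\<forall>c\<in>arcs D. card c = 2) \<and>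
     (\<forall>c\<in>arcs D. \<forall>c'\<in>arcs D. \<not> crossing m D c c')"

subsection \<open>Regions and their colours\<close>

text \<open>
  For \<open>g \<le> n\<close>, where \<open>n\<close> is the number of boundary points, the gap \<open>g\<close> is the segment of the
  boundary of the rectangle following clockwise on exactly \<open>g\<close> boundary points (so gaps \<open>0\<close> and
  \<open>n\<close> are parts of the same segment, the one around the north-west corner). Two gaps lie in the
  same region iff no arc separates them. Walking clockwise from the north-west corner, which is
  white, the colour changes at each boundary point.
\<close>

definition enclosed :: "nat \<Rightarrow> pseudodiagram \<Rightarrow> bpoint set \<Rightarrow> nat \<Rightarrow> bool" where
  "enclosed m D c g \<longleftrightarrow> (\<exists>a\<in>c. \<exists>b\<in>c. pos m D a \<le> g \<and> g < pos m D b)"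

definition same_region :: "nat \<Rightarrow> pseudodiagram \<Rightarrow> nat \<Rightarrow> nat \<Rightarrow> bool" where
  "same_region m D g h \<longleftrightarrow> (\<forall>c\<in>arcs D. enclosed m D c g \<longleftrightarrow> enclosed m D c h)"

definition white :: "nat \<Rightarrow> bool" where
  "white g \<longleftrightarrow> even g"

text \<open>The gap \<open>2 * m + easts D\<close> is the one around the south-west corner \<open>(1,0)\<close>.\<close>

definition CC :: "nat \<Rightarrow> pseudodiagram set" where
  "CC m = {D. sym_pseudodiagram m D \<and> white (2 * m + easts D)}"

subsection \<open>Stacking\<close>

text \<open>
  The first diagram is placed above the second one. The points \<open>South i\<close> of the first and
  \<open>North i\<close> of the second are glued to a single point \<open>Inr i\<close>; the components of the glued
  picture are the curves of the concatenation.
\<close>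

fun upper :: "bpoint \<Rightarrow> bpoint + nat" where
  "upper (South i) = Inr i"
| "upper x = Inl x"

fun lower :: "nat \<Rightarrow> nat \<Rightarrow> bpoint \<Rightarrow> bpoint + nat" where
  "lower p q (North i) = Inr i"
| "lower p q (South i) = Inl (South i)"
| "lower p q (West j) = Inl (West (p + j))"
| "lower p q (East j) = Inl (East (q + j))"

definition glued :: "pseudodiagram \<Rightarrow> pseudodiagram \<Rightarrow> (bpoint + nat) set set" where
  "glued D D' = image upper ` arcs D \<union> image (lower (wests D) (easts D)) ` arcs D'"

definition components :: "pseudodiagram \<Rightarrow> pseudodiagram \<Rightarrow> (bpoint + nat) set set" where
  "components D D' =
     \<Union>(glued D D') // {(x, y). \<exists>c\<in>glued D D'. x \<in> c \<and> y \<in> c}\<^sup>*"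

definition stack :: "pseudodiagram \<Rightarrow> pseudodiagram \<Rightarrow> pseudodiagram" where
  "stack D D' = Pseudodiagram
     (wests D + wests D')
     (easts D + easts D')
     {Inl -` C | C. C \<in> components D D' \<and> Inl -` C \<noteq> {}}
     (loop_pairs D + loop_pairs D' + card {C \<in> components D D'. Inl -` C = {}})"

subsection \<open>Loops, factor and reduction\<close>

definition west_loops :: "pseudodiagram \<Rightarrow> (nat \<times> nat) set" where
  "west_loops D = {(i, j). i < j \<and> {West i, West j} \<in> arcs D}"

definition east_loops :: "pseudodiagram \<Rightarrow> (nat \<times> nat) set" where
  "east_loops D = {(i, j). i < j \<and> {East i, East j} \<in> arcs D}"

definition noncontractible :: "pseudodiagram \<Rightarrow> bpoint set set" where
  "noncontractible D = {c \<in> arcs D. \<exists>i j. c = {West i, East j}}"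

definition contractible :: "pseudodiagram \<Rightarrow> bpoint set set" where
  "contractible D = {c \<in> arcs D. \<exists>i j. c = {West i, West j} \<or> c = {East i, East j}}"

record 'k parameters =
  \<delta> :: 'k
  \<delta>\<^sub>L :: 'k
  \<delta>\<^sub>R :: 'k
  \<kappa>\<^sub>L :: 'k
  \<kappa>\<^sub>R :: 'k
  \<kappa>\<^sub>L\<^sub>R :: 'k

text \<open>
  The immediate interior of a loop astride a reflection line meets that line just below the upper
  one \<open>i\<close> of its two crossing points \<open>i < j\<close>, i.e. in the gap preceding \<open>West i\<close> or following
  \<open>East i\<close> in clockwise order.
\<close>

definition factor :: "nat \<Rightarrow> 'k::field parameters \<Rightarrow> pseudodiagram \<Rightarrow> 'k" where
  "factor m P D =
     \<delta> P ^ loop_pairs D *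
     (\<Prod>(i, j)\<in>west_loops D. if white (pos m D (West i) - 1) then \<delta>\<^sub>L P else \<kappa>\<^sub>L P) *
     (\<Prod>(i, j)\<in>east_loops D.
        if even m
        then (if white (pos m D (East i)) then \<delta>\<^sub>R P else \<kappa>\<^sub>R P)
        else (if white (pos m D (East i)) then \<kappa>\<^sub>R P else \<delta>\<^sub>R P)) *
     \<kappa>\<^sub>L\<^sub>R P ^ (card (noncontractible D) div 2)"

text \<open>
  Deleting noncontractible loops in adjacent pairs leaves one of them if their number is odd and
  none otherwise; up to isotopy it does not matter which one is left, and we keep the northernmost.
\<close>

definition kept :: "pseudodiagram \<Rightarrow> bpoint set set" where
  "kept D = arcs D - contractible D - noncontractible D \<union>
     (if odd (card (noncontractible D))
      then {c \<in> noncontractible D. \<exists>i. West i \<in> c \<and>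
              (\<forall>i' j'. {West i', East j'} \<in> noncontractible D \<longrightarrow> i \<le> i')}
      else {})"

fun renumber :: "bpoint set \<Rightarrow> bpoint \<Rightarrow> bpoint" where
  "renumber X (West j) = West (card {i. i \<le> j \<and> West i \<in> X})"
| "renumber X (East j) = East (card {i. i \<le> j \<and> East i \<in> X})"
| "renumber X (North i) = North i"
| "renumber X (South i) = South i"

definition reduce :: "pseudodiagram \<Rightarrow> pseudodiagram" where
  "reduce D = Pseudodiagram
     (card {j. West j \<in> \<Union>(kept D)})
     (card {j. East j \<in> \<Union>(kept D)})
     (image (renumber (\<Union>(kept D))) ` kept D)
     0"

section \<open>The affine symmetric Temperley--Lieb algebra\<close>

definition Bphi :: "nat \<Rightarrow> pseudodiagram set" where
  "Bphi m = {D \<in> CC m. loop_pairs D = 0 \<and> contractible D = {} \<and> card (noncontractible D) \<le> 1}"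

definition identity_diagram :: "nat \<Rightarrow> pseudodiagram" where
  "identity_diagram m = Pseudodiagram 0 0 {{North i, South i} | i. i \<in> {1..m}} 0"

definition diagram_mult ::
  "nat \<Rightarrow> 'k::field parameters \<Rightarrow> (pseudodiagram \<Rightarrow>\<^sub>0 'k) \<Rightarrow> (pseudodiagram \<Rightarrow>\<^sub>0 'k) \<Rightarrow> (pseudodiagram \<Rightarrow>\<^sub>0 'k)"
where
  "diagram_mult m P a b = (\<Sum>d\<in>Poly_Mapping.keys a. \<Sum>d'\<in>Poly_Mapping.keys b.
     Poly_Mapping.single (reduce (stack d d'))
       (Poly_Mapping.lookup a d * Poly_Mapping.lookup b d' * factor m P (stack d d')))"

definition bphi :: "nat \<Rightarrow> 'k::field parameters \<Rightarrow> ('k, pseudodiagram \<Rightarrow>\<^sub>0 'k) module" where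
  "bphi m P = \<lparr>
     carrier = {a. Poly_Mapping.keys a \<subseteq> Bphi m},
     mult = diagram_mult m P,
     one = Poly_Mapping.single (identity_diagram m) 1,
     zero = 0,
     add = (+),
     module.smult = (\<lambda>r. Poly_Mapping.map ((*) r))\<rparr>"

subsection \<open>Propagating lines\<close>

definition propagating :: "pseudodiagram \<Rightarrow> bpoint set set" where
  "propagating d = {c \<in> arcs d. \<exists>i j. c = {North i, South j}}"

text \<open>The number of mirror pairs of propagating lines.\<close>

definition num_prop :: "pseudodiagram \<Rightarrow> nat" where
  "num_prop d = card (propagating d)"

definition closest_prop :: "pseudodiagram \<Rightarrow> nat" where
  "closest_prop d = (LEAST i. North i \<in> \<Union>(propagating d))"

text \<open>
  The regions touching the line that starts at \<open>North i\<close> are those of the gaps \<open>i - 1\<close> and \<open>i\<close> on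
  its two sides; the gaps from \<open>2 * m + easts d\<close> on are the segments of the 0-reflection line.
\<close>

definition inner_gap :: "nat \<Rightarrow> pseudodiagram \<Rightarrow> nat \<Rightarrow> bool" where
  "inner_gap m d g \<longleftrightarrow>
     g \<in> {2 * m + easts d .. 2 * m + easts d + wests d} \<and>
     (same_region m d g (closest_prop d - 1) \<or> same_region m d g (closest_prop d))"

definition Bphi_idx :: "nat \<Rightarrow> int \<Rightarrow> pseudodiagram set" where
  "Bphi_idx m l = {d \<in> Bphi m. int (num_prop d) = \<bar>l\<bar> \<and>
     (l > 0 \<longrightarrow> (\<exists>g. inner_gap m d g \<and> \<not> white g)) \<and>
     (l < 0 \<longrightarrow> (\<exists>g. inner_gap m d g \<and> white g))}"

subsection \<open>Prestandard modules\<close>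

definition Tspan :: "nat \<Rightarrow> int \<Rightarrow> (pseudodiagram \<Rightarrow>\<^sub>0 'k::field) set" where
  "Tspan m j = {a. Poly_Mapping.keys a \<subseteq> {d \<in> Bphi m. int (num_prop d) \<le> j}}"

definition left_multiples ::
  "nat \<Rightarrow> 'k::field parameters \<Rightarrow> pseudodiagram \<Rightarrow> (pseudodiagram \<Rightarrow>\<^sub>0 'k) set" where
  "left_multiples m P d =
     {a \<otimes>\<^bsub>bphi m P\<^esub> Poly_Mapping.single d 1 | a. a \<in> carrier (bphi m P)}"

text \<open>
  The quotient of a submodule \<open>U\<close> of \<open>M\<close> by a submodule \<open>T \<subseteq> U\<close>, as a vector space of cosets. The
  ring multiplication and unit in the record type of modules play no role.
\<close>

definition quotient_space :: "('k, 'v) module \<Rightarrow> 'v set \<Rightarrow> 'v set \<Rightarrow> ('k, 'v set) module" where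
  "quotient_space M U T = \<lparr>
     carrier = {T +>\<^bsub>M\<^esub> u | u. u \<in> U},
     mult = (\<lambda>_ _. undefined),
     one = undefined,
     zero = T,
     add = set_add M,
     module.smult = (\<lambda>r X. T <+>\<^bsub>M\<^esub> (module.smult M r ` X))\<rparr>"

definition prestandard ::
  "nat \<Rightarrow> 'k::field parameters \<Rightarrow> int \<Rightarrow> pseudodiagram \<Rightarrow> ('k, (pseudodiagram \<Rightarrow>\<^sub>0 'k) set) module"
where
  "prestandard m P l d = quotient_space (bphi m P)
     (left_multiples m P d <+>\<^bsub>bphi m P\<^esub> Tspan m (\<bar>l\<bar> - 1)) (Tspan m (\<bar>l\<bar> - 1))"

definition has_dimension :: "('k::field, 'v) module \<Rightarrow> nat \<Rightarrow> bool" where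
  "has_dimension V n \<longleftrightarrow>
     vectorspace class_ring V \<and> vectorspace.fin_dim class_ring V \<and> vectorspace.dim class_ring V = n"

end

theory Submission
  imports Defs
begin

text \<open>
  A product \<open>d' d\<close> either loses propagating lines or keeps the lower half of \<open>d\<close>, and then the parity
  of the number of half lines from the south to the 0-reflection line, i.e. the colour of the inner
  region, is kept as well. Conversely a diagram \<open>e\<close> with the lower half of \<open>d\<close> is, up to a unit,
  \<open>(e d\<^sup>*) d\<close>, where \<open>d\<^sup>*\<close> is \<open>d\<close> turned upside down: gluing a half to its mirror image only creates
  loops and straight lines. So the dimension is the number of upper halves with \<open>x\<close> propagating lines
  and the right parity. An upper half amounts to the set \<open>C\<close> of closing points of its northern arcs,
  which is a ballot set, and the number \<open>a\<close> of its half lines to the 0-reflection line, where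
  \<open>2 |C| + a + x \<le> m\<close> and the parity of \<open>a\<close> is prescribed. There are \<open>m choose s\<close> ballot sets
  of at most \<open>s\<close> elements, and every \<open>s \<le> k\<close> occurs once.
\<close>

subsection \<open>Quotients of spans of diagrams\<close>

text \<open>The obstacle is that \<open>stack\<close> is defined by connected components, while all
  counting is done on planar matchings: that a concatenation is again planar has to be derived. The
  vertices of the common edge are therefore glued one pair at a time, each pair being adjacent when
  its turn comes. After that no product is computed. A propagating line rules out noncontractible
  loops, so the lower half, the set \<open>C\<close> and the number \<open>a\<close> fix how many
  points lie on each reflection line and which points of the boundary close an arc, and hence the
  diagram. Equality of diagrams is proved by comparing these data. Colouring composability needs an
  even number of eastern crossing points. For a fixed lower half this follows from the parity of
  \<open>a\<close>, since the northern lines to the east number \<open>m - 2 |C| - a - x\<close>. If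
  \<open>par\<close> is 0 or 1 according to the prescribed parity of \<open>a\<close> and
  \<open>s = |C| + (a - par) / 2\<close>, the condition \<open>2 |C| + a + x \<le> m\<close> says
  that \<open>s\<close> is at most \<open>(m - x - par) / 2\<close>; the integer part of this is
  \<open>k\<close>, and the three values of \<epsilon> only encode the rounding.\<close>

lemma keys_add_subset:
  "Poly_Mapping.keys a \<subseteq> S \<Longrightarrow> Poly_Mapping.keys b \<subseteq> S \<Longrightarrow> Poly_Mapping.keys (a + b) \<subseteq> S"
  using Poly_Mapping.keys_add by fastforce

lemma keys_scale_subset:
  fixes r :: "'k::field"
  shows "Poly_Mapping.keys a \<subseteq> S \<Longrightarrow> Poly_Mapping.keys (Poly_Mapping.map ((*) r) a) \<subseteq> S"
  by (auto simp: in_keys_iff Poly_Mapping.map.rep_eq when_def split: if_splits)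

lemma lookup_scale: "Poly_Mapping.lookup (Poly_Mapping.map ((*) (r::'k::field)) a) b = r * Poly_Mapping.lookup a b"
  by (simp add: Poly_Mapping.map.rep_eq when_def)

lemma keys_uminus_subset:
  "Poly_Mapping.keys a \<subseteq> S \<Longrightarrow> Poly_Mapping.keys (- a :: 'b \<Rightarrow>\<^sub>0 'k::field) \<subseteq> S"
  by simp

text \<open>The cosets of the span of \<open>S\<close>, written without the record operations of
  \<open>bphi\<close>. Once the operations of \<open>quotient_space\<close> are expressed through
  it, the parameters and the multiplication disappear from the computation of the dimension.\<close>

definition coset :: "'b set \<Rightarrow> ('b \<Rightarrow>\<^sub>0 'k::field) \<Rightarrow> ('b \<Rightarrow>\<^sub>0 'k) set" where
  "coset S u = {v. Poly_Mapping.keys (v - u) \<subseteq> S}"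

lemma coset_eq_iff: "coset S u = coset S v \<longleftrightarrow> Poly_Mapping.keys (u - v) \<subseteq> S"
proof
  assume "coset S u = coset S v"
  moreover have "u \<in> coset S u" by (simp add: coset_def)
  ultimately show "Poly_Mapping.keys (u - v) \<subseteq> S" by (auto simp: coset_def)
next
  assume *: "Poly_Mapping.keys (u - v) \<subseteq> S"
  have "Poly_Mapping.keys (w - u) \<subseteq> S \<longleftrightarrow> Poly_Mapping.keys (w - v) \<subseteq> S" for w
    using keys_add_subset[of "w - u" S "u - v"] keys_add_subset[of "w - v" S "- (u - v)"] *
      keys_uminus_subset[OF *] by auto
  then show "coset S u = coset S v" by (simp add: coset_def)
qed

lemma a_r_coset_bphi:
  "{a. Poly_Mapping.keys a \<subseteq> S} +>\<^bsub>bphi m P\<^esub> u = coset S u" (is "?L = ?R")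
proof -
  have "v \<in> ?L" if "Poly_Mapping.keys (v - u) \<subseteq> S" for v
    unfolding a_r_coset_def' bphi_def using that by (auto intro!: exI[of _ "v - u"])
  then show ?thesis by (auto simp: a_r_coset_def' bphi_def coset_def)
qed

lemma set_add_coset:
  "coset S u <+>\<^bsub>bphi m P\<^esub> coset S v = coset S (u + v)" (is "?L = ?R")
proof
  show "?L \<subseteq> ?R"
  proof
    fix w assume "w \<in> ?L"
    then obtain a b where w: "w = a + b" and ab: "a \<in> coset S u" "b \<in> coset S v"
      by (auto simp: set_add_def' bphi_def)
    have "a + b - (u + v) = (a - u) + (b - v)" by simp
    then show "w \<in> ?R" using keys_add_subset[of "a - u" S "b - v"] ab w by (simp only: coset_def mem_Collect_eq)
  qed
  show "?R \<subseteq> ?L"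
  proof
    fix w assume "w \<in> ?R"
    then have "w - v \<in> coset S u" by (simp add: coset_def algebra_simps)
    moreover have "v \<in> coset S v" by (simp add: coset_def)
    moreover have "w = (w - v) + v" by simp
    ultimately have "\<exists>x\<in>coset S u. \<exists>y\<in>coset S v. w = x + y" by blast
    then show "w \<in> ?L" unfolding set_add_def' bphi_def by auto
  qed
qed

lemma set_add_scale_coset:
  "{a. Poly_Mapping.keys a \<subseteq> S} <+>\<^bsub>bphi m P\<^esub> (Poly_Mapping.map ((*) (r::'k::field)) ` coset S u)
    = coset S (Poly_Mapping.map ((*) r) u)" (is "?L = ?R")
proof
  show "?L \<subseteq> ?R"
  proof
    fix w assume "w \<in> ?L"
    then obtain a b where w: "w = a + Poly_Mapping.map ((*) r) b"
      and ab: "Poly_Mapping.keys a \<subseteq> S" "Poly_Mapping.keys (b - u) \<subseteq> S"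
      by (auto simp: set_add_def' bphi_def coset_def)
    have "w - Poly_Mapping.map ((*) r) u = a + Poly_Mapping.map ((*) r) (b - u)"
      unfolding w by (rule poly_mapping_eqI) (simp add: lookup_add lookup_minus lookup_scale algebra_simps)
    then show "w \<in> ?R"
      using keys_add_subset[OF ab(1) keys_scale_subset[OF ab(2)]] by (simp add: coset_def)
  qed
  show "?R \<subseteq> ?L"
  proof
    fix w assume "w \<in> ?R"
    then have "w - Poly_Mapping.map ((*) r) u \<in> {a. Poly_Mapping.keys a \<subseteq> S}" by (simp add: coset_def)
    moreover have "u \<in> coset S u" by (simp add: coset_def)
    moreover have "w = (w - Poly_Mapping.map ((*) r) u) + Poly_Mapping.map ((*) r) u" by simp
    ultimately have "\<exists>x\<in>{a. Poly_Mapping.keys a \<subseteq> S}. \<exists>y\<in>coset S u. w = x + Poly_Mapping.map ((*) r) y" by blast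
    then show "w \<in> ?L" unfolding set_add_def' bphi_def by auto
  qed
qed

text \<open>Modulo the span of \<open>S\<close>, the diagrams in \<open>R - S\<close> form a basis.
  The proof gives a linear bijection from the space of coordinate vectors, whose dimension is
  known.\<close>

lemma has_dimension_quotient_space:
  fixes P :: "'k::field parameters"
  assumes fin: "finite (R - S)"
  shows "has_dimension (quotient_space (bphi m P) {a. Poly_Mapping.keys a \<subseteq> R \<union> S}
    {a. Poly_Mapping.keys a \<subseteq> S}) (card (R - S))" (is "has_dimension ?V _")
proof -
  let ?U = "{a :: pseudodiagram \<Rightarrow>\<^sub>0 'k. Poly_Mapping.keys a \<subseteq> R \<union> S}"
  let ?n = "card (R - S)"
  have carr: "carrier ?V = coset S ` ?U" by (auto simp: quotient_space_def a_r_coset_bphi)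
  have zero: "\<zero>\<^bsub>?V\<^esub> = coset S 0" by (simp add: quotient_space_def coset_def)
  have add: "coset S u \<oplus>\<^bsub>?V\<^esub> coset S v = coset S (u + v)" for u v
    by (simp add: quotient_space_def set_add_coset)
  have smult: "r \<odot>\<^bsub>?V\<^esub> coset S u = coset S (Poly_Mapping.map ((*) r) u)" for r u
  proof -
    have "module.smult (bphi m P) r = Poly_Mapping.map ((*) r)" by (simp add: bphi_def)
    then show ?thesis by (simp add: quotient_space_def set_add_scale_coset)
  qed
  have smult_add: "Poly_Mapping.map ((*) (r::'k)) (u + v) = Poly_Mapping.map ((*) r) u + Poly_Mapping.map ((*) r) v"
    for r and u v :: "pseudodiagram \<Rightarrow>\<^sub>0 'k"
    by (rule poly_mapping_eqI) (simp add: lookup_add lookup_scale algebra_simps)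
  have add_smult: "Poly_Mapping.map ((*) (r + s::'k)) u = Poly_Mapping.map ((*) r) u + Poly_Mapping.map ((*) s) u"
    for r s and u :: "pseudodiagram \<Rightarrow>\<^sub>0 'k"
    by (rule poly_mapping_eqI) (simp add: lookup_add lookup_scale algebra_simps)
  have smult_smult: "Poly_Mapping.map ((*) (r * s::'k)) u = Poly_Mapping.map ((*) r) (Poly_Mapping.map ((*) s) u)"
    for r s and u :: "pseudodiagram \<Rightarrow>\<^sub>0 'k"
    by (rule poly_mapping_eqI) (simp add: lookup_add lookup_scale algebra_simps)
  have smult_1: "Poly_Mapping.map ((*) (1::'k)) u = u" for u :: "pseudodiagram \<Rightarrow>\<^sub>0 'k"
    by (rule poly_mapping_eqI) (simp add: lookup_scale)
  have vs: "vectorspace class_ring ?V"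
  proof (rule vs_criteria)
    show "field (class_ring :: 'k ring)" by (rule class_field)
    show "\<zero>\<^bsub>?V\<^esub> \<in> carrier ?V" unfolding carr zero by auto
    show "\<forall>v w. v \<in> carrier ?V \<and> w \<in> carrier ?V \<longrightarrow> v \<oplus>\<^bsub>?V\<^esub> w \<in> carrier ?V"
      unfolding carr by (safe, simp only: add, rule imageI, rule CollectI, rule keys_add_subset)
    show "\<forall>v\<in>carrier ?V. \<exists>w\<in>carrier ?V. v \<oplus>\<^bsub>?V\<^esub> w = \<zero>\<^bsub>?V\<^esub>"
    proof
      fix v assume "v \<in> carrier ?V"
      then obtain u where "u \<in> ?U" "v = coset S u" unfolding carr by auto
      then show "\<exists>w\<in>carrier ?V. v \<oplus>\<^bsub>?V\<^esub> w = \<zero>\<^bsub>?V\<^esub>"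
        unfolding carr by (intro bexI[of _ "coset S (- u)"]) (auto simp: add zero)
    qed
    show "\<forall>c v. c \<in> carrier class_ring \<and> v \<in> carrier ?V \<longrightarrow> c \<odot>\<^bsub>?V\<^esub> v \<in> carrier ?V"
      unfolding carr by (auto simp: smult intro!: imageI keys_scale_subset)
  qed (unfold carr, auto simp: add smult zero smult_add add_smult smult_smult smult_1 ac_simps)
  obtain g where g: "bij_betw g {0..<?n} (R - S)" using ex_bij_betw_nat_finite[OF fin] by auto
  \<comment> \<open>Each coset has exactly one representative supported on \<open>R - S\<close>;
    \<open>h\<close> builds it from its coordinates.\<close>
  define h where "h v = (\<Sum>i<?n. Poly_Mapping.single (g i) (v $ i))" for v :: "'k vec"
  have lookup_h: "Poly_Mapping.lookup (h v) (g i) = v $ i" if "i < ?n" for v i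
  proof -
    have inj: "g j = g i \<longleftrightarrow> j = i" if "j < ?n" for j
      using g that \<open>i < ?n\<close> by (auto simp: bij_betw_def inj_on_def)
    have "Poly_Mapping.lookup (h v) (g i) = (\<Sum>j<?n. if j = i then v $ j else 0)"
      unfolding h_def lookup_sum by (intro sum.cong refl) (simp add: lookup_single when_def inj)
    then show ?thesis using that by simp
  qed
  have h_out: "Poly_Mapping.lookup (h v) b = 0" if "b \<notin> R - S" for v b
  proof -
    have "g i \<noteq> b" if "i < ?n" for i using g that \<open>b \<notin> R - S\<close> by (auto simp: bij_betw_def)
    then show ?thesis unfolding h_def lookup_sum by (intro sum.neutral) (auto simp: lookup_single when_def)
  qed
  have surj_g: "\<exists>i<?n. b = g i" if "b \<in> R - S" for b
  proof -
    have "b \<in> g ` {0..<?n}" using g that by (simp add: bij_betw_def)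
    then show ?thesis by auto
  qed
  have h_eqI: "h v = u" if "\<And>i. i < ?n \<Longrightarrow> Poly_Mapping.lookup u (g i) = v $ i"
    "\<And>b. b \<notin> R - S \<Longrightarrow> Poly_Mapping.lookup u b = 0" for u v
  proof (rule poly_mapping_eqI)
    fix b show "Poly_Mapping.lookup (h v) b = Poly_Mapping.lookup u b"
      using that surj_g[of b] h_out[of b v] lookup_h[of _ v] by (cases "b \<in> R - S") auto
  qed
  have keys_h: "Poly_Mapping.keys (h v) \<subseteq> R \<union> S" for v
    using h_out[of _ v] by (auto simp: in_keys_iff)
  interpret V: vectorspace class_ring ?V by (rule vs)
  interpret W: vec_space "TYPE('k)" ?n .
  have lin: "linear_map class_ring (module_vec TYPE('k) ?n) ?V (\<lambda>v. coset S (h v))"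
  proof -
    have "h (r \<cdot>\<^sub>v u) = Poly_Mapping.map ((*) r) (h u)" if "u \<in> carrier_vec ?n" for r u
      using that by (intro h_eqI) (auto simp: lookup_scale lookup_h h_out)
    moreover have "h (u + v) = h u + h v" if "u \<in> carrier_vec ?n" "v \<in> carrier_vec ?n" for u v
      using that by (intro h_eqI) (auto simp: lookup_add lookup_h h_out)
    moreover have "coset S (h u) \<in> carrier ?V" for u
      unfolding carr using keys_h by auto
    ultimately have "(\<lambda>v. coset S (h v)) \<in> LinearCombinations.module_hom class_ring (module_vec TYPE('k) ?n) ?V"
      unfolding LinearCombinations.module_hom_def by (auto simp: add smult module_vec_simps)
    then show ?thesis by unfold_locales
  qed
  interpret L: linear_map class_ring "module_vec TYPE('k) ?n" ?V "\<lambda>v. coset S (h v)" by (rule lin)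
  have "inj_on (\<lambda>v. coset S (h v)) (carrier_vec ?n)"
  proof (rule inj_onI)
    fix u v :: "'k vec" assume uv: "u \<in> carrier_vec ?n" "v \<in> carrier_vec ?n" and "coset S (h u) = coset S (h v)"
    then have k: "Poly_Mapping.keys (h u - h v) \<subseteq> S" by (simp add: coset_eq_iff)
    have "u $ i = v $ i" if "i < ?n" for i
    proof -
      have "g i \<notin> S" using g that by (auto simp: bij_betw_def)
      then have "g i \<notin> Poly_Mapping.keys (h u - h v)" using k by auto
      then show ?thesis using that by (simp add: in_keys_iff lookup_minus lookup_h)
    qed
    then show "u = v" using uv by auto
  qed
  moreover have "(\<lambda>v. coset S (h v)) ` carrier_vec ?n = carrier ?V"
  proof
    show "(\<lambda>v. coset S (h v)) ` carrier_vec ?n \<subseteq> carrier ?V" unfolding carr using keys_h by auto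
    show "carrier ?V \<subseteq> (\<lambda>v. coset S (h v)) ` carrier_vec ?n"
    proof
      fix w assume "w \<in> carrier ?V"
      then obtain u where u: "Poly_Mapping.keys u \<subseteq> R \<union> S" "w = coset S u" unfolding carr by auto
      let ?v = "vec ?n (\<lambda>i. Poly_Mapping.lookup u (g i))"
      have "Poly_Mapping.lookup (h ?v - u) b = 0" if "b \<notin> S" for b
      proof (cases "b \<in> R")
        case True
        then have "b \<in> R - S" using that by simp
        then obtain i where "i < ?n" "b = g i" using surj_g by blast
        then show ?thesis by (simp add: lookup_minus lookup_h)
      next
        case False
        then show ?thesis using u(1) that by (auto simp: lookup_minus h_out in_keys_iff)
      qed
      then have "Poly_Mapping.keys (h ?v - u) \<subseteq> S" by (auto simp: in_keys_iff)
      then show "w \<in> (\<lambda>v. coset S (h v)) ` carrier_vec ?n"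
        using u(2) by (intro image_eqI[of _ _ ?v]) (auto simp: coset_eq_iff[symmetric])
    qed
  qed
  ultimately have "W.dim = V.dim" "V.fin_dim"
    using L.dim_eq[OF W.fin_dim] L.surj_fin_dim[OF W.fin_dim] by (auto simp: module_vec_simps)
  then show ?thesis using vs W.dim_is_n by (simp add: has_dimension_def)
qed

section \<open>Left multiples of a diagram, with units as parameters\<close>

lemma factor_nonzero:
  assumes "\<delta> P \<noteq> 0" "\<delta>\<^sub>L P \<noteq> 0" "\<delta>\<^sub>R P \<noteq> 0" "\<kappa>\<^sub>L P \<noteq> 0" "\<kappa>\<^sub>R P \<noteq> 0" "\<kappa>\<^sub>L\<^sub>R P \<noteq> 0"
  shows "factor m P D \<noteq> 0"
proof -
  \<comment> \<open>For an arbitrary record \<open>D\<close> the sets of astride loops may be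
    infinite; a product over an infinite set is 1 by convention, so the claim covers this case as
    well.\<close>
  have "prod f A \<noteq> 0" if "\<And>x. f x \<noteq> 0" for f :: "nat \<times> nat \<Rightarrow> 'a" and A
    using that by (induction A rule: infinite_finite_induct) auto
  then have "(\<Prod>(i, j)\<in>west_loops D. if white (pos m D (West i) - 1) then \<delta>\<^sub>L P else \<kappa>\<^sub>L P) \<noteq> 0"
    "(\<Prod>(i, j)\<in>east_loops D.
        if even m
        then (if white (pos m D (East i)) then \<delta>\<^sub>R P else \<kappa>\<^sub>R P)
        else (if white (pos m D (East i)) then \<kappa>\<^sub>R P else \<delta>\<^sub>R P)) \<noteq> 0"
    using assms by (auto simp: case_prod_beta)
  then show ?thesis using assms by (simp add: factor_def)
qed

text \<open>Multiplying a basis diagram by \<open>d\<close> yields a nonzero multiple of a single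
  diagram. So the left multiples are spanned by the diagrams that are reached, and one preimage of
  each suffices, even if several diagrams have the same product with \<open>d\<close>.\<close>

lemma left_multiples_add_span:
  fixes P :: "'k::field parameters"
  assumes "\<And>D. factor m P D \<noteq> 0"
  shows "left_multiples m P d <+>\<^bsub>bphi m P\<^esub> {a. Poly_Mapping.keys a \<subseteq> S} =
    {a. Poly_Mapping.keys a \<subseteq> (\<lambda>d'. reduce (stack d' d)) ` Bphi m \<union> S}" (is "?L = ?R")
proof -
  define R where "R = (\<lambda>d'. reduce (stack d' d)) ` Bphi m"
  define \<phi> where "\<phi> a = (\<Sum>d'\<in>Poly_Mapping.keys a. Poly_Mapping.single (reduce (stack d' d))
    (Poly_Mapping.lookup a d' * factor m P (stack d' d)))" for a :: "pseudodiagram \<Rightarrow>\<^sub>0 'k"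
  have \<phi>: "a \<otimes>\<^bsub>bphi m P\<^esub> Poly_Mapping.single d 1 = \<phi> a" for a
    by (simp add: bphi_def diagram_mult_def \<phi>_def)
  \<comment> \<open>The sums for \<open>a\<close>, \<open>b\<close> and \<open>a + b\<close> run
    over different supports; extending them to a common finite set only adds zero terms.\<close>
  have \<phi>_super: "\<phi> a = (\<Sum>d'\<in>A. Poly_Mapping.single (reduce (stack d' d))
    (Poly_Mapping.lookup a d' * factor m P (stack d' d)))" if "finite A" "Poly_Mapping.keys a \<subseteq> A" for a A
    unfolding \<phi>_def using that by (intro sum.mono_neutral_left) (auto simp: in_keys_iff)
  have \<phi>_add: "\<phi> (a + b) = \<phi> a + \<phi> b" for a b
  proof -
    let ?A = "Poly_Mapping.keys a \<union> Poly_Mapping.keys b"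
    have "finite ?A" by simp
    then have eq: "\<phi> a = (\<Sum>d'\<in>?A. Poly_Mapping.single (reduce (stack d' d)) (Poly_Mapping.lookup a d' * factor m P (stack d' d)))"
      "\<phi> b = (\<Sum>d'\<in>?A. Poly_Mapping.single (reduce (stack d' d)) (Poly_Mapping.lookup b d' * factor m P (stack d' d)))"
      "\<phi> (a + b) = (\<Sum>d'\<in>?A. Poly_Mapping.single (reduce (stack d' d)) (Poly_Mapping.lookup (a + b) d' * factor m P (stack d' d)))"
      by (rule \<phi>_super; use Poly_Mapping.keys_add[of a b] in auto)+
    show ?thesis unfolding eq by (simp add: sum.distrib lookup_add distrib_right single_add)
  qed
  have \<phi>_0: "\<phi> 0 = 0" by (simp add: \<phi>_def)
  have \<phi>_sum: "\<phi> (sum f A) = (\<Sum>x\<in>A. \<phi> (f x))" for f :: "pseudodiagram \<Rightarrow> _" and A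
    by (induction A rule: infinite_finite_induct) (auto simp: \<phi>_0 \<phi>_add)
  have keys_\<phi>: "Poly_Mapping.keys (\<phi> a) \<subseteq> R" if "Poly_Mapping.keys a \<subseteq> Bphi m" for a
  proof -
    have "b \<in> R" if "Poly_Mapping.lookup (\<phi> a) b \<noteq> 0" for b
    proof (rule ccontr)
      assume "b \<notin> R"
      then have "reduce (stack d' d) \<noteq> b" if "d' \<in> Poly_Mapping.keys a" for d'
        using that \<open>Poly_Mapping.keys a \<subseteq> Bphi m\<close> by (auto simp: R_def)
      then have "Poly_Mapping.lookup (\<phi> a) b = 0"
        unfolding \<phi>_def lookup_sum by (intro sum.neutral) (auto simp: lookup_single when_def)
      then show False using that by simp
    qed
    then show ?thesis by (auto simp: in_keys_iff)
  qed
  have L: "?L = {\<phi> a + b | a b. Poly_Mapping.keys a \<subseteq> Bphi m \<and> Poly_Mapping.keys b \<subseteq> S}"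
  proof -
    have "left_multiples m P d = \<phi> ` {a. Poly_Mapping.keys a \<subseteq> Bphi m}"
      unfolding left_multiples_def \<phi> by (auto simp: bphi_def)
    moreover have "add (bphi m P) = (+)" by (simp add: bphi_def)
    ultimately show ?thesis by (auto simp: set_add_def')
  qed
  have "u \<in> ?L" if u: "Poly_Mapping.keys u \<subseteq> R \<union> S" for u
  proof -
    define K where "K = Poly_Mapping.keys u \<inter> R"
    have "\<forall>e\<in>R. \<exists>d'\<in>Bphi m. e = reduce (stack d' d)" by (auto simp: R_def)
    then obtain g where g: "\<And>e. e \<in> R \<Longrightarrow> g e \<in> Bphi m" "\<And>e. e \<in> R \<Longrightarrow> reduce (stack (g e) d) = e"
      by metis
    \<comment> \<open>One preimage \<open>g e\<close> is used for each \<open>e\<close>, and its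
      coefficient is divided by the factor of the concatenation. So \<phi> sends \<open>a\<close> to
      the part of \<open>u\<close> supported on \<open>R\<close>, and the remainder of
      \<open>u\<close> lies in the span of \<open>S\<close>.\<close>
    define a where "a = (\<Sum>e\<in>K. Poly_Mapping.single (g e) (Poly_Mapping.lookup u e / factor m P (stack (g e) d)))"
    have single: "\<phi> (Poly_Mapping.single (g e) (c / factor m P (stack (g e) d))) = Poly_Mapping.single e c"
      if "e \<in> R" for e c
      using that by (subst \<phi>_super[of "{g e}"]) (auto simp: g assms)
    have a: "\<phi> a = (\<Sum>e\<in>K. Poly_Mapping.single e (Poly_Mapping.lookup u e))"
      unfolding a_def \<phi>_sum by (intro sum.cong refl single) (simp add: K_def)
    have "finite K" by (simp add: K_def)
    have look: "Poly_Mapping.lookup (\<phi> a) b = (if b \<in> K then Poly_Mapping.lookup u b else 0)" for b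
    proof -
      have "Poly_Mapping.lookup (\<phi> a) b = (\<Sum>e\<in>K. if e = b then Poly_Mapping.lookup u e else 0)"
        unfolding a lookup_sum by (intro sum.cong refl) (simp add: lookup_single when_def)
      then show ?thesis using \<open>finite K\<close> by simp
    qed
    have "Poly_Mapping.keys (u - \<phi> a) \<subseteq> S"
      using u by (auto simp: in_keys_iff lookup_minus look K_def split: if_splits)
    moreover have "Poly_Mapping.keys a \<subseteq> Bphi m"
    proof -
      have "Poly_Mapping.lookup a b = 0" if "b \<notin> Bphi m" for b
        unfolding a_def lookup_sum using that g(1) by (intro sum.neutral) (auto simp: lookup_single when_def K_def)
      then show ?thesis by (auto simp: in_keys_iff)
    qed
    moreover have "u = \<phi> a + (u - \<phi> a)" by simp
    ultimately show ?thesis unfolding L by blast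
  qed
  moreover have "Poly_Mapping.keys u \<subseteq> R \<union> S" if "u \<in> ?L" for u
  proof -
    from that have "\<exists>a b. u = \<phi> a + b \<and> Poly_Mapping.keys a \<subseteq> Bphi m \<and> Poly_Mapping.keys b \<subseteq> S"
      unfolding L by blast
    then obtain a b where ab: "u = \<phi> a + b" "Poly_Mapping.keys a \<subseteq> Bphi m" "Poly_Mapping.keys b \<subseteq> S"
      by blast
    show ?thesis unfolding ab(1) using keys_\<phi>[OF ab(2)] ab(3) by (intro keys_add_subset) auto
  qed
  ultimately show ?thesis unfolding R_def[symmetric] by blast
qed

subsection \<open>Gluing in the plane\<close>

text \<open>The relation \<open>r\<close> is meant to be an equivalence on the whole type, in which
  points already glued may remain; only its restriction to \<open>X\<close> is a pairing.
  Noncrossing is put as follows: \<open>u\<close> separates \<open>a\<close> from \<open>c\<close>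
  exactly if \<open>v\<close> does. In this form the ends of an arc are interchangeable, and the
  conditions of two arcs that are joined at a point can be chained.\<close>

definition noncrossing_pairing :: "('a \<Rightarrow> nat) \<Rightarrow> 'a set \<Rightarrow> ('a \<Rightarrow> 'a \<Rightarrow> bool) \<Rightarrow> bool" where
  "noncrossing_pairing f X r \<longleftrightarrow>
     (\<forall>x\<in>X. \<exists>!y. y \<in> X \<and> y \<noteq> x \<and> r x y) \<and>
     (\<forall>a\<in>X. \<forall>c\<in>X. \<forall>u\<in>X. \<forall>v\<in>X. r a c \<longrightarrow> r u v \<longrightarrow> a \<notin> {u, v} \<longrightarrow> c \<notin> {u, v} \<longrightarrow>
        ((f a < f u \<longleftrightarrow> f c < f u) \<longleftrightarrow> (f a < f v \<longleftrightarrow> f c < f v)))"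

text \<open>For an equivalence \<open>r\<close> this is the equivalence generated by
  \<open>r\<close> and the pair \<open>(s, t)\<close>, in closed form.\<close>

definition merge :: "'a \<Rightarrow> 'a \<Rightarrow> ('a \<Rightarrow> 'a \<Rightarrow> bool) \<Rightarrow> 'a \<Rightarrow> 'a \<Rightarrow> bool" where
  "merge s t r x y \<longleftrightarrow> r x y \<or> r x s \<and> r t y \<or> r x t \<and> r s y"

lemma equivp_merge:
  assumes "equivp r" shows "equivp (merge s t r)"
proof (rule equivpI)
  show "reflp (merge s t r)" using equivp_reflp[OF assms] by (auto simp: merge_def reflp_def)
  show "symp (merge s t r)" using equivp_symp[OF assms] by (auto simp: merge_def symp_def)
  show "transp (merge s t r)"
    using equivp_transp[OF assms] equivp_symp[OF assms] unfolding merge_def transp_def by meson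
qed

text \<open>Gluing two neighbours keeps a picture planar. Every remaining point lies on the same
  side of \<open>s\<close> and of \<open>t\<close>, so the condition for an arc that runs from
  \<open>a\<close> through the gluing to \<open>c\<close> is the combination of the conditions for
  its two pieces.\<close>

lemma noncrossing_pairing_merge:
  assumes r: "equivp r" and nc: "noncrossing_pairing f X r" and inj: "inj_on f X"
    and st: "s \<in> X" "t \<in> X" "f s < f t" and adj: "\<And>z. z \<in> X \<Longrightarrow> \<not> (f s < f z \<and> f z < f t)"
  shows "noncrossing_pairing f (X - {s, t}) (merge s t r)"
proof -
  have sym: "r x y \<Longrightarrow> r y x" for x y using equivp_symp[OF r] .
  have trans: "r x y \<Longrightarrow> r y z \<Longrightarrow> r x z" for x y z using equivp_transp[OF r] .
  have ex: "\<exists>y. y \<in> X \<and> y \<noteq> x \<and> r x y" if "x \<in> X" for x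
    using nc that unfolding noncrossing_pairing_def by blast
  have uniq: "y = z" if "x \<in> X" "y \<in> X" "z \<in> X" "y \<noteq> x" "z \<noteq> x" "r x y" "r x z" for x y z
    using nc that unfolding noncrossing_pairing_def by blast
  have "s \<noteq> t" using st(3) by auto
  have pairing: "\<exists>!y. y \<in> X - {s, t} \<and> y \<noteq> x \<and> merge s t r x y" if x: "x \<in> X - {s, t}" for x
  proof -
    obtain y where y: "y \<in> X" "y \<noteq> x" "r x y" using ex[of x] x by auto
    \<comment> \<open>If \<open>x\<close> was paired with one of the glued points, its new partner
      is the old partner \<open>q\<close> of the other one. The names \<open>s'\<close> and
      \<open>t'\<close> cover both orders.\<close>
    have aux: "\<exists>!y. y \<in> X - {s, t} \<and> y \<noteq> x \<and> merge s t r x y"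
      if xs: "r x s'" and st': "s' \<in> X" "t' \<in> X" "s' \<noteq> t'" "{s, t} = {s', t'}" for s' t'
    proof -
      obtain q where q: "q \<in> X" "q \<noteq> t'" "r t' q" using ex[of t'] st' by auto
      have ne: "x \<noteq> s'" "x \<noteq> t'" using x st' by auto
      have nxt: "\<not> r x t'" using uniq[of x s' t'] xs ne st' x by auto
      then have qx: "q \<noteq> x" using q(3) sym by blast
      have qs: "q \<noteq> s'" using q(3) nxt xs trans sym by blast
      have mq: "merge s t r x q"
        using xs q(3) st'(3,4) unfolding merge_def by (metis doubleton_eq_iff)
      have zq: "z = q" if "z \<in> X - {s, t}" "z \<noteq> x" "merge s t r x z" for z
      proof -
        have z: "z \<in> X" "z \<noteq> s'" "z \<noteq> t'" using that(1) st'(4) by auto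
        have "\<not> r x z" using uniq[of x s' z] xs ne z that(2) x st' by auto
        then have "r t' z" using that(3) nxt st'(4) unfolding merge_def by (metis doubleton_eq_iff)
        then show "z = q" using uniq[of t' z q] z q st' by auto
      qed
      have "q \<in> X - {s, t}" unfolding st'(4) using q(1,2) qs by simp
      then show ?thesis using qx mq zq by blast
    qed
    consider "y = s" | "y = t" | "y \<notin> {s, t}" by auto
    then show ?thesis
    proof cases
      case 1 then show ?thesis using aux[of s t] y st \<open>s \<noteq> t\<close> by auto
    next
      case 2 then show ?thesis using aux[of t s] y st \<open>s \<noteq> t\<close> by auto
    next
      case 3
      have "\<not> r x s" "\<not> r x t" using uniq[of x y s] uniq[of x y t] y x 3 st by auto
      then have "merge s t r x z \<longleftrightarrow> r x z" for z by (auto simp: merge_def)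
      then show ?thesis using y 3 uniq[of x] x by (intro ex1I[of _ y]) auto
    qed
  qed
  have N: "(f a < f u \<longleftrightarrow> f c < f u) \<longleftrightarrow> (f a < f v \<longleftrightarrow> f c < f v)"
    if "a \<in> X" "c \<in> X" "u \<in> X" "v \<in> X" "r a c" "r u v" "a \<notin> {u, v}" "c \<notin> {u, v}" for a c u v
    using nc that unfolding noncrossing_pairing_def by blast
  \<comment> \<open>No point of \<open>X\<close> lies between \<open>s\<close> and \<open>t\<close>,
    so a comparison with either of them has the same outcome.\<close>
  have adj': "(f s < f x \<longleftrightarrow> f t < f x) \<and> (f x < f s \<longleftrightarrow> f x < f t)" if "x \<in> X - {s, t}" for x
  proof -
    have "f x \<noteq> f s" "f x \<noteq> f t" using inj st that by (auto simp: inj_on_def)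
    then show ?thesis using adj[of x] that st(3) by force
  qed
  have "(f a < f u \<longleftrightarrow> f c < f u) \<longleftrightarrow> (f a < f v \<longleftrightarrow> f c < f v)"
    if X: "a \<in> X - {s, t}" "c \<in> X - {s, t}" "u \<in> X - {s, t}" "v \<in> X - {s, t}"
      and m: "merge s t r a c" "merge s t r u v" and ne: "a \<notin> {u, v}" "c \<notin> {u, v}" for a c u v
  proof -
    have aX: "a \<in> X" "c \<in> X" "u \<in> X" "v \<in> X" using X by auto
    note A = adj'[OF X(1)] adj'[OF X(2)] adj'[OF X(3)] adj'[OF X(4)]
    consider "r a c" "r u v" | "r a c" "r u s" "r v t" | "r a c" "r u t" "r v s"
      | "r u v" "r a s" "r c t" | "r u v" "r a t" "r c s"
      | s' t' where "r a s'" "r c t'" "r u s' \<and> r v t' \<or> r u t' \<and> r v s'" "{s', t'} = {s, t}"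
      using m sym unfolding merge_def by blast
    then show ?thesis
    proof cases
      case 1 then show ?thesis using N aX ne by blast
    next
      case 2
      then have "(f a < f u \<longleftrightarrow> f c < f u) \<longleftrightarrow> (f a < f s \<longleftrightarrow> f c < f s)"
        "(f a < f v \<longleftrightarrow> f c < f v) \<longleftrightarrow> (f a < f t \<longleftrightarrow> f c < f t)"
        using N[of a c u s] N[of a c v t] aX X ne st by blast+
      then show ?thesis using A by blast
    next
      case 3
      then have "(f a < f u \<longleftrightarrow> f c < f u) \<longleftrightarrow> (f a < f t \<longleftrightarrow> f c < f t)"
        "(f a < f v \<longleftrightarrow> f c < f v) \<longleftrightarrow> (f a < f s \<longleftrightarrow> f c < f s)"
        using N[of a c u t] N[of a c v s] aX X ne st by blast+
      then show ?thesis using A by blast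
    next
      case 4
      then have "(f a < f u \<longleftrightarrow> f s < f u) \<longleftrightarrow> (f a < f v \<longleftrightarrow> f s < f v)"
        "(f c < f u \<longleftrightarrow> f t < f u) \<longleftrightarrow> (f c < f v \<longleftrightarrow> f t < f v)"
        using N[of a s u v] N[of c t u v] aX X ne st by blast+
      then show ?thesis using A by blast
    next
      case 5
      then have "(f a < f u \<longleftrightarrow> f t < f u) \<longleftrightarrow> (f a < f v \<longleftrightarrow> f t < f v)"
        "(f c < f u \<longleftrightarrow> f s < f u) \<longleftrightarrow> (f c < f v \<longleftrightarrow> f s < f v)"
        using N[of a t u v] N[of c s u v] aX X ne st by blast+
      then show ?thesis using A by blast
    next
      \<comment> \<open>Both arcs would run through the gluing. Then \<open>s'\<close> is joined to
        \<open>a\<close> and to \<open>u\<close> or \<open>v\<close>, so by uniqueness of partners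
        the two arcs share an end.\<close>
      case 6
      then have s't': "s' \<in> X" "t' \<in> X" "a \<noteq> s'" "a \<noteq> t'" "c \<noteq> s'" "c \<noteq> t'" "u \<noteq> s'" "u \<noteq> t'" "v \<noteq> s'" "v \<noteq> t'"
        using X st by (auto simp: doubleton_eq_iff)
      have "r s' a" using 6 sym by blast
      moreover have "r s' u \<or> r s' v" using 6 sym by blast
      ultimately have "a = u \<or> a = v" using uniq[of s' a u] uniq[of s' a v] aX s't' by blast
      then show ?thesis using ne by auto
    qed
  qed
  then show ?thesis unfolding noncrossing_pairing_def by (intro conjI ballI impI pairing)
qed

subsection \<open>Diagrams\<close>

lemma finite_points: "finite (points m D)"
  by (simp add: points_def)

lemma inj_on_pos: "inj_on (pos m D) (points m D)"
  unfolding inj_on_def points_def by (auto; linarith)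

lemma sym_arc:
  assumes "sym_pseudodiagram m D" "c \<in> arcs D"
  obtains a b where "c = {a, b}" "a \<noteq> b" "a \<in> points m D" "b \<in> points m D"
proof -
  have "card c = 2" "c \<subseteq> points m D" using assms unfolding sym_pseudodiagram_def partition_on_def by auto
  then show thesis using that by (auto simp: card_2_iff)
qed

lemma sym_unique:
  assumes "sym_pseudodiagram m D" "{a, b} \<in> arcs D" "{a, b'} \<in> arcs D"
  shows "b = b'"
proof -
  have "disjoint (arcs D)" using assms unfolding sym_pseudodiagram_def partition_on_def by auto
  then have "{a, b} = {a, b'}" using disjointD[of "arcs D" "{a, b}" "{a, b'}"] assms(2,3) by blast
  then show ?thesis by (auto simp: doubleton_eq_iff)
qed

lemma sym_in_points:
  assumes "sym_pseudodiagram m D" "{a, b} \<in> arcs D"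
  shows "a \<in> points m D" "b \<in> points m D" "a \<noteq> b"
proof -
  have "card {a, b} = 2" "{a, b} \<subseteq> points m D"
    using assms unfolding sym_pseudodiagram_def partition_on_def by auto
  then show "a \<in> points m D" "b \<in> points m D" "a \<noteq> b" by auto
qed

lemma sym_ex:
  assumes "sym_pseudodiagram m D" "a \<in> points m D"
  obtains b where "{a, b} \<in> arcs D" "b \<in> points m D" "a \<noteq> b"
proof -
  have "\<Union>(arcs D) = points m D" using assms unfolding sym_pseudodiagram_def partition_on_def by auto
  then obtain c where c: "c \<in> arcs D" "a \<in> c" using assms by auto
  then obtain a' b' where ab: "c = {a', b'}" "a' \<noteq> b'" "a' \<in> points m D" "b' \<in> points m D"
    using sym_arc assms by metis
  show thesis
  proof (cases "a = a'")
    case True then show thesis using that[of b'] c ab by auto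
  next
    case False
    then have "c = {a, a'}" "a = b'" using c(2) ab(1) by auto
    then show thesis using that[of a'] c ab by auto
  qed
qed

text \<open>The eight excluded chains are the orders in which the pairs \<open>p, q\<close> and
  \<open>s, t\<close> interleave. This passes from the chains of \<open>crossing\<close> to the
  separation form of \<open>noncrossing_pairing\<close>.\<close>

lemma noncrossing_xor:
  fixes p q s t :: nat
  assumes "p \<noteq> s" "p \<noteq> t" "q \<noteq> s" "q \<noteq> t"
    "\<not> (p < s \<and> s < q \<and> q < t)" "\<not> (s < p \<and> p < t \<and> t < q)"
    "\<not> (p < t \<and> t < q \<and> q < s)" "\<not> (t < p \<and> p < s \<and> s < q)"
    "\<not> (q < s \<and> s < p \<and> p < t)" "\<not> (s < q \<and> q < t \<and> t < p)"
    "\<not> (q < t \<and> t < p \<and> p < s)" "\<not> (t < q \<and> q < s \<and> s < p)"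
  shows "(p < s \<longleftrightarrow> q < s) \<longleftrightarrow> (p < t \<longleftrightarrow> q < t)"
  using assms by (smt (verit) nat_neq_iff less_trans)

lemma sym_noncrossing:
  assumes "sym_pseudodiagram m D" "{a, c} \<in> arcs D" "{u, v} \<in> arcs D" "a \<notin> {u, v}" "c \<notin> {u, v}"
  shows "(pos m D a < pos m D u \<longleftrightarrow> pos m D c < pos m D u) \<longleftrightarrow> (pos m D a < pos m D v \<longleftrightarrow> pos m D c < pos m D v)"
proof -
  have X: "a \<in> points m D" "c \<in> points m D" "u \<in> points m D" "v \<in> points m D"
    using sym_in_points assms by blast+
  have ne: "pos m D a \<noteq> pos m D u" "pos m D a \<noteq> pos m D v" "pos m D c \<noteq> pos m D u" "pos m D c \<noteq> pos m D v"
    using X assms(4,5) inj_on_pos[of m D] by (auto simp: inj_on_def)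
  have "\<not> crossing m D {a, c} {u, v}" "\<not> crossing m D {u, v} {a, c}"
    using assms(1-3) unfolding sym_pseudodiagram_def by auto
  then have "\<not> (pos m D x < pos m D y \<and> pos m D y < pos m D z \<and> pos m D z < pos m D w)"
    "\<not> (pos m D y < pos m D x \<and> pos m D x < pos m D w \<and> pos m D w < pos m D z)"
    if "x \<in> {a, c}" "z \<in> {a, c}" "y \<in> {u, v}" "w \<in> {u, v}" for x y z w
    unfolding crossing_def using that by blast+
  from this[of a c u v] this[of a c v u] this[of c a u v] this[of c a v u] ne
  show ?thesis by (intro noncrossing_xor) auto
qed

lemma sym_pseudodiagramI:
  assumes arc: "\<And>c. c \<in> arcs D \<Longrightarrow> \<exists>a b. c = {a, b} \<and> a \<noteq> b \<and> a \<in> points m D \<and> b \<in> points m D"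
    and ex: "\<And>a. a \<in> points m D \<Longrightarrow> \<exists>b. {a, b} \<in> arcs D"
    and uniq: "\<And>a b b'. {a, b} \<in> arcs D \<Longrightarrow> {a, b'} \<in> arcs D \<Longrightarrow> b = b'"
    and nc: "\<And>a b c d. {a, c} \<in> arcs D \<Longrightarrow> {b, d} \<in> arcs D \<Longrightarrow> pos m D a < pos m D b \<Longrightarrow>
      pos m D b < pos m D c \<Longrightarrow> pos m D c < pos m D d \<Longrightarrow> False"
  shows "sym_pseudodiagram m D"
proof -
  have two: "card c = 2" if "c \<in> arcs D" for c using arc[OF that] by (auto simp: card_2_iff)
  have pair: "c = {x, y}" if "c \<in> arcs D" "x \<in> c" "y \<in> c" "x \<noteq> y" for c x y
    using arc[OF that(1)] that by auto
  have "partition_on (points m D) (arcs D)"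
    unfolding partition_on_def
  proof (intro conjI disjointI)
    show "\<Union>(arcs D) = points m D"
    proof
      show "\<Union>(arcs D) \<subseteq> points m D" using arc by fastforce
      show "points m D \<subseteq> \<Union>(arcs D)" 
      proof
        fix a assume "a \<in> points m D"
        then obtain b where "{a, b} \<in> arcs D" using ex by blast
        then show "a \<in> \<Union>(arcs D)" by blast
      qed
    qed
    show "{} \<notin> arcs D" using two by force
    show "p \<inter> q = {}" if pq: "p \<in> arcs D" "q \<in> arcs D" "p \<noteq> q" for p q
    proof (rule ccontr)
      assume "p \<inter> q \<noteq> {}"
      then obtain x where x: "x \<in> p" "x \<in> q" by auto
      obtain y z where "p = {x, y}" "q = {x, z}" using arc[OF pq(1)] arc[OF pq(2)] x by (auto simp: insert_commute)
      then show False using uniq[of x y z] pq by auto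
    qed
  qed
  moreover have "\<not> crossing m D c c'" if cc: "c \<in> arcs D" "c' \<in> arcs D" for c c'
  proof
    assume "crossing m D c c'"
    then obtain a b a' b' where ab: "a \<in> c" "b \<in> c'" "a' \<in> c" "b' \<in> c'" and
      lt: "pos m D a < pos m D b" "pos m D b < pos m D a'" "pos m D a' < pos m D b'"
      unfolding crossing_def by blast
    have "c = {a, a'}" "c' = {b, b'}" using pair ab lt cc by (metis less_trans nat_neq_iff)+
    then show False using nc[of a a' b b'] lt cc by auto
  qed
  ultimately show ?thesis unfolding sym_pseudodiagram_def using two by blast
qed

subsection \<open>The concatenation is planar\<close>

definition link_rel :: "pseudodiagram \<Rightarrow> pseudodiagram \<Rightarrow> ((bpoint + nat) \<times> (bpoint + nat)) set" where
  "link_rel D D' = {(x, y). \<exists>c\<in>glued D D'. x \<in> c \<and> y \<in> c}"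

text \<open>The disjoint union of both pictures before any gluing. The diagonal makes it an
  equivalence on the whole type, including values that are no boundary points, as is assumed for
  gluing with \<open>merge\<close>.\<close>

definition juxtaposed :: "pseudodiagram \<Rightarrow> pseudodiagram \<Rightarrow> bpoint + bpoint \<Rightarrow> bpoint + bpoint \<Rightarrow> bool" where
  "juxtaposed D D' u v \<longleftrightarrow> u = v \<or> (\<exists>c\<in>arcs D. \<exists>a\<in>c. \<exists>b\<in>c. u = Inl a \<and> v = Inl b) \<or>
     (\<exists>c\<in>arcs D'. \<exists>a\<in>c. \<exists>b\<in>c. u = Inr a \<and> v = Inr b)"

text \<open>Replaces the transitive closure behind \<open>components\<close> by finitely many steps,
  each within reach of \<open>noncrossing_pairing_merge\<close>.\<close>

fun glue :: "pseudodiagram \<Rightarrow> pseudodiagram \<Rightarrow> nat \<Rightarrow> bpoint + bpoint \<Rightarrow> bpoint + bpoint \<Rightarrow> bool" where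
  "glue D D' 0 = juxtaposed D D'"
| "glue D D' (Suc k) = merge (Inl (South (Suc k))) (Inr (North (Suc k))) (glue D D' k)"

definition unglued :: "nat \<Rightarrow> pseudodiagram \<Rightarrow> pseudodiagram \<Rightarrow> nat \<Rightarrow> (bpoint + bpoint) set" where
  "unglued m D D' k = Inl ` points m D \<union> Inr ` points m D'
     - (\<Union>i\<in>{1..k}. {Inl (South i), Inr (North i)})"

lemma in_unglued_iff:
  "Inl a \<in> unglued m D D' k \<longleftrightarrow> a \<in> points m D \<and> a \<notin> South ` {1..k}"
  "Inr a \<in> unglued m D D' k \<longleftrightarrow> a \<in> points m D' \<and> a \<notin> North ` {1..k}"
  by (auto simp: unglued_def)

text \<open>
  The boundary of the lower rectangle is inserted between the southern and the western side of the
  upper one. Then \<open>South 1\<close> and \<open>North 1\<close> are neighbours, and after gluing them so are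
  \<open>South 2\<close> and \<open>North 2\<close>, and so on.
\<close>

fun jpos :: "nat \<Rightarrow> pseudodiagram \<Rightarrow> pseudodiagram \<Rightarrow> bpoint + bpoint \<Rightarrow> nat" where
  "jpos m D D' (Inl (North i)) = pos m D (North i)"
| "jpos m D D' (Inl (East j)) = pos m D (East j)"
| "jpos m D D' (Inl (South i)) = pos m D (South i)"
| "jpos m D D' (Inl (West j)) = pos m D (West j) + (2 * m + easts D' + wests D')"
| "jpos m D D' (Inr p) = 2 * m + easts D + pos m D' p"

fun project :: "pseudodiagram \<Rightarrow> bpoint + bpoint \<Rightarrow> bpoint + nat" where
  "project D (Inl p) = upper p"
| "project D (Inr p) = lower (wests D) (easts D) p"

text \<open>A section of \<open>project\<close> over the boundary points of the concatenation; its
  image consists of the points that are never glued.\<close>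

fun lift :: "pseudodiagram \<Rightarrow> bpoint \<Rightarrow> bpoint + bpoint" where
  "lift D (North i) = Inl (North i)"
| "lift D (South i) = Inr (South i)"
| "lift D (West j) = (if j \<le> wests D then Inl (West j) else Inr (West (j - wests D)))"
| "lift D (East j) = (if j \<le> easts D then Inl (East j) else Inr (East (j - easts D)))"

lemma in_points_iff [simp]:
  "North i \<in> points m D \<longleftrightarrow> i \<in> {1..m}" "South i \<in> points m D \<longleftrightarrow> i \<in> {1..m}"
  "West j \<in> points m D \<longleftrightarrow> j \<in> {1..wests D}" "East j \<in> points m D \<longleftrightarrow> j \<in> {1..easts D}"
  by (auto simp: points_def)

lemma pos_bounds:
  assumes "p \<in> points m D"
  shows "1 \<le> pos m D p" "pos m D p \<le> 2 * m + easts D + wests D"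
  using assms by (cases p; auto)+

lemma jpos_Inl_less_iff:
  assumes "a \<in> points m D" "b \<in> points m D"
  shows "jpos m D D' (Inl a) < jpos m D D' (Inl b) \<longleftrightarrow> pos m D a < pos m D b"
  using assms by (cases a; cases b) auto

text \<open>The lower boundary occupies an interval in the order \<open>jpos\<close>, so a point of
  the upper boundary has all of it on the same side. Hence arcs of different pictures do not
  cross.\<close>

lemma jpos_Inl_Inr:
  assumes "a \<in> points m D" "u \<in> points m D'" "v \<in> points m D'"
  shows "jpos m D D' (Inl a) < jpos m D D' (Inr u) \<longleftrightarrow> jpos m D D' (Inl a) < jpos m D D' (Inr v)"
    "jpos m D D' (Inr u) < jpos m D D' (Inl a) \<longleftrightarrow> jpos m D D' (Inr v) < jpos m D D' (Inl a)"
  using pos_bounds[OF assms(2)] pos_bounds[OF assms(3)] assms(1) by (cases a; auto)+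

lemma inj_on_jpos: "inj_on (jpos m D D') (unglued m D D' 0)"
proof (rule inj_onI)
  fix u v assume uv: "u \<in> unglued m D D' 0" "v \<in> unglued m D D' 0" "jpos m D D' u = jpos m D D' v"
  have ne: "jpos m D D' (Inl a) \<noteq> jpos m D D' (Inr b)" if "a \<in> points m D" "b \<in> points m D'" for a b
    using that pos_bounds[OF that(2)] by (cases a) auto
  consider a b where "u = Inl a" "v = Inl b" "a \<in> points m D" "b \<in> points m D"
    | a b where "u = Inr a" "v = Inr b" "a \<in> points m D'" "b \<in> points m D'"
    | a b where "u = Inl a" "v = Inr b" "a \<in> points m D" "b \<in> points m D'"
    | a b where "u = Inr a" "v = Inl b" "a \<in> points m D'" "b \<in> points m D"
    using uv(1,2) unfolding unglued_def by auto
  then show "u = v"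
  proof cases
    case 1
    then have "\<not> pos m D a < pos m D b" "\<not> pos m D b < pos m D a"
      using jpos_Inl_less_iff uv(3) by (metis less_irrefl)+
    then show ?thesis using 1 inj_on_pos[of m D] by (auto simp: inj_on_def)
  next
    case 2
    then show ?thesis using uv(3) inj_on_pos[of m D'] by (auto simp: inj_on_def)
  next
    case 3
    then show ?thesis using ne uv(3) by metis
  next
    case 4
    then show ?thesis using ne uv(3) by metis
  qed
qed

lemma same_arc_iff:
  assumes "sym_pseudodiagram m D"
  shows "(\<exists>c\<in>arcs D. a \<in> c \<and> b \<in> c) \<longleftrightarrow> (a = b \<and> a \<in> points m D) \<or> {a, b} \<in> arcs D"
proof
  assume "\<exists>c\<in>arcs D. a \<in> c \<and> b \<in> c"
  then obtain c where c: "c \<in> arcs D" "a \<in> c" "b \<in> c" by blast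
  then obtain x y where "c = {x, y}" "x \<in> points m D" "y \<in> points m D" using sym_arc[OF assms] by metis
  then show "(a = b \<and> a \<in> points m D) \<or> {a, b} \<in> arcs D" using c by (auto simp: insert_commute)
next
  assume "(a = b \<and> a \<in> points m D) \<or> {a, b} \<in> arcs D"
  then show "\<exists>c\<in>arcs D. a \<in> c \<and> b \<in> c"
  proof
    assume "a = b \<and> a \<in> points m D"
    then show ?thesis using sym_ex[OF assms] by (metis insertI1)
  qed blast
qed

lemma juxtaposed_simps:
  assumes "sym_pseudodiagram m D" "sym_pseudodiagram m D'"
  shows "juxtaposed D D' (Inl a) (Inl b) \<longleftrightarrow> a = b \<or> {a, b} \<in> arcs D"
    "juxtaposed D D' (Inr a) (Inr b) \<longleftrightarrow> a = b \<or> {a, b} \<in> arcs D'"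
    "\<not> juxtaposed D D' (Inl a) (Inr b)" "\<not> juxtaposed D D' (Inr a) (Inl b)"
  using same_arc_iff[OF assms(1), of a b] same_arc_iff[OF assms(2), of a b]
  unfolding juxtaposed_def by auto

lemma equivp_juxtaposed:
  assumes D: "sym_pseudodiagram m D" "sym_pseudodiagram m D'"
  shows "equivp (juxtaposed D D')"
proof (rule equivpI)
  note simps = juxtaposed_simps[OF D]
  show "reflp (juxtaposed D D')" by (auto simp: reflp_def juxtaposed_def)
  show "symp (juxtaposed D D')" unfolding symp_def juxtaposed_def by blast
  show "transp (juxtaposed D D')"
  proof (rule transpI)
    fix u v w assume *: "juxtaposed D D' u v" "juxtaposed D D' v w"
    have eq: "x = z" if "{x, y} \<in> arcs E" "{y, z} \<in> arcs E" "sym_pseudodiagram m E" for E x y z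
      using sym_unique[OF that(3), of y x z] that(1,2) by (simp add: insert_commute)
    show "juxtaposed D D' u w"
      using * eq[OF _ _ D(1)] eq[OF _ _ D(2)] by (cases u; cases v; cases w) (auto simp: simps)
  qed
qed

lemma noncrossing_juxtaposed:
  assumes D: "sym_pseudodiagram m D" "sym_pseudodiagram m D'"
  shows "noncrossing_pairing (jpos m D D') (unglued m D D' 0) (juxtaposed D D')"
proof -
  note simps = juxtaposed_simps[OF D]
  have "\<exists>!y. y \<in> unglued m D D' 0 \<and> y \<noteq> x \<and> juxtaposed D D' x y" if "x \<in> unglued m D D' 0" for x
  proof (cases x)
    case (Inl a)
    then have "a \<in> points m D" using that by (auto simp: in_unglued_iff)
    then obtain b where b: "{a, b} \<in> arcs D" "b \<in> points m D" "a \<noteq> b" using sym_ex[OF D(1)] by metis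
    have "y = Inl b" if "y \<noteq> x" "juxtaposed D D' x y" for y
      using that sym_unique[OF D(1) b(1)] by (cases y) (auto simp: Inl simps)
    then show ?thesis using b by (intro ex1I[of _ "Inl b"]) (auto simp: Inl simps in_unglued_iff)
  next
    case (Inr a)
    then have "a \<in> points m D'" using that by (auto simp: in_unglued_iff)
    then obtain b where b: "{a, b} \<in> arcs D'" "b \<in> points m D'" "a \<noteq> b" using sym_ex[OF D(2)] by metis
    have "y = Inr b" if "y \<noteq> x" "juxtaposed D D' x y" for y
      using that sym_unique[OF D(2) b(1)] by (cases y) (auto simp: Inr simps)
    then show ?thesis using b by (intro ex1I[of _ "Inr b"]) (auto simp: Inr simps in_unglued_iff)
  qed
  moreover have "(jpos m D D' a < jpos m D D' u \<longleftrightarrow> jpos m D D' c < jpos m D D' u) \<longleftrightarrow>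
      (jpos m D D' a < jpos m D D' v \<longleftrightarrow> jpos m D D' c < jpos m D D' v)"
    if X: "a \<in> unglued m D D' 0" "c \<in> unglued m D D' 0" "u \<in> unglued m D D' 0" "v \<in> unglued m D D' 0"
      and J: "juxtaposed D D' a c" "juxtaposed D D' u v" and ne: "a \<notin> {u, v}" "c \<notin> {u, v}" for a c u v
  proof (cases "a = c \<or> u = v")
    case False
    consider a' c' u' v' where "a = Inl a'" "c = Inl c'" "u = Inl u'" "v = Inl v'"
      | a' c' u' v' where "a = Inr a'" "c = Inr c'" "u = Inr u'" "v = Inr v'"
      | a' c' u' v' where "a = Inl a'" "c = Inl c'" "u = Inr u'" "v = Inr v'"
      | a' c' u' v' where "a = Inr a'" "c = Inr c'" "u = Inl u'" "v = Inl v'"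
      using J by (cases a; cases c; cases u; cases v) (auto simp: simps)
    then show ?thesis
    proof cases
      case 1
      then have p: "a' \<in> points m D" "c' \<in> points m D" "u' \<in> points m D" "v' \<in> points m D"
        using X by (auto simp: in_unglued_iff)
      have "{a', c'} \<in> arcs D" "{u', v'} \<in> arcs D" using J False by (auto simp: 1 simps)
      then show ?thesis using sym_noncrossing[OF D(1), of a' c' u' v'] ne
        by (simp add: 1 jpos_Inl_less_iff p)
    next
      case 2
      have "{a', c'} \<in> arcs D'" "{u', v'} \<in> arcs D'" using J False by (auto simp: 2 simps)
      then show ?thesis using sym_noncrossing[OF D(2), of a' c' u' v'] ne by (simp add: 2)
    next
      case 3
      then have p: "a' \<in> points m D" "c' \<in> points m D" "u' \<in> points m D'" "v' \<in> points m D'"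
        using X by (auto simp: in_unglued_iff)
      show ?thesis unfolding 3 using jpos_Inl_Inr(1)[OF p(1,3,4)] jpos_Inl_Inr(1)[OF p(2,3,4)] by blast
    next
      case 4
      then have p: "a' \<in> points m D'" "c' \<in> points m D'" "u' \<in> points m D" "v' \<in> points m D"
        using X by (auto simp: in_unglued_iff)
      show ?thesis unfolding 4 using jpos_Inl_Inr(2)[OF p(3,1,2)] jpos_Inl_Inr(2)[OF p(4,1,2)] by blast
    qed
  qed auto
  ultimately show ?thesis unfolding noncrossing_pairing_def by (intro conjI ballI impI)
qed

lemma unglued_Suc:
  "unglued m D D' (Suc k) = unglued m D D' k - {Inl (South (Suc k)), Inr (North (Suc k))}"
proof -
  have "{1..Suc k} = insert (Suc k) {1..k}" by auto
  then show ?thesis unfolding unglued_def by auto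
qed

lemma noncrossing_glue:
  assumes D: "sym_pseudodiagram m D" "sym_pseudodiagram m D'" and "k \<le> m"
  shows "equivp (glue D D' k) \<and> noncrossing_pairing (jpos m D D') (unglued m D D' k) (glue D D' k)"
  using assms(3)
proof (induction k)
  case 0
  show ?case using equivp_juxtaposed[OF D] noncrossing_juxtaposed[OF D] by simp
next
  case (Suc k)
  then have IH: "equivp (glue D D' k)"
    "noncrossing_pairing (jpos m D D') (unglued m D D' k) (glue D D' k)" by auto
  have "noncrossing_pairing (jpos m D D') (unglued m D D' (Suc k)) (glue D D' (Suc k))"
    unfolding unglued_Suc glue.simps
  proof (rule noncrossing_pairing_merge[OF IH])
    show "inj_on (jpos m D D') (unglued m D D' k)"
      by (rule inj_on_subset[OF inj_on_jpos]) (auto simp: unglued_def)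
    show "Inl (South (Suc k)) \<in> unglued m D D' k" "Inr (North (Suc k)) \<in> unglued m D D' k"
      using Suc.prems by (auto simp: in_unglued_iff)
    show "jpos m D D' (Inl (South (Suc k))) < jpos m D D' (Inr (North (Suc k)))" using Suc.prems by simp
    fix z assume z: "z \<in> unglued m D D' k"
    \<comment> \<open>The only points between the two are \<open>South i\<close> and
      \<open>North i\<close> with \<open>i \<le> k\<close>, and these have been glued
      before.\<close>
    show "\<not> (jpos m D D' (Inl (South (Suc k))) < jpos m D D' z \<and> jpos m D D' z < jpos m D D' (Inr (North (Suc k))))"
    proof (cases z)
      case (Inl a)
      then show ?thesis using z Suc.prems by (cases a) (auto simp: in_unglued_iff)
    next
      case (Inr a)
      then show ?thesis using z Suc.prems by (cases a) (auto simp: in_unglued_iff)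
    qed
  qed
  then show ?case using equivp_merge[OF IH(1)] by simp
qed

lemma glue_mono: "glue D D' k u v \<Longrightarrow> k \<le> l \<Longrightarrow> glue D D' l u v"
proof (induction l)
  case (Suc l)
  then show ?case by (cases "k = Suc l") (auto simp: merge_def)
qed auto

lemma sym_link_rel: "(x, y) \<in> (link_rel D D')\<^sup>* \<Longrightarrow> (y, x) \<in> (link_rel D D')\<^sup>*"
proof -
  have "sym (link_rel D D')" by (auto simp: sym_def link_rel_def)
  then show "(x, y) \<in> (link_rel D D')\<^sup>* \<Longrightarrow> (y, x) \<in> (link_rel D D')\<^sup>*"
    using sym_rtrancl by (metis symD)
qed

lemma glue_imp_link_rel:
  "glue D D' k u v \<Longrightarrow> (project D u, project D v) \<in> (link_rel D D')\<^sup>*"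
proof (induction k arbitrary: u v)
  case 0
  then consider "u = v"
    | c a b where "c \<in> arcs D" "a \<in> c" "b \<in> c" "u = Inl a" "v = Inl b"
    | c a b where "c \<in> arcs D'" "a \<in> c" "b \<in> c" "u = Inr a" "v = Inr b"
    by (auto simp: juxtaposed_def)
  then show ?case
  proof cases
    case 2
    then have "upper ` c \<in> glued D D'" by (auto simp: glued_def)
    then have "(project D u, project D v) \<in> link_rel D D'" using 2 unfolding link_rel_def by auto
    then show ?thesis by blast
  next
    case 3
    then have "lower (wests D) (easts D) ` c \<in> glued D D'" by (auto simp: glued_def)
    then have "(project D u, project D v) \<in> link_rel D D'" using 3 unfolding link_rel_def by auto
    then show ?thesis by blast
  qed auto
next
  case (Suc k)
  let ?s = "Inl (South (Suc k)) :: bpoint + bpoint" and ?t = "Inr (North (Suc k)) :: bpoint + bpoint"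
  have st: "project D ?s = project D ?t" by simp
  from Suc.prems consider "glue D D' k u v" | "glue D D' k u ?s" "glue D D' k ?t v"
    | "glue D D' k u ?t" "glue D D' k ?s v"
    by (auto simp: merge_def)
  then show ?case
    using Suc.IH rtrancl_trans[of "project D u" "project D ?s" "link_rel D D'" "project D v"] st
    by cases metis+
qed

lemma project_eq:
  assumes "u \<in> unglued m D D' 0" "v \<in> unglued m D D' 0" "project D u = project D v"
  shows "u = v \<or> (\<exists>i\<in>{1..m}. {u, v} = {Inl (South i), Inr (North i)})"
proof -
  have LL: "upper a = upper b \<Longrightarrow> a = b" for a b by (cases a; cases b) auto
  have RR: "lower p q a = lower p q b \<Longrightarrow> a = b" for a b p q by (cases a; cases b) auto
  have LR: "\<exists>i\<in>{1..m}. a = South i \<and> b = North i"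
    if "upper a = lower (wests D) (easts D) b" "a \<in> points m D" "b \<in> points m D'" for a b
    using that by (cases a; cases b) auto
  consider a b where "u = Inl a" "v = Inl b" "a \<in> points m D" "b \<in> points m D"
    | a b where "u = Inr a" "v = Inr b" "a \<in> points m D'" "b \<in> points m D'"
    | a b where "u = Inl a" "v = Inr b" "a \<in> points m D" "b \<in> points m D'"
    | a b where "u = Inr a" "v = Inl b" "a \<in> points m D'" "b \<in> points m D"
    using assms(1,2) unfolding unglued_def by auto
  then show ?thesis
  proof cases
    case 1 then show ?thesis using LL assms(3) by auto
  next
    case 2 then show ?thesis using RR assms(3) by auto
  next
    case 3 then show ?thesis using LR[of a b] assms(3) by auto
  next
    case 4 then show ?thesis using LR[of b a] assms(3) by auto
  qed
qed

text \<open>A chain of arcs through glued points lifts to the juxtaposed pictures: consecutive arcs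
  meet in a point that has at most two lifts, and two different lifts are a pair that has been
  glued. The induction keeps \<open>v\<close> arbitrary so that any lift of the current end may be
  used.\<close>

lemma link_rel_imp_glue:
  assumes D: "sym_pseudodiagram m D" "sym_pseudodiagram m D'"
    and xy: "(x, y) \<in> (link_rel D D')\<^sup>*"
    and u: "u \<in> unglued m D D' 0" "project D u = x"
  shows "v \<in> unglued m D D' 0 \<Longrightarrow> project D v = y \<Longrightarrow> glue D D' m u v"
  using xy
proof (induction arbitrary: v rule: rtrancl_induct)
  note eq = noncrossing_glue[OF D order_refl, THEN conjunct1]
  have gl: "glue D D' m (Inl (South i)) (Inr (North i))" if i: "i \<in> {1..m}" for i
  proof -
    obtain j where j: "i = Suc j" using i by (cases i) auto
    have "equivp (glue D D' j)" using noncrossing_glue[OF D] i j by auto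
    then have "glue D D' i (Inl (South i)) (Inr (North i))"
      unfolding j by (simp add: merge_def equivp_reflp)
    then show ?thesis using glue_mono i by auto
  qed
  have proj: "glue D D' m u v"
    if "u \<in> unglued m D D' 0" "v \<in> unglued m D D' 0" "project D u = project D v" for u v
    using project_eq[OF that] gl equivp_reflp[OF eq] equivp_symp[OF eq] by (auto simp: doubleton_eq_iff)
  {
    case base
    then show ?case using proj u by metis
  next
    case (step y z)
    obtain a b where ab: "a \<in> unglued m D D' 0" "b \<in> unglued m D D' 0" "project D a = y" "project D b = z"
      "juxtaposed D D' a b"
    proof -
      obtain c where "c \<in> glued D D'" "y \<in> c" "z \<in> c" using step(2) by (auto simp: link_rel_def)
      then consider e p q where "e \<in> arcs D" "p \<in> e" "q \<in> e" "y = upper p" "z = upper q"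
        | e p q where "e \<in> arcs D'" "p \<in> e" "q \<in> e"
          "y = lower (wests D) (easts D) p" "z = lower (wests D) (easts D) q"
        by (auto simp: glued_def)
      then show thesis
      proof cases
        case 1
        then have "p \<in> points m D" "q \<in> points m D" using sym_arc[OF D(1)] by (metis insertE singletonD)+
        then show thesis using 1 by (intro that[of "Inl p" "Inl q"]) (auto simp: in_unglued_iff juxtaposed_def)
      next
        case 2
        then have "p \<in> points m D'" "q \<in> points m D'" using sym_arc[OF D(2)] by (metis insertE singletonD)+
        then show thesis using 2 by (intro that[of "Inr p" "Inr q"]) (auto simp: in_unglued_iff juxtaposed_def)
      qed
    qed
    have "glue D D' m u a" using step.IH ab by blast
    moreover have "glue D D' m a b" using glue_mono[of D D' 0 a b m] ab(5) by simp
    moreover have "glue D D' m b v" using proj ab step.prems by metis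
    ultimately show ?case using equivp_transp[OF eq] by metis
  }
qed

lemma stack_simps [simp]:
  "wests (stack D D') = wests D + wests D'" "easts (stack D D') = easts D + easts D'"
  by (simp_all add: stack_def)

lemma lift_in_unglued:
  assumes "z \<in> points m (stack D D')"
  shows "lift D z \<in> unglued m D D' m" "lift D z \<in> unglued m D D' 0" "project D (lift D z) = Inl z"
  using assms by (cases z; auto simp: in_unglued_iff)+

lemma unglued_eq_lift:
  assumes "u \<in> unglued m D D' m"
  obtains z where "z \<in> points m (stack D D')" "u = lift D z"
proof -
  have "\<exists>z\<in>points m (stack D D'). u = lift D z"
  proof (cases u)
    case (Inl a)
    then show ?thesis using assms by (cases a) (auto simp: in_unglued_iff intro!: bexI[of _ a])
  next
    case (Inr a)
    show ?thesis
    proof (cases a)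
      case (South i)
      then show ?thesis using assms Inr by (intro bexI[of _ a]) (auto simp: in_unglued_iff)
    next
      case (West j)
      then show ?thesis using assms Inr by (intro bexI[of _ "West (wests D + j)"]) (auto simp: in_unglued_iff)
    next
      case (East j)
      then show ?thesis using assms Inr by (intro bexI[of _ "East (easts D + j)"]) (auto simp: in_unglued_iff)
    qed (use assms Inr in \<open>auto simp: in_unglued_iff\<close>)
  qed
  then show thesis using that by blast
qed

text \<open>In the order \<open>jpos\<close> the \<open>2 * m\<close> glued points come directly
  after the eastern points of the upper picture. Omitting them moves everything behind them by
  \<open>2 * m\<close> and leaves the order of the other points unchanged.\<close>

lemma jpos_lift:
  assumes "z \<in> points m (stack D D')"
  shows "jpos m D D' (lift D z) =
    pos m (stack D D') z + (if pos m (stack D D') z \<le> m + easts D then 0 else 2 * m)"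
  using assms by (cases z) auto

lemma jpos_lift_less_iff:
  assumes "z \<in> points m (stack D D')" "z' \<in> points m (stack D D')"
  shows "jpos m D D' (lift D z) < jpos m D D' (lift D z') \<longleftrightarrow> pos m (stack D D') z < pos m (stack D D') z'"
  unfolding jpos_lift[OF assms(1)] jpos_lift[OF assms(2)] by auto

definition joined :: "pseudodiagram \<Rightarrow> pseudodiagram \<Rightarrow> bpoint \<Rightarrow> bpoint \<Rightarrow> bool" where
  "joined D D' z z' \<longleftrightarrow> (Inl z, Inl z') \<in> (link_rel D D')\<^sup>*"

lemma joined_iff_glue:
  assumes "sym_pseudodiagram m D" "sym_pseudodiagram m D'"
    "z \<in> points m (stack D D')" "z' \<in> points m (stack D D')"
  shows "joined D D' z z' \<longleftrightarrow> glue D D' m (lift D z) (lift D z')"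
  unfolding joined_def
  using link_rel_imp_glue[OF assms(1,2), of "Inl z" "Inl z'" "lift D z" "lift D z'"]
    glue_imp_link_rel[of D D' m "lift D z" "lift D z'"] lift_in_unglued[OF assms(3)] lift_in_unglued[OF assms(4)]
  by auto

text \<open>The pairing of the unglued points, transported along the bijection
  \<open>lift\<close>.\<close>

lemma joined_ex1:
  assumes D: "sym_pseudodiagram m D" "sym_pseudodiagram m D'" and z: "z \<in> points m (stack D D')"
  shows "\<exists>!z'. z' \<in> points m (stack D D') \<and> z' \<noteq> z \<and> joined D D' z z'"
proof -
  have inj: "lift D x = lift D y \<Longrightarrow> x = y" if "x \<in> points m (stack D D')" "y \<in> points m (stack D D')" for x y
    using lift_in_unglued(3) that by (metis sum.inject(1))
  have "\<exists>!u. u \<in> unglued m D D' m \<and> u \<noteq> lift D z \<and> glue D D' m (lift D z) u"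
    using noncrossing_glue[OF D order_refl] lift_in_unglued(1)[OF z] unfolding noncrossing_pairing_def by blast
  then obtain u where u: "u \<in> unglued m D D' m" "u \<noteq> lift D z" "glue D D' m (lift D z) u"
    and u_uniq: "\<And>v. v \<in> unglued m D D' m \<Longrightarrow> v \<noteq> lift D z \<Longrightarrow> glue D D' m (lift D z) v \<Longrightarrow> v = u"
    by blast
  obtain z' where z': "z' \<in> points m (stack D D')" "u = lift D z'" using unglued_eq_lift u(1) by metis
  show ?thesis
  proof (rule ex1I[of _ z'])
    show "z' \<in> points m (stack D D') \<and> z' \<noteq> z \<and> joined D D' z z'"
      using z' u joined_iff_glue[OF D z] by auto
    fix y assume y: "y \<in> points m (stack D D') \<and> y \<noteq> z \<and> joined D D' z y"
    then have "lift D y = u" using u_uniq[of "lift D y"] joined_iff_glue[OF D z] lift_in_unglued(1) inj z by metis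
    then show "y = z'" using inj z' y by metis
  qed
qed

lemma Inl_in_glued:
  assumes D: "sym_pseudodiagram m D" "sym_pseudodiagram m D'"
  shows "Inl z \<in> \<Union>(glued D D') \<longleftrightarrow> z \<in> points m (stack D D')"
proof
  assume "Inl z \<in> \<Union>(glued D D')"
  then consider e p where "e \<in> arcs D" "p \<in> e" "Inl z = upper p"
    | e p where "e \<in> arcs D'" "p \<in> e" "Inl z = lower (wests D) (easts D) p"
    by (auto simp: glued_def)
  then show "z \<in> points m (stack D D')"
  proof cases
    case 1
    then have "p \<in> points m D" using sym_arc[OF D(1)] by (metis insertE singletonD)
    then show ?thesis using 1 by (cases p) auto
  next
    case 2
    then have "p \<in> points m D'" using sym_arc[OF D(2)] by (metis insertE singletonD)
    then show ?thesis using 2 by (cases p) auto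
  qed
next
  assume z: "z \<in> points m (stack D D')"
  \<comment> \<open>Since \<open>z\<close> is linked to a different point, the chain has a first
    step, and this step takes place in a glued arc through \<open>z\<close>.\<close>
  obtain z' where z': "z' \<noteq> z" "joined D D' z z'" using joined_ex1[OF D z] by blast
  then have "(Inl z, Inl z') \<in> (link_rel D D')\<^sup>*" "(Inl z :: bpoint + nat) \<noteq> Inl z'" by (auto simp: joined_def)
  then obtain y where "(Inl z, y) \<in> link_rel D D'" by (meson converse_rtranclE)
  then show "Inl z \<in> \<Union>(glued D D')" by (auto simp: link_rel_def)
qed

text \<open>A component containing a boundary point is the class of that point, and by
  \<open>joined_ex1\<close> it contains exactly one further boundary point. Components without
  boundary points are loops and do not show up among the arcs.\<close>

lemma arcs_stack:
  assumes D: "sym_pseudodiagram m D" "sym_pseudodiagram m D'"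
  shows "c \<in> arcs (stack D D') \<longleftrightarrow> (\<exists>z z'. c = {z, z'} \<and> z \<noteq> z' \<and> z \<in> points m (stack D D') \<and>
    z' \<in> points m (stack D D') \<and> joined D D' z z')"
proof -
  let ?R = "link_rel D D'"
  have comp: "components D D' = \<Union>(glued D D') // ?R\<^sup>*" by (simp add: components_def link_rel_def)
  have in_pts: "z' \<in> points m (stack D D')" if "(y, Inl z') \<in> ?R\<^sup>*" "y \<in> \<Union>(glued D D')" for y z'
  proof -
    have "Inl z' \<in> \<Union>(glued D D')"
      using that by (cases rule: rtranclE) (auto simp: link_rel_def)
    then show ?thesis using Inl_in_glued[OF D] by simp
  qed
  have cls: "Inl -` (?R\<^sup>* `` {Inl z}) = {z, z'}"
    if "z \<in> points m (stack D D')" "z' \<in> points m (stack D D')" "z \<noteq> z'" "joined D D' z z'" for z z'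
  proof -
    have "y = z \<or> y = z'" if "(Inl z, Inl y) \<in> ?R\<^sup>*" for y
    proof -
      have "y \<in> points m (stack D D')" using in_pts that Inl_in_glued[OF D] \<open>z \<in> points m (stack D D')\<close> by metis
      then show ?thesis using joined_ex1[OF D \<open>z \<in> points m (stack D D')\<close>] that \<open>z' \<in> points m (stack D D')\<close>
          \<open>z \<noteq> z'\<close> \<open>joined D D' z z'\<close> unfolding joined_def by blast
    qed
    then show ?thesis using that by (auto simp: joined_def)
  qed
  have arcs: "arcs (stack D D') = {Inl -` C | C. C \<in> components D D' \<and> Inl -` C \<noteq> {}}" by (simp add: stack_def)
  show ?thesis
  proof
    assume "c \<in> arcs (stack D D')"
    then obtain C z where C: "c = Inl -` C" "C \<in> components D D'" "Inl z \<in> C" unfolding arcs by auto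
    then obtain y where y: "y \<in> \<Union>(glued D D')" "C = ?R\<^sup>* `` {y}" unfolding comp by (auto simp: quotient_def)
    have "(y, Inl z) \<in> ?R\<^sup>*" using C y by simp
    then have "C = ?R\<^sup>* `` {Inl z}" unfolding y(2) by (auto intro: rtrancl_trans sym_link_rel)
    moreover have z: "z \<in> points m (stack D D')" using in_pts C y by auto
    moreover obtain z' where "z' \<in> points m (stack D D')" "z' \<noteq> z" "joined D D' z z'" using joined_ex1[OF D z] by blast
    ultimately show "\<exists>z z'. c = {z, z'} \<and> z \<noteq> z' \<and> z \<in> points m (stack D D') \<and>
      z' \<in> points m (stack D D') \<and> joined D D' z z'" using cls C(1) by metis
  next
    assume "\<exists>z z'. c = {z, z'} \<and> z \<noteq> z' \<and> z \<in> points m (stack D D') \<and>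
      z' \<in> points m (stack D D') \<and> joined D D' z z'"
    then obtain z z' where z: "c = {z, z'}" "z \<noteq> z'" "z \<in> points m (stack D D')"
      "z' \<in> points m (stack D D')" "joined D D' z z'" by blast
    have "c = Inl -` (?R\<^sup>* `` {Inl z})" using cls z by metis
    moreover have "?R\<^sup>* `` {Inl z} \<in> components D D'"
      unfolding comp using Inl_in_glued[OF D] z by (auto intro: quotientI)
    ultimately show "c \<in> arcs (stack D D')" unfolding arcs using z by blast
  qed
qed

lemma sym_stack:
  assumes D: "sym_pseudodiagram m D" "sym_pseudodiagram m D'"
  shows "sym_pseudodiagram m (stack D D')"
proof (rule sym_pseudodiagramI)
  let ?X = "points m (stack D D')"
  have arc: "{a, b} \<in> arcs (stack D D') \<longleftrightarrow> a \<noteq> b \<and> a \<in> ?X \<and> b \<in> ?X \<and> joined D D' a b" for a b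
    using arcs_stack[OF D, of "{a, b}"] sym_link_rel unfolding joined_def by (auto simp: doubleton_eq_iff)
  show "\<exists>a b. c = {a, b} \<and> a \<noteq> b \<and> a \<in> ?X \<and> b \<in> ?X" if "c \<in> arcs (stack D D')" for c
    using that arcs_stack[OF D, of c] by blast
  show "\<exists>b. {a, b} \<in> arcs (stack D D')" if "a \<in> ?X" for a
    using joined_ex1[OF D that] that arc by blast
  show "b = b'" if "{a, b} \<in> arcs (stack D D')" "{a, b'} \<in> arcs (stack D D')" for a b b'
    using joined_ex1[OF D, of a] that unfolding arc by blast
  show False if ab: "{a, c} \<in> arcs (stack D D')" "{b, d} \<in> arcs (stack D D')"
    and lt: "pos m (stack D D') a < pos m (stack D D') b" "pos m (stack D D') b < pos m (stack D D') c"
      "pos m (stack D D') c < pos m (stack D D') d" for a b c d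
  proof -
    have X: "a \<in> ?X" "b \<in> ?X" "c \<in> ?X" "d \<in> ?X" using ab arc by auto
    let ?f = "jpos m D D'"
    have f: "?f (lift D a) < ?f (lift D b)" "?f (lift D b) < ?f (lift D c)" "?f (lift D c) < ?f (lift D d)"
      using jpos_lift_less_iff X lt by auto
    have "glue D D' m (lift D a) (lift D c)" "glue D D' m (lift D b) (lift D d)"
      using ab arc joined_iff_glue[OF D] by auto
    moreover have "lift D a \<notin> {lift D b, lift D d}" "lift D c \<notin> {lift D b, lift D d}" using f by auto
    ultimately have "(?f (lift D a) < ?f (lift D b) \<longleftrightarrow> ?f (lift D c) < ?f (lift D b)) \<longleftrightarrow>
        (?f (lift D a) < ?f (lift D d) \<longleftrightarrow> ?f (lift D c) < ?f (lift D d))"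
      using noncrossing_glue[OF D order_refl] lift_in_unglued(1) X unfolding noncrossing_pairing_def by blast
    then show False using f by auto
  qed
qed

lemma arc_stack_iff:
  assumes D: "sym_pseudodiagram m D" "sym_pseudodiagram m D'"
  shows "{a, b} \<in> arcs (stack D D') \<longleftrightarrow>
    a \<noteq> b \<and> a \<in> points m (stack D D') \<and> b \<in> points m (stack D D') \<and> joined D D' a b"
  using arcs_stack[OF D, of "{a, b}"] sym_link_rel unfolding joined_def by (auto simp: doubleton_eq_iff)

subsection \<open>Reduction and flipping\<close>

text \<open>The common frame of \<open>reduce\<close> and \<open>flip\<close>: both push a set of
  arcs forward along an injective map of boundary points. Only the noncrossing condition depends on
  what the map does to positions.\<close>

lemma sym_image:
  assumes D: "sym_pseudodiagram m D" and A: "A \<subseteq> arcs D" and inj: "inj_on h (\<Union>A)"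
    and points: "points m D' = h ` \<Union>A" and arcs: "arcs D' = image h ` A"
    and nc: "\<And>a b c d. {a, c} \<in> A \<Longrightarrow> {b, d} \<in> A \<Longrightarrow> pos m D' (h a) < pos m D' (h b) \<Longrightarrow>
      pos m D' (h b) < pos m D' (h c) \<Longrightarrow> pos m D' (h c) < pos m D' (h d) \<Longrightarrow> False"
  shows "sym_pseudodiagram m D'"
proof (rule sym_pseudodiagramI)
  have pair: "\<exists>a b. {a, b} \<in> A \<and> p = h a \<and> q = h b" if pq: "{p, q} \<in> arcs D'" for p q
  proof -
    obtain c where c: "c \<in> A" "{p, q} = h ` c" using pq arcs by auto
    obtain a b where ab: "c = {a, b}" using sym_arc[OF D] c(1) A by blast
    then have "p = h a \<and> q = h b \<or> p = h b \<and> q = h a" using c(2) by (auto simp: doubleton_eq_iff)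
    then show ?thesis using ab c(1) by (metis insert_commute)
  qed
  show "\<exists>a b. c = {a, b} \<and> a \<noteq> b \<and> a \<in> points m D' \<and> b \<in> points m D'" if cD: "c \<in> arcs D'" for c
  proof -
    obtain c' where c: "c' \<in> A" "c = h ` c'" using cD arcs by auto
    obtain a b where ab: "c' = {a, b}" "a \<noteq> b" using sym_arc[OF D] c(1) A by blast
    then have "h a \<noteq> h b" using inj c(1) unfolding inj_on_def by blast
    then show ?thesis using ab c points by (intro exI[of _ "h a"] exI[of _ "h b"]) auto
  qed
  show "\<exists>b. {a, b} \<in> arcs D'" if aD: "a \<in> points m D'" for a
  proof -
    obtain a' c where a: "a = h a'" "a' \<in> c" "c \<in> A" using aD points by auto
    then obtain x y where "c = {x, y}" using sym_arc[OF D] A by blast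
    then obtain b where "c = {a', b}" using a(2) by (metis insertE insert_commute singletonD)
    moreover have "h ` c \<in> arcs D'" using a(3) arcs by blast
    ultimately show ?thesis using a(1) by (intro exI[of _ "h b"]) simp
  qed
  show "b = b'" if b: "{a, b} \<in> arcs D'" "{a, b'} \<in> arcs D'" for a b b'
  proof -
    obtain x y where xy: "{x, y} \<in> A" "a = h x" "b = h y" using pair[OF b(1)] by auto
    obtain x' y' where xy': "{x', y'} \<in> A" "a = h x'" "b' = h y'" using pair[OF b(2)] by auto
    have "x = x'" using inj xy xy' unfolding inj_on_def by blast
    then show ?thesis using sym_unique[OF D, of x y y'] xy xy' A by auto
  qed
  show False if abcd: "{a, c} \<in> arcs D'" "{b, d} \<in> arcs D'" "pos m D' a < pos m D' b"
    "pos m D' b < pos m D' c" "pos m D' c < pos m D' d" for a b c d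
  proof -
    obtain a' c' where "{a', c'} \<in> A" "a = h a'" "c = h c'" using pair[OF abcd(1)] by auto
    moreover obtain b' d' where "{b', d'} \<in> A" "b = h b'" "d = h d'" using pair[OF abcd(2)] by auto
    ultimately show False using nc[of a' c' b' d'] abcd by auto
  qed
qed

text \<open>Meant for \<open>renumber\<close>, which replaces an index by its rank among the
  surviving ones.\<close>

lemma card_le_image_rank:
  fixes A :: "nat set"
  assumes "finite A"
  shows "(\<lambda>j. card {i. i \<le> j \<and> i \<in> A}) ` A = {1..card A}"
    and "\<And>j j'. j \<in> A \<Longrightarrow> j' \<in> A \<Longrightarrow> card {i. i \<le> j \<and> i \<in> A} < card {i. i \<le> j' \<and> i \<in> A} \<longleftrightarrow> j < j'"
    and "\<And>j. j \<in> A \<Longrightarrow> 1 \<le> card {i. i \<le> j \<and> i \<in> A} \<and> card {i. i \<le> j \<and> i \<in> A} \<le> card A"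
proof -
  let ?r = "\<lambda>j. card {i. i \<le> j \<and> i \<in> A}"
  have less: "?r j < ?r j'" if "j' \<in> A" "j < j'" for j j'
  proof (rule psubset_card_mono)
    have "j' \<in> {i. i \<le> j' \<and> i \<in> A}" "j' \<notin> {i. i \<le> j \<and> i \<in> A}" using that by auto
    moreover have "{i. i \<le> j \<and> i \<in> A} \<subseteq> {i. i \<le> j' \<and> i \<in> A}" using that by auto
    ultimately show "{i. i \<le> j \<and> i \<in> A} \<subset> {i. i \<le> j' \<and> i \<in> A}" by blast
  qed simp
  show iff: "?r j < ?r j' \<longleftrightarrow> j < j'" if "j \<in> A" "j' \<in> A" for j j'
    using less[of j' j] less[of j j'] that by (cases j j' rule: linorder_cases) auto
  show bounds: "1 \<le> ?r j \<and> ?r j \<le> card A" if "j \<in> A" for j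
  proof
    have "{i. i \<le> j \<and> i \<in> A} \<noteq> {}" using that by auto
    then show "1 \<le> ?r j" by (simp add: Suc_le_eq card_gt_0_iff)
    show "?r j \<le> card A" by (rule card_mono[OF assms]) auto
  qed
  have "inj_on ?r A"
  proof (rule inj_onI)
    fix j j' assume "j \<in> A" "j' \<in> A" "?r j = ?r j'"
    then show "j = j'" using iff[of j j'] iff[of j' j] by (metis less_irrefl linorder_neqE_nat)
  qed
  then have "card (?r ` A) = card {1..card A}" by (simp add: card_image)
  then show "?r ` A = {1..card A}"
    using bounds by (intro card_subset_eq) auto
qed

lemma kept_subset: "kept D \<subseteq> arcs D"
  by (auto simp: kept_def noncontractible_def)

lemma kept_vertex:
  assumes "c \<in> arcs D" "a \<in> c" "a \<in> range North \<union> range South"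
  shows "c \<in> kept D"
proof -
  have "c \<notin> contractible D" "c \<notin> noncontractible D"
    using assms by (auto simp: contractible_def noncontractible_def)
  then show ?thesis using assms by (simp add: kept_def)
qed

lemma finite_arcs:
  assumes "sym_pseudodiagram m D" shows "finite (arcs D)"
proof -
  have "\<Union>(arcs D) = points m D" using assms unfolding sym_pseudodiagram_def partition_on_def by auto
  then show ?thesis using finite_points finite_UnionD by metis
qed

lemma Union_arcs:
  assumes "sym_pseudodiagram m D" shows "\<Union>(arcs D) = points m D"
  using assms unfolding sym_pseudodiagram_def partition_on_def by auto

lemma reduce_simps [simp]:
  "wests (reduce D) = card {j. West j \<in> \<Union>(kept D)}" "easts (reduce D) = card {j. East j \<in> \<Union>(kept D)}"
  "arcs (reduce D) = image (renumber (\<Union>(kept D))) ` kept D" "loop_pairs (reduce D) = 0"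
  by (simp_all add: reduce_def)

text \<open>Closing the gaps left by deleted loops keeps the clockwise order: on one side because
  ranks are monotone, between different sides because the sides occupy consecutive intervals before
  and after.\<close>

lemma renumber_facts:
  assumes D: "sym_pseudodiagram m D"
  defines "X \<equiv> \<Union>(kept D)"
  shows "X \<subseteq> points m D"
    and "points m (reduce D) = renumber X ` X"
    and "\<And>a b. a \<in> X \<Longrightarrow> b \<in> X \<Longrightarrow>
      pos m (reduce D) (renumber X a) < pos m (reduce D) (renumber X b) \<longleftrightarrow> pos m D a < pos m D b"
    and "inj_on (renumber X) X"
proof -
  show X: "X \<subseteq> points m D" using Union_arcs[OF D] kept_subset[of D] unfolding X_def by blast
  define AW where "AW = {j. West j \<in> X}"
  define AE where "AE = {j. East j \<in> X}"
  have sub: "AW \<subseteq> {1..wests D}" "AE \<subseteq> {1..easts D}" using X by (auto simp: AW_def AE_def)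
  then have fin: "finite AW" "finite AE" by (auto intro: finite_subset)
  note rW = card_le_image_rank[OF fin(1)] and rE = card_le_image_rank[OF fin(2)]
  have ren: "renumber X (West j) = West (card {i. i \<le> j \<and> i \<in> AW})"
    "renumber X (East j) = East (card {i. i \<le> j \<and> i \<in> AE})" for j
    by (simp_all add: AW_def AE_def)
  have we: "wests (reduce D) = card AW" "easts (reduce D) = card AE" by (simp_all add: AW_def AE_def X_def)
  have ns: "North i \<in> X" "South i \<in> X" if "i \<in> {1..m}" for i
  proof -
    have "North i \<in> points m D" "South i \<in> points m D" using that by auto
    then obtain c c' where "c \<in> arcs D" "North i \<in> c" "c' \<in> arcs D" "South i \<in> c'"
      using Union_arcs[OF D] by blast
    then show "North i \<in> X" "South i \<in> X" using kept_vertex unfolding X_def by blast+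
  qed
  have X_iff: "X = North ` {1..m} \<union> South ` {1..m} \<union> West ` AW \<union> East ` AE"
  proof
    show "X \<subseteq> North ` {1..m} \<union> South ` {1..m} \<union> West ` AW \<union> East ` AE"
    proof
      fix a assume "a \<in> X"
      then show "a \<in> North ` {1..m} \<union> South ` {1..m} \<union> West ` AW \<union> East ` AE"
        using X by (cases a) (auto simp: AW_def AE_def)
    qed
    show "North ` {1..m} \<union> South ` {1..m} \<union> West ` AW \<union> East ` AE \<subseteq> X"
      using ns by (auto simp: AW_def AE_def)
  qed
  have "renumber X ` (West ` AW) = West ` {1..card AW}" "renumber X ` (East ` AE) = East ` {1..card AE}"
    unfolding rW(1)[symmetric] rE(1)[symmetric] image_image ren by auto
  moreover have "renumber X ` (North ` {1..m}) = North ` {1..m}" "renumber X ` (South ` {1..m}) = South ` {1..m}"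
    by (auto simp: image_image)
  ultimately have "renumber X ` X = North ` {1..m} \<union> South ` {1..m} \<union> West ` {1..card AW} \<union> East ` {1..card AE}"
    by (subst (2) X_iff) (simp only: image_Un)
  then show "points m (reduce D) = renumber X ` X"
    unfolding points_def we by auto
  show less: "pos m (reduce D) (renumber X a) < pos m (reduce D) (renumber X b) \<longleftrightarrow> pos m D a < pos m D b"
    if ab: "a \<in> X" "b \<in> X" for a b
  proof -
    define rW' where "rW' j = card {i. i \<le> j \<and> i \<in> AW}" for j
    define rE' where "rE' j = card {i. i \<le> j \<and> i \<in> AE}" for j
    have W: "1 \<le> rW' j" "rW' j \<le> card AW" "1 \<le> j" "j \<le> wests D" if "West j \<in> X" for j
      using rW(3)[of j] that sub by (auto simp: AW_def rW'_def)
    have E: "1 \<le> rE' j" "rE' j \<le> card AE" "1 \<le> j" "j \<le> easts D" if "East j \<in> X" for j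
      using rE(3)[of j] that sub by (auto simp: AE_def rE'_def)
    have WW: "rW' j < rW' j' \<longleftrightarrow> j < j'" if "West j \<in> X" "West j' \<in> X" for j j'
      using rW(2)[of j j'] that by (auto simp: AW_def rW'_def)
    have EE: "rE' j < rE' j' \<longleftrightarrow> j < j'" if "East j \<in> X" "East j' \<in> X" for j j'
      using rE(2)[of j j'] that by (auto simp: AE_def rE'_def)
    have P: "pos m (reduce D) (North i) = i" "pos m (reduce D) (South i) = 2 * m + card AE + 1 - i"
      "pos m (reduce D) (renumber X (West j)) = 2 * m + card AE + card AW + 1 - rW' j"
      "pos m (reduce D) (renumber X (East j)) = m + rE' j" for i j
      by (simp_all only: pos.simps we ren rW'_def rE'_def)
    have Q: "pos m D (North i) = i" "pos m D (South i) = 2 * m + easts D + 1 - i"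
      "pos m D (West i) = 2 * m + easts D + wests D + 1 - i" "pos m D (East i) = m + i" for i
      by simp_all
    have NS: "renumber X (North i) = North i" "renumber X (South i) = South i" for i by simp_all
    have i: "1 \<le> i" "i \<le> m" if "North i \<in> X \<or> South i \<in> X" for i using that X by auto
    show ?thesis
    proof (cases a)
      case a: (North p)
      show ?thesis
      proof (cases b)
        case b: (North q)
        show ?thesis using ab i[of p] i[of q] unfolding a b NS P Q by auto
      next
        case b: (South q)
        show ?thesis using ab i[of p] i[of q] unfolding a b NS P Q by auto
      next
        case b: (West q)
        show ?thesis using ab i[of p] W[of q] unfolding a b NS P Q by auto
      next
        case b: (East q)
        show ?thesis using ab i[of p] E[of q] unfolding a b NS P Q by auto
      qed
    next
      case a: (South p)
      show ?thesis
      proof (cases b)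
        case b: (North q)
        show ?thesis using ab i[of p] i[of q] unfolding a b NS P Q by auto
      next
        case b: (South q)
        show ?thesis using ab i[of p] i[of q] unfolding a b NS P Q by auto
      next
        case b: (West q)
        show ?thesis using ab i[of p] W[of q] unfolding a b NS P Q by auto
      next
        case b: (East q)
        show ?thesis using ab i[of p] E[of q] unfolding a b NS P Q by auto
      qed
    next
      case a: (West p)
      show ?thesis
      proof (cases b)
        case b: (North q)
        show ?thesis using ab W[of p] i[of q] unfolding a b NS P Q by auto
      next
        case b: (South q)
        show ?thesis using ab W[of p] i[of q] unfolding a b NS P Q by auto
      next
        case b: (West q)
        show ?thesis using ab W[of p] W[of q] WW[of p q] WW[of q p] unfolding a b NS P Q by auto
      next
        case b: (East q)
        show ?thesis using ab W[of p] E[of q] unfolding a b NS P Q by auto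
      qed
    next
      case a: (East p)
      show ?thesis
      proof (cases b)
        case b: (North q)
        show ?thesis using ab E[of p] i[of q] unfolding a b NS P Q by auto
      next
        case b: (South q)
        show ?thesis using ab E[of p] i[of q] unfolding a b NS P Q by auto
      next
        case b: (West q)
        show ?thesis using ab E[of p] W[of q] unfolding a b NS P Q by auto
      next
        case b: (East q)
        show ?thesis using ab E[of p] E[of q] EE[of p q] EE[of q p] unfolding a b NS P Q by auto
      qed
    qed
  qed
  show "inj_on (renumber X) X"
  proof (rule inj_onI)
    fix a b assume ab: "a \<in> X" "b \<in> X" "renumber X a = renumber X b"
    then have "pos m D a = pos m D b"
      using less[of a b] less[of b a] by (metis less_irrefl linorder_neqE_nat)
    then show "a = b" using inj_on_pos[of m D] X ab by (auto simp: inj_on_def)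
  qed
qed

lemma sym_reduce:
  assumes D: "sym_pseudodiagram m D"
  shows "sym_pseudodiagram m (reduce D)"
proof (rule sym_image[OF D kept_subset])
  note rf = renumber_facts[OF D]
  show "inj_on (renumber (\<Union>(kept D))) (\<Union>(kept D))"
    "points m (reduce D) = renumber (\<Union>(kept D)) ` \<Union>(kept D)" by (rule rf)+
  show "arcs (reduce D) = image (renumber (\<Union>(kept D))) ` kept D" by simp
  fix a b c d
  let ?p = "\<lambda>a. pos m (reduce D) (renumber (\<Union>(kept D)) a)"
  assume k: "{a, c} \<in> kept D" "{b, d} \<in> kept D" and lt: "?p a < ?p b" "?p b < ?p c" "?p c < ?p d"
  then have "pos m D a < pos m D b" "pos m D b < pos m D c" "pos m D c < pos m D d"
    using rf(3) by (metis UnionI insert_iff)+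
  moreover have "\<not> crossing m D {a, c} {b, d}"
    using D k kept_subset[of D] unfolding sym_pseudodiagram_def by blast
  ultimately show False unfolding crossing_def by blast
qed

text \<open>If the number is odd, the northernmost loop is well defined: it has the least western
  end, and two arcs with a common end coincide.\<close>

lemma card_kept_noncontractible:
  assumes D: "sym_pseudodiagram m D"
  shows "card (kept D \<inter> noncontractible D) = card (noncontractible D) mod 2"
proof (cases "odd (card (noncontractible D))")
  case False
  have "contractible D \<inter> noncontractible D = {}" by (auto simp: contractible_def noncontractible_def doubleton_eq_iff)
  then have "kept D \<inter> noncontractible D = {}" using False by (auto simp: kept_def)
  then show ?thesis using False by auto
next
  case True
  define S where "S = {c \<in> noncontractible D. \<exists>i. West i \<in> c \<and>
    (\<forall>i' j'. {West i', East j'} \<in> noncontractible D \<longrightarrow> i \<le> i')}"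
  have "kept D \<inter> noncontractible D = S" using True by (auto simp: kept_def S_def)
  moreover have "\<exists>c. S = {c}"
  proof -
    define i where "i = (LEAST i. \<exists>j. {West i, East j} \<in> noncontractible D)"
    have "noncontractible D \<noteq> {}" using True by auto
    then have "\<exists>i j. {West i, East j} \<in> noncontractible D" by (auto simp: noncontractible_def)
    then have ex: "\<exists>j. {West i, East j} \<in> noncontractible D" unfolding i_def by (rule LeastI_ex)
    have le: "i \<le> i'" if "{West i', East j'} \<in> noncontractible D" for i' j'
      unfolding i_def using that by (intro Least_le) blast
    obtain j where j: "{West i, East j} \<in> noncontractible D" using ex by blast
    then have "{West i, East j} \<in> S" using le by (auto simp: S_def)
    moreover have "c = {West i, East j}" if cS: "c \<in> S" for c
    proof -
      obtain i' where i': "c \<in> noncontractible D" "West i' \<in> c"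
        "\<And>i'' j'. {West i'', East j'} \<in> noncontractible D \<Longrightarrow> i' \<le> i''" using cS by (auto simp: S_def)
      then obtain j' where c: "c = {West i', East j'}" by (auto simp: noncontractible_def)
      then have "i' = i" using i' le j by (simp add: le_antisym)
      then show ?thesis using c j i'(1) sym_unique[OF D, of "West i"] by (auto simp: noncontractible_def)
    qed
    ultimately show ?thesis by blast
  qed
  ultimately show ?thesis using True by (auto simp: odd_iff_mod_2_eq_one)
qed

text \<open>Reduction respects the colour of the south-west corner. A deleted contractible loop has
  no or two eastern ends, and the noncontractible loops, with one eastern end each, are deleted in
  even number.\<close>

lemma even_easts_reduce:
  assumes D: "sym_pseudodiagram m D" and "even (easts D)"
  shows "even (easts (reduce D))"
proof -
  define f where "f c = card {j. East j \<in> c}" for c :: "bpoint set"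
  have disj: "disjoint (arcs D)" using D unfolding sym_pseudodiagram_def partition_on_def by auto
  have fin: "finite {j. East j \<in> c}" if "c \<in> arcs D" for c
  proof (rule finite_subset)
    have "c \<subseteq> points m D" using that Union_arcs[OF D] by blast
    then show "{j. East j \<in> c} \<subseteq> {1..easts D}" using in_points_iff(4) by blast
  qed simp
  have count: "card {j. East j \<in> \<Union>A} = sum f A" if "A \<subseteq> arcs D" for A
  proof -
    have "{j. East j \<in> \<Union>A} = (\<Union>c\<in>A. {j. East j \<in> c})" by auto
    also have "card \<dots> = (\<Sum>c\<in>A. card {j. East j \<in> c})"
    proof (rule card_UN_disjoint)
      show "finite A" using finite_subset[OF that finite_arcs[OF D]] .
      show "\<forall>c\<in>A. finite {j. East j \<in> c}" using fin that by auto
      show "\<forall>c\<in>A. \<forall>c'\<in>A. c \<noteq> c' \<longrightarrow> {j. East j \<in> c} \<inter> {j. East j \<in> c'} = {}"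
        using disjointD[OF disj] that by blast
    qed
    finally show ?thesis by (simp add: f_def)
  qed
  have "{j. East j \<in> \<Union>(arcs D)} = {1..easts D}" using Union_arcs[OF D] by auto
  then have 1: "easts D = sum f (arcs D)" using count[of "arcs D"] by simp
  have 2: "easts (reduce D) = sum f (kept D)" using count[OF kept_subset] by simp
  have dj: "contractible D \<inter> noncontractible D = {}"
    by (auto simp: contractible_def noncontractible_def doubleton_eq_iff)
  have fina: "finite (arcs D)" by (rule finite_arcs[OF D])
  have sub: "contractible D \<subseteq> arcs D" "noncontractible D \<subseteq> arcs D"
    by (auto simp: contractible_def noncontractible_def)
  have "arcs D = kept D \<union> (contractible D \<union> (noncontractible D - kept D))"
    using sub kept_subset[of D] by (auto simp: kept_def)
  moreover have "kept D \<inter> contractible D = {}" using dj by (auto simp: kept_def)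
  ultimately have "sum f (arcs D) = sum f (kept D) + sum f (contractible D \<union> (noncontractible D - kept D))"
    using fina by (metis (no_types, lifting) Diff_disjoint Int_Un_distrib finite_Un sum.union_disjoint sup_bot_left)
  also have "sum f (contractible D \<union> (noncontractible D - kept D)) =
      sum f (contractible D) + sum f (noncontractible D - kept D)"
    using dj sub fina by (intro sum.union_disjoint) (auto intro: finite_subset)
  also have "sum f (noncontractible D - kept D) = card (noncontractible D - kept D)"
  proof -
    have "f c = 1" if cN: "c \<in> noncontractible D" for c
    proof -
      obtain i j where "c = {West i, East j}" using cN by (auto simp: noncontractible_def)
      then have "{j. East j \<in> c} = {j}" by auto
      then show ?thesis by (simp add: f_def)
    qed
    then show ?thesis by simp
  qed
  also have "\<dots> = card (noncontractible D) - card (kept D \<inter> noncontractible D)"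
    using sub(2) fina by (simp add: card_Diff_subset_Int Int_commute finite_subset)
  also have "\<dots> = card (noncontractible D) - card (noncontractible D) mod 2"
    using card_kept_noncontractible[OF D] by simp
  finally have "easts D = easts (reduce D) + sum f (contractible D) + (card (noncontractible D) - card (noncontractible D) mod 2)"
    using 1 2 by simp
  moreover have "even (sum f (contractible D))"
  proof (rule dvd_sum)
    fix c assume c: "c \<in> contractible D"
    then obtain i j where "c = {West i, West j} \<or> c = {East i, East j}" by (auto simp: contractible_def)
    then show "even (f c)"
    proof
      assume e: "c = {East i, East j}"
      then have "i \<noteq> j" using c sub sym_in_points(3)[OF D, of "East i" "East j"] by auto
      moreover have "{k. East k \<in> c} = {i, j}" using e by auto
      ultimately show ?thesis by (simp add: f_def)
    qed (simp add: f_def)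
  qed
  moreover have "even (card (noncontractible D) - card (noncontractible D) mod 2)"
    by (simp add: minus_mod_eq_mult_div)
  ultimately show ?thesis using assms(2) by (metis even_add)
qed

text \<open>Since \<open>renumber\<close> keeps every point on its side, a loop that survives the
  reduction comes from a kept loop of the same kind; of these there is at most one, and it is
  noncontractible.\<close>

lemma reduce_in_Bphi:
  assumes D: "sym_pseudodiagram m D" and "even (easts D)"
  shows "reduce D \<in> Bphi m"
proof -
  let ?h = "renumber (\<Union>(kept D))"
  have W: "\<exists>j. a = West j" if "?h a = West i" for a i using that by (cases a) auto
  have E: "\<exists>j. a = East j" if "?h a = East i" for a i using that by (cases a) auto
  have arc: "\<exists>a b. c = {a, b} \<and> {a, b} \<in> arcs D" if "c \<in> kept D" for c
    using sym_arc[OF D] kept_subset[of D] that by (metis subsetD)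
  have "contractible (reduce D) = {}"
  proof (rule ccontr)
    assume "contractible (reduce D) \<noteq> {}"
    then obtain c i j where c: "c \<in> kept D" "?h ` c = {West i, West j} \<or> ?h ` c = {East i, East j}"
      by (auto simp: contractible_def)
    then obtain a b where ab: "c = {a, b}" "{a, b} \<in> arcs D" using arc by metis
    then have "(\<exists>i j. c = {West i, West j}) \<or> (\<exists>i j. c = {East i, East j})"
      using c(2) W[of a] W[of b] E[of a] E[of b] by (auto simp: doubleton_eq_iff; blast)
    then have "c \<in> contractible D" using ab by (auto simp: contractible_def)
    moreover have "contractible D \<inter> noncontractible D = {}"
      by (auto simp: contractible_def noncontractible_def doubleton_eq_iff)
    ultimately show False using c(1) by (auto simp: kept_def split: if_splits)
  qed
  moreover have "card (noncontractible (reduce D)) \<le> 1"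
  proof -
    have "noncontractible (reduce D) \<subseteq> image ?h ` (kept D \<inter> noncontractible D)"
    proof
      fix c assume "c \<in> noncontractible (reduce D)"
      then obtain c' i j where c: "c' \<in> kept D" "c = ?h ` c'" "?h ` c' = {West i, East j}"
        by (auto simp: noncontractible_def)
      then obtain a b where ab: "c' = {a, b}" "{a, b} \<in> arcs D" using arc by metis
      then have "\<exists>i j. c' = {West i, East j}"
        using c(3) W[of a] W[of b] E[of a] E[of b] by (auto simp: doubleton_eq_iff; blast)
      then have "c' \<in> noncontractible D" using ab by (auto simp: noncontractible_def)
      then show "c \<in> image ?h ` (kept D \<inter> noncontractible D)" using c by auto
    qed
    moreover have "finite (kept D \<inter> noncontractible D)"
      using finite_arcs[OF D] kept_subset[of D] by (metis finite_Int finite_subset)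
    ultimately have "card (noncontractible (reduce D)) \<le> card (kept D \<inter> noncontractible D)"
      by (metis card_image_le card_mono dual_order.trans finite_imageI)
    then show ?thesis unfolding card_kept_noncontractible[OF D] by linarith
  qed
  ultimately show ?thesis
    using sym_reduce[OF D] even_easts_reduce[OF assms] by (auto simp: Bphi_def CC_def white_def)
qed

lemma BphiD:
  assumes "D \<in> Bphi m"
  shows "sym_pseudodiagram m D" "even (easts D)" "loop_pairs D = 0"
    "{West i, West j} \<notin> arcs D" "{East i, East j} \<notin> arcs D" "card (noncontractible D) \<le> 1"
  using assms by (auto simp: Bphi_def CC_def white_def contractible_def)

lemma stack_reduce_in_Bphi:
  assumes "D \<in> Bphi m" "D' \<in> Bphi m"
  shows "reduce (stack D D') \<in> Bphi m"
  using reduce_in_Bphi[OF sym_stack[OF BphiD(1)[OF assms(1)] BphiD(1)[OF assms(2)]]] BphiD(2)[OF assms(1)]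
    BphiD(2)[OF assms(2)] by simp

section \<open>Turning a diagram upside down\<close>

fun flip_point :: "pseudodiagram \<Rightarrow> bpoint \<Rightarrow> bpoint" where
  "flip_point D (North i) = South i"
| "flip_point D (South i) = North i"
| "flip_point D (West j) = West (wests D + 1 - j)"
| "flip_point D (East j) = East (easts D + 1 - j)"

definition flip :: "pseudodiagram \<Rightarrow> pseudodiagram" where
  "flip D = Pseudodiagram (wests D) (easts D) (image (flip_point D) ` arcs D) (loop_pairs D)"

lemma flip_simps [simp]:
  "wests (flip D) = wests D" "easts (flip D) = easts D" "loop_pairs (flip D) = loop_pairs D"
  "arcs (flip D) = image (flip_point D) ` arcs D"
  by (simp_all add: flip_def)

lemma flip_point_involution: "a \<in> points m D \<Longrightarrow> flip_point D (flip_point D a) = a"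
  by (cases a) auto

lemma points_flip: "points m (flip D) = points m D" 
  by (simp add: points_def)

lemma flip_point_in_points: "a \<in> points m D \<Longrightarrow> flip_point D a \<in> points m D"
  by (cases a) auto

text \<open>Turning the rectangle upside down reverses the clockwise order, but the numbering still
  starts in the north-west corner. So the \<open>M\<close> points before the western side and the
  \<open>N\<close> points on it are reversed separately, which is a reversal followed by a
  rotation.\<close>

lemma reversed_blocks_less_iff:
  fixes x y M N :: nat
  assumes "1 \<le> x" "x \<le> M + N" "1 \<le> y" "y \<le> M + N"
  shows "(if x \<le> M then M + 1 - x else 2 * M + N + 1 - x) < (if y \<le> M then M + 1 - y else 2 * M + N + 1 - y)
    \<longleftrightarrow> (if y \<le> M then x \<le> M \<and> y < x else x \<le> M \<or> y < x)"
  using assms by auto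

lemma pos_flip:
  assumes "a \<in> points m D"
  shows "pos m (flip D) (flip_point D a) =
    (if pos m D a \<le> 2 * m + easts D then 2 * m + easts D + 1 - pos m D a
     else 2 * (2 * m + easts D) + wests D + 1 - pos m D a)"
  using assms by (cases a) auto

lemma sym_flip:
  assumes D: "sym_pseudodiagram m D"
  shows "sym_pseudodiagram m (flip D)"
proof (rule sym_image[OF D order_refl])
  show "inj_on (flip_point D) (\<Union>(arcs D))"
    unfolding Union_arcs[OF D] using flip_point_involution by (rule inj_on_inverseI)
  show "points m (flip D) = flip_point D ` \<Union>(arcs D)"
    unfolding Union_arcs[OF D] points_flip
    using flip_point_involution flip_point_in_points by (force simp: image_iff)
  show "arcs (flip D) = image (flip_point D) ` arcs D" by simp
  fix a b c d
  let ?p = "\<lambda>a. pos m (flip D) (flip_point D a)"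
  assume arcs: "{a, c} \<in> arcs D" "{b, d} \<in> arcs D" and lt: "?p a < ?p b" "?p b < ?p c" "?p c < ?p d"
  have X: "a \<in> points m D" "b \<in> points m D" "c \<in> points m D" "d \<in> points m D"
    using sym_in_points[OF D] arcs by blast+
  have "a \<notin> {b, d}" "c \<notin> {b, d}" using lt by auto
  then have "(pos m D a < pos m D b \<longleftrightarrow> pos m D c < pos m D b) \<longleftrightarrow> (pos m D a < pos m D d \<longleftrightarrow> pos m D c < pos m D d)"
    using sym_noncrossing[OF D arcs] by simp
  moreover have "?p x < ?p y \<longleftrightarrow> (if pos m D y \<le> 2 * m + easts D then pos m D x \<le> 2 * m + easts D \<and> pos m D y < pos m D x
      else pos m D x \<le> 2 * m + easts D \<or> pos m D y < pos m D x)"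
    if "x \<in> points m D" "y \<in> points m D" for x y
    unfolding pos_flip[OF that(1)] pos_flip[OF that(2)]
    by (rule reversed_blocks_less_iff) (use pos_bounds that in auto)
  note less = this[OF X(1,2)] this[OF X(2,3)] this[OF X(3,4)]
  \<comment> \<open>The separation form of noncrossing survives reversal and rotation; the cases
    record which of the four points lie on the western side.\<close>
  ultimately show False using lt unfolding less
    by (cases "pos m D a \<le> 2 * m + easts D"; cases "pos m D b \<le> 2 * m + easts D";
        cases "pos m D c \<le> 2 * m + easts D"; cases "pos m D d \<le> 2 * m + easts D"; simp)
qed

lemma flip_in_Bphi:
  assumes D: "D \<in> Bphi m"
  shows "flip D \<in> Bphi m"
proof -
  have W: "\<exists>j. a = West j" if "flip_point D a = West i" for a i using that by (cases a) auto
  have E: "\<exists>j. a = East j" if "flip_point D a = East i" for a i using that by (cases a) auto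
  note arc = sym_arc[OF BphiD(1)[OF D]]
  have "contractible (flip D) = {}"
  proof (rule ccontr)
    assume "contractible (flip D) \<noteq> {}"
    then obtain c i j where c: "c \<in> arcs D" "flip_point D ` c = {West i, West j} \<or> flip_point D ` c = {East i, East j}"
      by (auto simp: contractible_def)
    then obtain a b where ab: "c = {a, b}" using arc by metis
    then have "(\<exists>i j. c = {West i, West j}) \<or> (\<exists>i j. c = {East i, East j})"
      using c(2) W[of a] W[of b] E[of a] E[of b] by (auto simp: doubleton_eq_iff; blast)
    then show False using BphiD[OF D] c(1) by auto
  qed
  moreover have "card (noncontractible (flip D)) \<le> 1"
  proof -
    have "noncontractible (flip D) \<subseteq> image (flip_point D) ` noncontractible D"
    proof
      fix c assume "c \<in> noncontractible (flip D)"
      then obtain c' i j where c: "c' \<in> arcs D" "c = flip_point D ` c'" "flip_point D ` c' = {West i, East j}"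
        by (auto simp: noncontractible_def)
      then obtain a b where ab: "c' = {a, b}" using arc by metis
      then have "\<exists>i j. c' = {West i, East j}"
        using c(3) W[of a] W[of b] E[of a] E[of b] by (auto simp: doubleton_eq_iff; blast)
      then have "c' \<in> noncontractible D" using c(1) by (auto simp: noncontractible_def)
      then show "c \<in> image (flip_point D) ` noncontractible D" using c by auto
    qed
    moreover have "finite (noncontractible D)"
      using finite_arcs[OF BphiD(1)[OF D]] by (simp add: noncontractible_def)
    ultimately have "card (noncontractible (flip D)) \<le> card (noncontractible D)"
      by (metis card_image_le card_mono dual_order.trans finite_imageI)
    then show ?thesis using BphiD(6)[OF D] by linarith
  qed
  ultimately show ?thesis
    using sym_flip[OF BphiD(1)[OF D]] BphiD[OF D] by (auto simp: Bphi_def CC_def white_def)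
qed

subsection \<open>Half diagrams\<close>

definition partner :: "pseudodiagram \<Rightarrow> bpoint \<Rightarrow> bpoint" where
  "partner D a = (THE b. {a, b} \<in> arcs D)"

lemma partner_eq: "sym_pseudodiagram m D \<Longrightarrow> {a, b} \<in> arcs D \<Longrightarrow> partner D a = b"
  unfolding partner_def using sym_unique by blast

lemma partner_arc: "sym_pseudodiagram m D \<Longrightarrow> a \<in> points m D \<Longrightarrow> {a, partner D a} \<in> arcs D"
  using sym_ex partner_eq by metis

text \<open>Indices on the other three sides are forgotten because they change when a diagram is put
  on top; the side itself does not change, except for propagating lines.\<close>

fun south_type :: "bpoint \<Rightarrow> bpoint" where
  "south_type (South i) = South i"
| "south_type (North i) = North 0"
| "south_type (West i) = West 0"
| "south_type (East i) = East 0"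

fun north_type :: "bpoint \<Rightarrow> bpoint" where
  "north_type (South i) = South 0"
| "north_type (North i) = North i"
| "north_type (West i) = West 0"
| "north_type (East i) = East 0"

fun flip_type :: "bpoint \<Rightarrow> bpoint" where
  "flip_type (South i) = North i"
| "flip_type (North i) = South i"
| "flip_type (West i) = West i"
| "flip_type (East i) = East i"

text \<open>
  The index \<open>0\<close>, which no boundary point has, marks lines leaving the half.
\<close>

definition low :: "pseudodiagram \<Rightarrow> nat \<Rightarrow> bpoint" where
  "low D i = south_type (partner D (South i))"

definition up :: "pseudodiagram \<Rightarrow> nat \<Rightarrow> bpoint" where
  "up D i = north_type (partner D (North i))"

lemma type_renumber [simp]:
  "south_type (renumber X b) = south_type b" "north_type (renumber X b) = north_type b"
  by (cases b; simp)+

lemma type_flip_point [simp]: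
  "south_type (flip_point D b) = flip_type (north_type b)"
  "north_type (flip_point D b) = flip_type (south_type b)"
  by (cases b; simp)+

text \<open>Reduction deletes only loops, which end at no vertex, and it renumbers only the crossing
  points, whose indices the halves do not record.\<close>

lemma halves_reduce:
  assumes D: "sym_pseudodiagram m D" and i: "i \<in> {1..m}"
  shows "low (reduce D) i = low D i" "up (reduce D) i = up D i"
proof -
  let ?h = "renumber (\<Union>(kept D))"
  have *: "partner (reduce D) a = ?h (partner D a)"
    if "a \<in> points m D" "a \<in> range North \<union> range South" for a
  proof -
    have "{a, partner D a} \<in> kept D"
      using partner_arc[OF D that(1)] that(2) by (intro kept_vertex) auto
    then have "?h ` {a, partner D a} \<in> arcs (reduce D)" unfolding reduce_simps by (rule imageI)
    moreover have "?h a = a" using that(2) by auto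
    ultimately show ?thesis using partner_eq[OF sym_reduce[OF D]] by simp
  qed
  show "low (reduce D) i = low D i" "up (reduce D) i = up D i"
    using *[of "South i"] *[of "North i"] i by (simp_all add: low_def up_def)
qed

lemma halves_flip:
  assumes D: "sym_pseudodiagram m D" and i: "i \<in> {1..m}"
  shows "low (flip D) i = flip_type (up D i)" "up (flip D) i = flip_type (low D i)"
proof -
  have *: "partner (flip D) (flip_point D a) = flip_point D (partner D a)" if "a \<in> points m D" for a
  proof -
    have "flip_point D ` {a, partner D a} \<in> arcs (flip D)"
      unfolding flip_simps using partner_arc[OF D that] by (rule imageI)
    then show ?thesis using partner_eq[OF sym_flip[OF D]] by simp
  qed
  show "low (flip D) i = flip_type (up D i)" "up (flip D) i = flip_type (low D i)"
    using *[of "South i"] *[of "North i"] i by (simp_all add: low_def up_def)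
qed

section \<open>Halves of a concatenation\<close>

lemma upper_link:
  assumes "{a, b} \<in> arcs D" shows "(upper a, upper b) \<in> (link_rel D D')\<^sup>*"
proof -
  have "upper ` {a, b} \<in> glued D D'" unfolding glued_def using assms by blast
  then have "(upper a, upper b) \<in> link_rel D D'"
    unfolding link_rel_def by (intro CollectI case_prodI bexI[of _ "upper ` {a, b}"] conjI) simp_all
  then show ?thesis by blast
qed

lemma lower_link:
  assumes "{a, b} \<in> arcs D'"
  shows "(lower (wests D) (easts D) a, lower (wests D) (easts D) b) \<in> (link_rel D D')\<^sup>*"
proof -
  have "lower (wests D) (easts D) ` {a, b} \<in> glued D D'" unfolding glued_def using assms by blast
  then have "(lower (wests D) (easts D) a, lower (wests D) (easts D) b) \<in> link_rel D D'"
    unfolding link_rel_def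
    by (intro CollectI case_prodI bexI[of _ "lower (wests D) (easts D) ` {a, b}"] conjI) simp_all
  then show ?thesis by blast
qed

lemma partner_stack:
  assumes D: "sym_pseudodiagram m D" "sym_pseudodiagram m D'"
    and "joined D D' a b" "a \<noteq> b" "a \<in> points m (stack D D')" "b \<in> points m (stack D D')"
  shows "partner (stack D D') a = b"
  using partner_eq[OF sym_stack[OF D]] arc_stack_iff[OF D] assms(3-) by blast

text \<open>A line of the lower diagram that avoids the glued edge is a whole curve of the
  concatenation, up to a shift of its index on a side.\<close>

lemma low_stack:
  assumes D: "sym_pseudodiagram m D" "sym_pseudodiagram m D'" and i: "i \<in> {1..m}"
    and nonprop: "low D' i \<noteq> North 0"
  shows "low (stack D D') i = low D' i"
proof -
  let ?b = "partner D' (South i)"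
  have arc: "{South i, ?b} \<in> arcs D'" using partner_arc[OF D(2)] i by auto
  then have ne: "?b \<noteq> South i" "?b \<in> points m D'" using sym_in_points[OF D(2) arc] by auto
  have link: "(Inl (South i), lower (wests D) (easts D) ?b) \<in> (link_rel D D')\<^sup>*"
    using lower_link[OF arc] by simp
  obtain z where z: "lower (wests D) (easts D) ?b = Inl z" "z \<in> points m (stack D D')"
    "z \<noteq> South i" "south_type z = south_type ?b"
    using ne nonprop by (cases ?b) (auto simp: low_def)
  have "partner (stack D D') (South i) = z"
    using link z i by (intro partner_stack[OF D]) (auto simp: joined_def)
  then show ?thesis using z(4) by (simp add: low_def)
qed

lemma up_stack:
  assumes D: "sym_pseudodiagram m D" "sym_pseudodiagram m D'" and i: "i \<in> {1..m}"
    and nonprop: "up D i \<noteq> South 0"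
  shows "up (stack D D') i = up D i"
proof -
  let ?b = "partner D (North i)"
  have arc: "{North i, ?b} \<in> arcs D" using partner_arc[OF D(1)] i by auto
  then have ne: "?b \<noteq> North i" "?b \<in> points m D" using sym_in_points[OF D(1) arc] by auto
  have link: "(Inl (North i), upper ?b) \<in> (link_rel D D')\<^sup>*"
    using upper_link[OF arc] by simp
  have z: "upper ?b = Inl ?b" "?b \<in> points m (stack D D')"
    using ne nonprop by (cases ?b; auto simp: up_def)+
  have "partner (stack D D') (North i) = ?b"
    using link z ne i by (intro partner_stack[OF D]) (auto simp: joined_def)
  then show ?thesis by (simp add: up_def)
qed

text \<open>A propagating line of \<open>D\<close> that arrives at the glued edge is continued at
  once by a propagating line of \<open>D'\<close>, because the mirrored half leaves it no other
  choice. So propagating lines meet in pairs and none is turned back; all other lines at the outer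
  edges avoid the glued edge.\<close>

lemma halves_stack_mirrored:
  assumes D: "sym_pseudodiagram m D" "sym_pseudodiagram m D'"
    and mirror: "\<And>i. i \<in> {1..m} \<Longrightarrow> low D i = flip_type (up D' i)" and i: "i \<in> {1..m}"
  shows "up (stack D D') i = up D i" "low (stack D D') i = low D' i"
proof -
  have through: "\<exists>k l. partner (stack D D') (North k) = South l \<and> partner (stack D D') (South l) = North k \<and>
      partner D (South j) = North k \<and> partner D' (North j) = South l"
    if j: "j \<in> {1..m}" and pr: "low D j = North 0 \<or> up D' j = South 0" for j
  proof -
    have "low D j = North 0" using pr mirror[OF j] by auto
    then obtain k where k: "partner D (South j) = North k"
      by (cases "partner D (South j)") (auto simp: low_def)
    have "flip_type (up D' j) = North 0" using \<open>low D j = North 0\<close> mirror[OF j] by simp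
    then obtain l where l: "partner D' (North j) = South l"
      by (cases "partner D' (North j)") (auto simp: up_def)
    have arcs: "{South j, North k} \<in> arcs D" "{North j, South l} \<in> arcs D'"
      using partner_arc[OF D(1), of "South j"] partner_arc[OF D(2), of "North j"] j k l by auto
    then have kl: "k \<in> {1..m}" "l \<in> {1..m}" using sym_in_points(2)[OF D(1)] sym_in_points(2)[OF D(2)] by fastforce+
    have "(Inr j, Inl (North k)) \<in> (link_rel D D')\<^sup>*" "(Inr j, Inl (South l)) \<in> (link_rel D D')\<^sup>*"
      using upper_link[OF arcs(1)] lower_link[OF arcs(2)] by simp_all
    then have "joined D D' (North k) (South l)" "joined D D' (South l) (North k)"
      unfolding joined_def using sym_link_rel rtrancl_trans by metis+
    then show ?thesis using k l kl
      by (intro exI[of _ k] exI[of _ l] conjI partner_stack[OF D]) auto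
  qed
  show "up (stack D D') i = up D i"
  proof (cases "up D i = South 0")
    case True
    then obtain j where j: "partner D (North i) = South j" by (cases "partner D (North i)") (auto simp: up_def)
    then have arc: "{North i, South j} \<in> arcs D" using partner_arc[OF D(1), of "North i"] i by auto
    then have jm: "j \<in> {1..m}" using sym_in_points(2)[OF D(1)] by fastforce
    have ps: "partner D (South j) = North i" using partner_eq[OF D(1)] arc by (metis insert_commute)
    then obtain k l where kl: "partner (stack D D') (North k) = South l" "partner D (South j) = North k"
      using through[OF jm] by (auto simp: low_def)
    then have "k = i" using ps by simp
    then show ?thesis using kl(1) True by (simp add: up_def)
  qed (rule up_stack[OF D i])
  show "low (stack D D') i = low D' i"
  proof (cases "low D' i = North 0")
    case True
    then obtain j where j: "partner D' (South i) = North j" by (cases "partner D' (South i)") (auto simp: low_def)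
    then have arc: "{South i, North j} \<in> arcs D'" using partner_arc[OF D(2), of "South i"] i by auto
    then have jm: "j \<in> {1..m}" using sym_in_points(2)[OF D(2)] by fastforce
    have ps: "partner D' (North j) = South i" using partner_eq[OF D(2)] arc by (metis insert_commute)
    then obtain k l where kl: "partner (stack D D') (South l) = North k" "partner D' (North j) = South l"
      using through[OF jm] by (auto simp: up_def)
    then have "l = i" using ps by simp
    then show ?thesis using kl(1) True by (simp add: low_def)
  qed (rule low_stack[OF D i])
qed

lemma num_prop_low:
  assumes D: "sym_pseudodiagram m D"
  shows "num_prop D = card {i \<in> {1..m}. low D i = North 0}"
proof -
  have "bij_betw (\<lambda>i. {South i, partner D (South i)}) {i \<in> {1..m}. low D i = North 0} (propagating D)"
  proof (rule bij_betwI')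
    fix i assume "i \<in> {i \<in> {1..m}. low D i = North 0}"
    then have i: "i \<in> {1..m}" "low D i = North 0" by auto
    then obtain k where k: "partner D (South i) = North k" by (cases "partner D (South i)") (auto simp: low_def)
    then show "{South i, partner D (South i)} \<in> propagating D"
      using partner_arc[OF D, of "South i"] i by (auto simp: propagating_def insert_commute)
    fix j assume "j \<in> {i \<in> {1..m}. low D i = North 0}"
    then obtain l where "partner D (South j) = North l" by (cases "partner D (South j)") (auto simp: low_def)
    then show "({South i, partner D (South i)} = {South j, partner D (South j)}) = (i = j)"
      using k by (auto simp: doubleton_eq_iff)
  next
    fix c assume "c \<in> propagating D"
    then obtain i j where c: "c = {South j, North i}" "c \<in> arcs D" by (auto simp: propagating_def insert_commute)
    then have "partner D (South j) = North i" using partner_eq[OF D] by auto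
    moreover have "j \<in> {1..m}" using sym_in_points(1)[OF D, of "South j" "North i"] c by auto
    ultimately show "\<exists>i\<in>{i \<in> {1..m}. low D i = North 0}. c = {South i, partner D (South i)}"
      using c by (intro bexI[of _ j]) (auto simp: low_def)
  qed
  then show ?thesis unfolding num_prop_def by (rule bij_betw_same_card[symmetric])
qed

text \<open>The southern lines of \<open>d\<close> that do not propagate survive in every product.
  Hence the southern ends of propagating lines can only become fewer, and if their number stays the
  same, then so does the whole lower half.\<close>

lemma num_prop_stack_le:
  assumes d: "d \<in> Bphi m" "d' \<in> Bphi m"
  defines "e \<equiv> reduce (stack d' d)"
  shows "num_prop e \<le> num_prop d"
    and "num_prop e = num_prop d \<Longrightarrow> i \<in> {1..m} \<Longrightarrow> low e i = low d i"
proof -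
  note D = BphiD(1)[OF d(2)] BphiD(1)[OF d(1)]
  have e: "sym_pseudodiagram m e" unfolding e_def by (intro sym_reduce sym_stack D)
  have low: "low e i = low d i" if "i \<in> {1..m}" "low d i \<noteq> North 0" for i
    using halves_reduce(1)[OF sym_stack[OF D]] low_stack[OF D] that by (simp add: e_def)
  then have sub: "{i \<in> {1..m}. low e i = North 0} \<subseteq> {i \<in> {1..m}. low d i = North 0}"
    by (metis (mono_tags, lifting) Collect_mono)
  show "num_prop e \<le> num_prop d"
    unfolding num_prop_low[OF e] num_prop_low[OF D(2)] using sub by (intro card_mono) auto
  assume "num_prop e = num_prop d" and i: "i \<in> {1..m}"
  then have "{i \<in> {1..m}. low e i = North 0} = {i \<in> {1..m}. low d i = North 0}"
    unfolding num_prop_low[OF e] num_prop_low[OF D(2)] using sub by (intro card_subset_eq) auto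
  then show "low e i = low d i" using low i by (cases "low d i = North 0") auto
qed

subsection \<open>Noncrossing matchings and their closing points\<close>

text \<open>Pairs are oriented, opening point first, so that the second components are the closing
  points. Working with positions makes segments of different diagrams comparable.\<close>

definition nc_matching :: "nat \<Rightarrow> (nat \<times> nat) set \<Rightarrow> bool" where
  "nc_matching n M \<longleftrightarrow>
     (\<forall>a b. (a, b) \<in> M \<longrightarrow> 1 \<le> a \<and> a < b \<and> b \<le> n) \<and>
     (\<forall>p\<in>{1..n}. \<exists>q. (p, q) \<in> M \<or> (q, p) \<in> M) \<and>
     (\<forall>p q q'. (p, q) \<in> M \<longrightarrow> (p, q') \<in> M \<longrightarrow> q = q') \<and>
     (\<forall>p q q'. (q, p) \<in> M \<longrightarrow> (q', p) \<in> M \<longrightarrow> q = q') \<and>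
     (\<forall>p q q'. (p, q) \<in> M \<longrightarrow> (q', p) \<notin> M) \<and>
     (\<forall>a b c d. (a, b) \<in> M \<longrightarrow> (c, d) \<in> M \<longrightarrow> \<not> (a < c \<and> c < b \<and> b < d))"

lemma nc_matchingD:
  assumes "nc_matching n M"
  shows "(a, b) \<in> M \<Longrightarrow> 1 \<le> a \<and> a < b \<and> b \<le> n"
    "p \<in> {1..n} \<Longrightarrow> \<exists>q. (p, q) \<in> M \<or> (q, p) \<in> M"
    "(p, q) \<in> M \<Longrightarrow> (p, q') \<in> M \<Longrightarrow> q = q'"
    "(q, p) \<in> M \<Longrightarrow> (q', p) \<in> M \<Longrightarrow> q = q'"
    "(p, q) \<in> M \<Longrightarrow> (q', p) \<in> M \<Longrightarrow> False"
    "(a, b) \<in> M \<Longrightarrow> (c, d) \<in> M \<Longrightarrow> a < c \<Longrightarrow> c < b \<Longrightarrow> b < d \<Longrightarrow> False"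
  using assms unfolding nc_matching_def by blast+

lemma nc_matching_closer:
  assumes "nc_matching n M" "p \<in> {1..n}"
  shows "p \<in> snd ` M \<longleftrightarrow> (\<exists>q. (q, p) \<in> M)" "p \<notin> snd ` M \<longleftrightarrow> (\<exists>q. (p, q) \<in> M)"
  using nc_matchingD(2)[OF assms] nc_matchingD(5)[OF assms(1), of p] by force+

text \<open>
  The induction works outwards from the innermost arcs.
\<close>

lemma nc_matching_local:
  assumes M: "nc_matching n M" and M': "nc_matching n' M'"
    and bounds: "1 \<le> s" "s + L \<le> n" "1 \<le> s'" "s' + L \<le> n'"
    and closers: "\<And>i. i \<le> L \<Longrightarrow> s + i \<in> snd ` M \<longleftrightarrow> s' + i \<in> snd ` M'"
    and arc: "(s + i, s + j) \<in> M" "j \<le> L"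
  shows "(s' + i, s' + j) \<in> M'"
  using arc
proof (induction "j - i" arbitrary: i j rule: less_induct)
  case less
  have "i < j" using nc_matchingD(1)[OF M less.prems(1)] by simp
  \<comment> \<open>The points strictly between the ends are matched among themselves in
    \<open>M\<close>, because an arc leaving the interval would cross the given one. By induction
    their copies are matched among themselves in \<open>M'\<close>.\<close>
  have inner: "\<exists>q1 q2. (s' + q1, s' + q2) \<in> M' \<and> i < q1 \<and> q1 < j \<and> i < q2 \<and> q2 < j \<and> (q = q1 \<or> q = q2)"
    if q: "i < q" "q < j" for q
  proof -
    have "s + q \<in> {1..n}" using q less.prems(2) bounds by auto
    then obtain r where r: "(s + q, r) \<in> M \<or> (r, s + q) \<in> M" using nc_matchingD(2)[OF M] by blast
    then show ?thesis
    proof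
      assume a: "(s + q, r) \<in> M"
      have "s + q < r" using nc_matchingD(1)[OF M a] by simp
      moreover have "\<not> s + j < r" using nc_matchingD(6)[OF M less.prems(1) a] q by auto
      moreover have "r \<noteq> s + j" using nc_matchingD(4)[OF M] less.prems(1) a q by fastforce
      ultimately have r': "r = s + (r - s)" "q < r - s" "r - s < j" by auto
      then have "(s' + q, s' + (r - s)) \<in> M'"
        using less.hyps[of "r - s" q] a q less.prems(2) by auto
      then show ?thesis using r' q by (intro exI[of _ q] exI[of _ "r - s"]) auto
    next
      assume a: "(r, s + q) \<in> M"
      have "r < s + q" using nc_matchingD(1)[OF M a] by simp
      moreover have "\<not> r < s + i" using nc_matchingD(6)[OF M a less.prems(1)] q by auto
      moreover have "r \<noteq> s + i" using nc_matchingD(3)[OF M] less.prems(1) a q by fastforce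
      ultimately have r': "r = s + (r - s)" "i < r - s" "r - s < q" by auto
      then have "(s' + (r - s), s' + q) \<in> M'"
        using less.hyps[of q "r - s"] a q less.prems(2) by auto
      then show ?thesis using r' q by (intro exI[of _ "r - s"] exI[of _ q]) auto
    qed
  qed
  have ij: "s + i \<in> {1..n}" "s + j \<in> {1..n}" "s' + i \<in> {1..n'}" "s' + j \<in> {1..n'}"
    using \<open>i < j\<close> less.prems(2) bounds by auto
  have "s + i \<notin> snd ` M" using nc_matching_closer(2)[OF M ij(1)] less.prems(1) by blast
  then have "s' + i \<notin> snd ` M'" using closers[of i] \<open>i < j\<close> less.prems(2) by auto
  then obtain b where b: "(s' + i, b) \<in> M'" using nc_matching_closer(2)[OF M' ij(3)] by blast
  have "s + j \<in> snd ` M" using nc_matching_closer(1)[OF M ij(2)] less.prems(1) by blast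
  then have "s' + j \<in> snd ` M'" using closers[of j] less.prems(2) by auto
  then obtain a where a: "(a, s' + j) \<in> M'" using nc_matching_closer(1)[OF M' ij(4)] by blast
  have b_ge: "s' + j \<le> b"
  proof (rule ccontr)
    assume "\<not> s' + j \<le> b"
    moreover have "s' + i < b" using nc_matchingD(1)[OF M' b] by simp
    ultimately have "b = s' + (b - s')" "i < b - s'" "b - s' < j" by auto
    then obtain q1 q2 where q: "(s' + q1, s' + q2) \<in> M'" "i < q1" "b = s' + q1 \<or> b = s' + q2"
      using inner[of "b - s'"] by metis
    then show False using nc_matchingD(4)[OF M' b] nc_matchingD(5)[OF M' _ b] by fastforce
  qed
  have a_le: "a \<le> s' + i"
  proof (rule ccontr)
    assume "\<not> a \<le> s' + i"
    moreover have "a < s' + j" using nc_matchingD(1)[OF M' a] by simp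
    ultimately have "a = s' + (a - s')" "i < a - s'" "a - s' < j" by auto
    then obtain q1 q2 where q: "(s' + q1, s' + q2) \<in> M'" "q2 < j" "a = s' + q1 \<or> a = s' + q2"
      using inner[of "a - s'"] by metis
    then show False using nc_matchingD(3)[OF M' a] nc_matchingD(5)[OF M' a] by fastforce
  qed
  \<comment> \<open>The partner \<open>b\<close> of the left copy lies at or beyond the right one,
    and the partner \<open>a\<close> of the right copy at or before the left one. If the two copies
    were not matched with each other, the arcs to \<open>b\<close> and from \<open>a\<close> would
    cross.\<close>
  show ?case
  proof (cases "b = s' + j")
    case False
    then have "s' + j < b" using b_ge by simp
    moreover have "a \<noteq> s' + i" using nc_matchingD(3)[OF M' b] a False by metis
    ultimately show ?thesis using nc_matchingD(6)[OF M' a b] a_le \<open>i < j\<close> by auto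
  qed (use b in simp)
qed

lemma int_height_Suc:
  "int (Suc p) - 2 * int (card (Z \<inter> {1..Suc p})) =
    int p - 2 * int (card (Z \<inter> {1..p})) + (if Suc p \<in> Z then - 1 else 1)"
proof -
  have "{1..Suc p} = insert (Suc p) {1..p}" by auto
  then show ?thesis by (cases "Suc p \<in> Z") auto
qed

text \<open>\<open>Z\<close> is read as the set of down steps of a Dyck path with height
  \<open>h\<close>. An opening point is matched with the first later step that returns to the height
  before it.\<close>

lemma ex_nc_matching:
  assumes Z: "Z \<subseteq> {1..n}" and ballot: "\<And>p. p \<le> n \<Longrightarrow> 2 * card (Z \<inter> {1..p}) \<le> p" and "2 * card Z = n"
  shows "\<exists>M. nc_matching n M \<and> snd ` M = Z"
proof -
  define h where "h p = int p - 2 * int (card (Z \<inter> {1..p}))" for p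
  have h_step: "h p = h (p - 1) + (if p \<in> Z then - 1 else 1)" if "1 \<le> p" for p
    using int_height_Suc[of "p - 1" Z] that by (simp add: h_def)
  have h_ge: "0 \<le> h p" if "p \<le> n" for p using ballot[OF that] by (simp add: h_def)
  have "Z \<inter> {1..n} = Z" using Z by auto
  then have h_n: "h n = 0" using assms(3) by (simp add: h_def)
  have h_0: "h 0 = 0" by (simp add: h_def)
  define M where "M = {(a, b). 1 \<le> a \<and> a < b \<and> b \<le> n \<and> h b = h (a - 1) \<and> (\<forall>c. a \<le> c \<and> c < b \<longrightarrow> h (a - 1) < h c)}"
  have M_iff: "(a, b) \<in> M \<longleftrightarrow> 1 \<le> a \<and> a < b \<and> b \<le> n \<and> h b = h (a - 1) \<and> (\<forall>c. a \<le> c \<and> c < b \<longrightarrow> h (a - 1) < h c)"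
    for a b by (simp add: M_def)
  have opener: "a \<notin> Z" if "(a, b) \<in> M" for a b
    using that h_step[of a] unfolding M_iff by (auto split: if_splits)
  have closer: "b \<in> Z" if "(a, b) \<in> M" for a b
  proof (rule ccontr)
    assume "b \<notin> Z"
    then have "h b = h (b - 1) + 1" using that h_step[of b] unfolding M_iff by auto
    moreover have "h (a - 1) < h (b - 1)" using that unfolding M_iff by auto
    ultimately show False using that unfolding M_iff by auto
  qed
  have ex_b: "\<exists>b. (p, b) \<in> M" if p: "p \<in> {1..n}" "p \<notin> Z" for p
  proof -
    define b where "b = (LEAST b. p < b \<and> h b \<le> h (p - 1))"
    have hp: "h p = h (p - 1) + 1" using h_step[of p] p by auto
    have "0 \<le> h (p - 1)" using h_ge[of "p - 1"] p by auto
    then have "p \<noteq> n" using hp h_n by auto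
    then have n: "p < n \<and> h n \<le> h (p - 1)" using p h_n \<open>0 \<le> h (p - 1)\<close> by auto
    have b: "p < b" "h b \<le> h (p - 1)" unfolding b_def using LeastI[of "\<lambda>b. p < b \<and> h b \<le> h (p - 1)", OF n] by auto
    have "b \<le> n" unfolding b_def using n by (rule Least_le)
    have between: "h (p - 1) < h c" if "p \<le> c" "c < b" for c
    proof (cases "c = p")
      case False
      then show ?thesis using not_less_Least[of c "\<lambda>b. p < b \<and> h b \<le> h (p - 1)"] that unfolding b_def by auto
    qed (use hp in simp)
    have "p \<le> b - 1" "b - 1 < b" "1 \<le> b" using b by auto
    \<comment> \<open>Steps have size one, so the path cannot fall below the level
      \<open>h (p - 1)\<close> without attaining it first.\<close>
    then have "h (p - 1) \<le> h b" using between[of "b - 1"] h_step[of b] by (simp split: if_splits)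
    then show ?thesis using b \<open>b \<le> n\<close> between p unfolding M_iff by (intro exI[of _ b]) auto
  qed
  have ex_a: "\<exists>a. (a, p) \<in> M" if p: "p \<in> {1..n}" "p \<in> Z" for p
  proof -
    \<comment> \<open>After \<open>q\<close> the path stays above the level \<open>h p\<close> until
      just before \<open>p\<close>. The opening point is \<open>q + 1\<close> and not
      \<open>q\<close>, since \<open>M\<close> refers to the height before the opening step.\<close>
    define q where "q = (GREATEST q. q < p \<and> h q \<le> h p)"
    have hp: "h (p - 1) = h p + 1" using h_step[of p] p by auto
    have 0: "0 < p \<and> h 0 \<le> h p" using p h_ge[of p] h_0 by auto
    have bound: "\<forall>y. y < p \<and> h y \<le> h p \<longrightarrow> y \<le> p" by auto
    have q: "q < p" "h q \<le> h p" unfolding q_def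
      using GreatestI_nat[of "\<lambda>q. q < p \<and> h q \<le> h p" 0 p] 0 by auto
    have between: "h p < h c" if "q < c" "c < p" for c
    proof (rule ccontr)
      assume "\<not> h p < h c"
      then have "c \<le> q" unfolding q_def using that Greatest_le_nat[of "\<lambda>q. q < p \<and> h q \<le> h p" c p] by auto
      then show False using that by simp
    qed
    have "q \<noteq> p - 1" using q(2) hp by auto
    then have sq: "q + 1 < p" using q(1) by simp
    have "h p \<le> h q" using between[of "q + 1"] h_step[of "q + 1"] sq by (auto split: if_splits)
    then show ?thesis using q between sq p unfolding M_iff by (intro exI[of _ "q + 1"]) auto
  qed
  have "nc_matching n M"
    unfolding nc_matching_def
  proof (intro conjI allI impI ballI)
    fix p assume "p \<in> {1..n}"
    then show "\<exists>q. (p, q) \<in> M \<or> (q, p) \<in> M" using ex_a ex_b by blast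
  next
    fix p q q' assume *: "(p, q) \<in> M" "(p, q') \<in> M"
    have "False" if "b < b'" "(p, b) \<in> M" "(p, b') \<in> M" for b b'
    proof -
      have "p \<le> b \<and> b < b'" using that unfolding M_iff by auto
      then have "h (p - 1) < h b" using that(3) unfolding M_iff by blast
      then show False using that unfolding M_iff by auto
    qed
    then show "q = q'" using * by (meson linorder_neqE_nat)
  next
    fix p q q' assume *: "(q, p) \<in> M" "(q', p) \<in> M"
    have "False" if "a < a'" "(a, p) \<in> M" "(a', p) \<in> M" for a a'
    proof -
      have "a \<le> a' - 1 \<and> a' - 1 < p" using that unfolding M_iff by auto
      then have "h (a - 1) < h (a' - 1)" using that(2) unfolding M_iff by blast
      then show False using that unfolding M_iff by auto
    qed
    then show "q = q'" using * by (meson linorder_neqE_nat)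
  next
    fix p q q' assume "(p, q) \<in> M"
    then show "(q', p) \<notin> M" using opener closer by blast
  next
    fix a b c d assume *: "(a, b) \<in> M" "(c, d) \<in> M"
    show "\<not> (a < c \<and> c < b \<and> b < d)"
    proof
      assume lt: "a < c \<and> c < b \<and> b < d"
      then have "a \<le> c - 1 \<and> c - 1 < b" by auto
      then have "h (a - 1) < h (c - 1)" using *(1) unfolding M_iff by blast
      moreover have "h (c - 1) < h b" using *(2) lt unfolding M_iff by auto
      moreover have "h b = h (a - 1)" using *(1) unfolding M_iff by auto
      ultimately show False by auto
    qed
  qed (auto simp: M_iff)
  moreover have "snd ` M = Z"
  proof
    show "snd ` M \<subseteq> Z" using closer by auto
    show "Z \<subseteq> snd ` M"
    proof
      fix p assume "p \<in> Z"
      then obtain a where "(a, p) \<in> M" using ex_a[of p] Z by blast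
      then show "p \<in> snd ` M" by force
    qed
  qed
  ultimately show ?thesis by blast
qed

text \<open>A point up to \<open>q\<close> lies on an arc closed by \<open>q\<close>, which
  contributes two such points, or on an arc passing over \<open>q\<close>, which contributes
  one.\<close>

lemma nc_matching_height:
  assumes M: "nc_matching n M" and "q \<le> n"
  shows "q = 2 * card (snd ` M \<inter> {1..q}) + card {(a, b) \<in> M. a \<le> q \<and> q < b}"
proof -
  have "M \<subseteq> {1..n} \<times> {1..n}" using nc_matchingD(1)[OF M] by fastforce
  then have fin: "finite M" by (rule finite_subset) simp
  let ?C = "{(a, b) \<in> M. b \<le> q}" and ?O = "{(a, b) \<in> M. a \<le> q}" and ?H = "{(a, b) \<in> M. a \<le> q \<and> q < b}"
  have finCO: "finite ?C" "finite ?O" "finite ?H" by (rule finite_subset[OF _ fin]; auto)+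
  have "snd ` M \<inter> {1..q} = snd ` ?C" using nc_matchingD(1)[OF M] by force
  moreover have "inj_on snd ?C" using nc_matchingD(4)[OF M] by (auto simp: inj_on_def)
  ultimately have C: "card (snd ` M \<inter> {1..q}) = card ?C" by (simp add: card_image)
  have "{1..q} - snd ` M = fst ` ?O"
  proof
    show "{1..q} - snd ` M \<subseteq> fst ` ?O"
    proof
      fix p assume p: "p \<in> {1..q} - snd ` M"
      then obtain r where "(p, r) \<in> M" using nc_matching_closer(2)[OF M, of p] assms(2) by auto
      then show "p \<in> fst ` ?O" using p by force
    qed
    show "fst ` ?O \<subseteq> {1..q} - snd ` M" using nc_matchingD(1)[OF M] nc_matchingD(5)[OF M] by fastforce
  qed
  moreover have "inj_on fst ?O" using nc_matchingD(3)[OF M] by (auto simp: inj_on_def)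
  ultimately have O: "card ({1..q} - snd ` M) = card ?O" by (simp add: card_image)
  have "?O = ?C \<union> ?H" using nc_matchingD(1)[OF M] by fastforce
  then have "card ?O = card ?C + card ?H" using finCO by (simp add: card_Un_disjoint disjoint_iff split: prod.splits)
  moreover have "card {1..q} = card ({1..q} \<inter> snd ` M) + card ({1..q} - snd ` M)"
    by (metis card_Int_Diff finite_atLeastAtMost)
  ultimately show ?thesis using C O by (simp add: Int_commute)
qed

subsection \<open>The matching of a diagram\<close>

definition matching :: "nat \<Rightarrow> pseudodiagram \<Rightarrow> (nat \<times> nat) set" where
  "matching m D = {(pos m D a, pos m D b) | a b. {a, b} \<in> arcs D \<and> pos m D a < pos m D b}"

lemma ex_point_at:
  assumes "p \<in> {1..2 * m + easts D + wests D}"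
  obtains a where "a \<in> points m D" "pos m D a = p"
proof -
  have "\<exists>a\<in>points m D. pos m D a = p"
  proof -
    consider "p \<le> m" | "m < p" "p \<le> m + easts D" | "m + easts D < p" "p \<le> 2 * m + easts D"
      | "2 * m + easts D < p" by linarith
    then show ?thesis
    proof cases
      case 1 then show ?thesis using assms by (intro bexI[of _ "North p"]) auto
    next
      case 2 then show ?thesis using assms by (intro bexI[of _ "East (p - m)"]) auto
    next
      case 3 then show ?thesis using assms by (intro bexI[of _ "South (2 * m + easts D + 1 - p)"]) auto
    next
      case 4 then show ?thesis using assms by (intro bexI[of _ "West (2 * m + easts D + wests D + 1 - p)"]) auto
    qed
  qed
  then show thesis using that by blast
qed

lemma pos_eq_iff: "a \<in> points m D \<Longrightarrow> b \<in> points m D \<Longrightarrow> pos m D a = pos m D b \<longleftrightarrow> a = b"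
  using inj_on_pos[of m D] by (auto simp: inj_on_def)

lemma matching_iff:
  assumes D: "sym_pseudodiagram m D" and "a \<in> points m D" "b \<in> points m D"
  shows "(pos m D a, pos m D b) \<in> matching m D \<longleftrightarrow> {a, b} \<in> arcs D \<and> pos m D a < pos m D b"
proof
  assume "(pos m D a, pos m D b) \<in> matching m D"
  then obtain a' b' where ab: "pos m D a = pos m D a'" "pos m D b = pos m D b'" "{a', b'} \<in> arcs D" "pos m D a' < pos m D b'"
    unfolding matching_def by auto
  then show "{a, b} \<in> arcs D \<and> pos m D a < pos m D b"
    using pos_eq_iff assms(2,3) sym_in_points[OF D ab(3)] by metis
qed (auto simp: matching_def)

lemma matching_obtain:
  assumes D: "sym_pseudodiagram m D" and "(p, q) \<in> matching m D"
  obtains a b where "p = pos m D a" "q = pos m D b" "a \<in> points m D" "b \<in> points m D" "{a, b} \<in> arcs D" "p < q"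
  using assms(2) sym_in_points[OF D] unfolding matching_def by blast

lemma nc_matching_matching:
  assumes D: "sym_pseudodiagram m D"
  shows "nc_matching (2 * m + easts D + wests D) (matching m D)"
  unfolding nc_matching_def
proof (intro conjI allI impI ballI)
  fix p q assume "(p, q) \<in> matching m D"
  then obtain a b where "p = pos m D a" "q = pos m D b" "a \<in> points m D" "b \<in> points m D" "p < q"
    using matching_obtain[OF D] by metis
  then show "1 \<le> p" "p < q" "q \<le> 2 * m + easts D + wests D" using pos_bounds by auto
next
  fix p assume "p \<in> {1..2 * m + easts D + wests D}"
  then obtain a where a: "a \<in> points m D" "pos m D a = p" using ex_point_at by metis
  then obtain b where b: "{a, b} \<in> arcs D" "b \<in> points m D" "a \<noteq> b" using sym_ex[OF D] by metis
  then have "pos m D a \<noteq> pos m D b" using a pos_eq_iff by metis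
  then have "pos m D a < pos m D b \<or> pos m D b < pos m D a" by linarith
  moreover have "{b, a} \<in> arcs D" using b(1) by (simp add: insert_commute)
  ultimately have "(p, pos m D b) \<in> matching m D \<or> (pos m D b, p) \<in> matching m D"
    using matching_iff[OF D a(1) b(2)] matching_iff[OF D b(2) a(1)] a(2) b(1) by auto
  then show "\<exists>q. (p, q) \<in> matching m D \<or> (q, p) \<in> matching m D" by blast
next
  fix p q q' assume *: "(p, q) \<in> matching m D" "(p, q') \<in> matching m D"
  obtain a b where ab: "q = pos m D b" "p = pos m D a" "a \<in> points m D" "{a, b} \<in> arcs D"
    using matching_obtain[OF D *(1)] by metis
  obtain a' b' where ab': "q' = pos m D b'" "p = pos m D a'" "a' \<in> points m D" "{a', b'} \<in> arcs D"
    using matching_obtain[OF D *(2)] by metis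
  have "a' = a" using pos_eq_iff ab ab' by metis
  then have "b = b'" using sym_unique[OF D, of a b b'] ab(4) ab'(4) by simp
  then show "q = q'" using ab ab' by simp
next
  fix p q q' assume *: "(q, p) \<in> matching m D" "(q', p) \<in> matching m D"
  obtain b a where ab: "q = pos m D b" "p = pos m D a" "a \<in> points m D" "{b, a} \<in> arcs D"
    using matching_obtain[OF D *(1)] by metis
  obtain b' a' where ab': "q' = pos m D b'" "p = pos m D a'" "a' \<in> points m D" "{b', a'} \<in> arcs D"
    using matching_obtain[OF D *(2)] by metis
  have "a' = a" using pos_eq_iff ab ab' by metis
  then have "b = b'" using sym_unique[OF D, of a b b'] ab(4) ab'(4) by (simp add: insert_commute)
  then show "q = q'" using ab ab' by simp
next
  fix p q q' assume *: "(p, q) \<in> matching m D"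
  show "(q', p) \<notin> matching m D"
  proof
    assume **: "(q', p) \<in> matching m D"
    obtain a b where ab: "p = pos m D a" "q = pos m D b" "a \<in> points m D" "{a, b} \<in> arcs D" "p < q"
      using matching_obtain[OF D *] by metis
    obtain a' c where ac: "q' = pos m D c" "p = pos m D a'" "a' \<in> points m D" "{c, a'} \<in> arcs D" "q' < p"
      using matching_obtain[OF D **] by metis
    have "a' = a" using pos_eq_iff ab ac by metis
    then have "b = c" using sym_unique[OF D ab(4)] ac(4) by (metis insert_commute)
    then show False using ab ac by simp
  qed
next
  fix p q r s assume *: "(p, q) \<in> matching m D" "(r, s) \<in> matching m D"
  obtain a b where ab: "p = pos m D a" "q = pos m D b" "{a, b} \<in> arcs D"
    using matching_obtain[OF D *(1)] by metis
  obtain c d where cd: "r = pos m D c" "s = pos m D d" "{c, d} \<in> arcs D"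
    using matching_obtain[OF D *(2)] by metis
  have "\<not> crossing m D {a, b} {c, d}" using D ab(3) cd(3) unfolding sym_pseudodiagram_def by blast
  then show "\<not> (p < r \<and> r < q \<and> q < s)" unfolding crossing_def ab cd by blast
qed

lemma pos_cong: "wests D = wests D' \<Longrightarrow> easts D = easts D' \<Longrightarrow> pos m D a = pos m D' a"
  by (cases a) auto

lemma points_cong: "wests D = wests D' \<Longrightarrow> easts D = easts D' \<Longrightarrow> points m D = points m D'"
  by (simp add: points_def)

text \<open>A noncrossing matching is determined by its closing points: this is
  \<open>nc_matching_local\<close> with the whole range of positions as the common segment.\<close>

lemma diagram_eqI:
  assumes D: "sym_pseudodiagram m D" "sym_pseudodiagram m D'"
    and we: "wests D = wests D'" "easts D = easts D'" "loop_pairs D = loop_pairs D'"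
    and closers: "snd ` matching m D = snd ` matching m D'"
  shows "D = D'"
proof -
  have sub: "arcs E \<subseteq> arcs E'"
    if E: "sym_pseudodiagram m E" "sym_pseudodiagram m E'" and we: "wests E = wests E'" "easts E = easts E'"
    and cl: "snd ` matching m E = snd ` matching m E'" for E E'
  proof
    fix c assume c: "c \<in> arcs E"
    then obtain x y where "c = {x, y}" "x \<noteq> y" "x \<in> points m E" "y \<in> points m E" using sym_arc[OF E(1)] by metis
    then obtain a b where ab: "c = {a, b}" "a \<in> points m E" "b \<in> points m E" "pos m E a < pos m E b"
      using pos_eq_iff by (metis insert_commute linorder_neqE_nat)
    let ?n = "2 * m + easts E + wests E"
    have "(pos m E a, pos m E b) \<in> matching m E" using matching_iff[OF E(1)] ab c by auto
    moreover have eq: "1 + (pos m E a - 1) = pos m E a" "1 + (pos m E b - 1) = pos m E b"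
      using pos_bounds(1)[OF ab(2)] pos_bounds(1)[OF ab(3)] by simp_all
    ultimately have "(1 + (pos m E a - 1), 1 + (pos m E b - 1)) \<in> matching m E" by simp
    moreover have "1 + (?n - 1) = ?n" "pos m E b - 1 \<le> ?n - 1" using pos_bounds[OF ab(3)] by auto
    ultimately have "(1 + (pos m E a - 1), 1 + (pos m E b - 1)) \<in> matching m E'"
      using nc_matching_local[OF nc_matching_matching[OF E(1)] nc_matching_matching[OF E(2)], of 1 "?n - 1" 1] we cl
      by auto
    then have "(pos m E' a, pos m E' b) \<in> matching m E'" unfolding eq using pos_cong[OF we] by simp
    then show "c \<in> arcs E'" using matching_iff[OF E(2)] ab points_cong[OF we] by auto
  qed
  have "arcs D = arcs D'" using sub[OF D we(1,2) closers] sub[OF D(2,1)] we closers by auto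
  then show ?thesis using we by (cases D; cases D') auto
qed

lemma ex_diagram:
  assumes M: "nc_matching (2 * m + e + w) M"
  obtains D where "sym_pseudodiagram m D" "wests D = w" "easts D = e" "loop_pairs D = 0" "matching m D = M"
proof -
  \<comment> \<open>Positions and boundary points depend only on the numbers of crossing points, so
    an arcless \<open>E\<close> supplies them before the arcs can be defined.\<close>
  define E where "E = Pseudodiagram w e {} 0"
  have E: "wests E = w" "easts E = e" by (simp_all add: E_def)
  define D where "D = Pseudodiagram w e {{a, b} | a b. a \<in> points m E \<and> b \<in> points m E \<and> (pos m E a, pos m E b) \<in> M} 0"
  have we: "wests D = w" "easts D = e" "loop_pairs D = 0" by (simp_all add: D_def)
  have pos: "pos m E a = pos m D a" for a by (rule pos_cong) (simp_all add: we E)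
  have points: "points m E = points m D" by (rule points_cong) (simp_all add: we E)
  have arcs: "arcs D = {{a, b} | a b. a \<in> points m D \<and> b \<in> points m D \<and> (pos m D a, pos m D b) \<in> M}"
    unfolding pos[symmetric] points[symmetric] by (simp only: D_def pseudodiagram.sel)
  have arc: "{a, b} \<in> arcs D \<longleftrightarrow> a \<in> points m D \<and> b \<in> points m D \<and> ((pos m D a, pos m D b) \<in> M \<or> (pos m D b, pos m D a) \<in> M)"
    for a b unfolding arcs by (auto simp: doubleton_eq_iff)
  note MD = nc_matchingD[OF M]
  have sym: "sym_pseudodiagram m D"
  proof (rule sym_pseudodiagramI)
    fix c assume "c \<in> arcs D"
    then obtain a b where "c = {a, b}" "a \<in> points m D" "b \<in> points m D" "(pos m D a, pos m D b) \<in> M"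
      unfolding arcs by blast
    then show "\<exists>a b. c = {a, b} \<and> a \<noteq> b \<and> a \<in> points m D \<and> b \<in> points m D"
      using MD(1) by (metis less_irrefl)
  next
    fix a assume a: "a \<in> points m D"
    then have "pos m D a \<in> {1..2 * m + e + w}" using pos_bounds[OF a] we by auto
    then obtain q where q: "(pos m D a, q) \<in> M \<or> (q, pos m D a) \<in> M" using MD(2) by blast
    then have "q \<in> {1..2 * m + easts D + wests D}" using MD(1) we by fastforce
    then obtain b where "b \<in> points m D" "pos m D b = q" using ex_point_at by metis
    then show "\<exists>b. {a, b} \<in> arcs D" using q a arc by blast
  next
    fix a b b' assume "{a, b} \<in> arcs D" "{a, b'} \<in> arcs D"
    then have "b \<in> points m D" "b' \<in> points m D" "pos m D b = pos m D b'" unfolding arc using MD(3-5) by blast+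
    then show "b = b'" using pos_eq_iff by metis
  next
    fix a b c d assume "{a, c} \<in> arcs D" "{b, d} \<in> arcs D" and lt: "pos m D a < pos m D b"
      "pos m D b < pos m D c" "pos m D c < pos m D d"
    then have "(pos m D a, pos m D c) \<in> M" "(pos m D b, pos m D d) \<in> M"
      unfolding arc using MD(1)[of "pos m D c" "pos m D a"] MD(1)[of "pos m D d" "pos m D b"] by auto
    then show False using MD(6) lt by blast
  qed
  have "matching m D = M"
  proof
    show "matching m D \<subseteq> M"
      unfolding matching_def arc using MD(1) by fastforce
    show "M \<subseteq> matching m D"
    proof
      fix c assume "c \<in> M"
      then obtain p q where c: "c = (p, q)" "(p, q) \<in> M" by (cases c) auto
      then have "p \<in> {1..2 * m + easts D + wests D}" "q \<in> {1..2 * m + easts D + wests D}" "p < q" using MD(1)[of p q] we by auto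
      then show "c \<in> matching m D" using ex_point_at c arc unfolding matching_def
        by (smt (verit, best) mem_Collect_eq)
    qed
  qed
  then show thesis using that sym we by blast
qed

subsection \<open>Diagrams with propagating lines\<close>

lemma sym_not_crossing:
  assumes "sym_pseudodiagram m D" "{a, c} \<in> arcs D" "{b, d} \<in> arcs D"
    "pos m D a < pos m D b" "pos m D b < pos m D c" "pos m D c < pos m D d"
  shows False
proof -
  have "\<not> crossing m D {a, c} {b, d}" using assms(1-3) unfolding sym_pseudodiagram_def by blast
  then show False using assms(4-6) unfolding crossing_def by blast
qed

section \<open>Numbers of lines between two sides of the rectangle\<close>

definition lines :: "pseudodiagram \<Rightarrow> (nat \<Rightarrow> bpoint) \<Rightarrow> (nat \<Rightarrow> bpoint) \<Rightarrow> nat" where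
  "lines D f g = card {i. \<exists>j. {f i, g j} \<in> arcs D}"

lemma lines_commute:
  assumes D: "sym_pseudodiagram m D" and inj: "inj f" "inj g"
  shows "lines D f g = lines D g f"
  unfolding lines_def
proof (rule bij_betw_same_card)
  let ?h = "\<lambda>i. THE j. {f i, g j} \<in> arcs D"
  have h: "?h i = j" if "{f i, g j} \<in> arcs D" for i j
  proof (rule the_equality)
    fix j' assume "{f i, g j'} \<in> arcs D"
    then have "g j' = g j" using sym_unique[OF D] that by blast
    then show "j' = j" using inj(2) by (simp add: inj_eq)
  qed (rule that)
  show "bij_betw ?h {i. \<exists>j. {f i, g j} \<in> arcs D} {j. \<exists>i. {g j, f i} \<in> arcs D}"
  proof (rule bij_betwI')
    fix i i' assume "i \<in> {i. \<exists>j. {f i, g j} \<in> arcs D}" "i' \<in> {i. \<exists>j. {f i, g j} \<in> arcs D}"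
    then obtain j j' where "{f i, g j} \<in> arcs D" "{f i', g j'} \<in> arcs D" by blast
    moreover have "i = i'" if "j = j'"
    proof -
      have "{g j, f i} \<in> arcs D" "{g j, f i'} \<in> arcs D"
        using calculation that by (simp_all add: insert_commute)
      then show ?thesis using sym_unique[OF D] inj(1) by (metis injD)
    qed
    ultimately show "(?h i = ?h i') = (i = i')" using h by auto
  next
    fix i assume "i \<in> {i. \<exists>j. {f i, g j} \<in> arcs D}"
    then obtain j where "{f i, g j} \<in> arcs D" by blast
    then show "?h i \<in> {j. \<exists>i. {g j, f i} \<in> arcs D}" using h by (auto simp: insert_commute)
  next
    fix j assume "j \<in> {j. \<exists>i. {g j, f i} \<in> arcs D}"
    then obtain i where "{f i, g j} \<in> arcs D" by (auto simp: insert_commute)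
    then show "\<exists>i\<in>{i. \<exists>j. {f i, g j} \<in> arcs D}. j = ?h i" using h by blast
  qed
qed

lemma up_iff:
  assumes D: "sym_pseudodiagram m D" and i: "i \<in> {1..m}"
  shows "up D i = West 0 \<longleftrightarrow> (\<exists>j. {North i, West j} \<in> arcs D)"
    "up D i = East 0 \<longleftrightarrow> (\<exists>j. {North i, East j} \<in> arcs D)"
    "up D i = South 0 \<longleftrightarrow> (\<exists>j. {North i, South j} \<in> arcs D)"
    "up D i = North j \<longleftrightarrow> {North i, North j} \<in> arcs D"
proof -
  obtain b where b: "{North i, b} \<in> arcs D" "partner D (North i) = b"
    using partner_arc[OF D, of "North i"] i by auto
  have eq: "{North i, c} \<in> arcs D \<longleftrightarrow> b = c" for c using b(1) sym_unique[OF D] by blast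
  show "up D i = West 0 \<longleftrightarrow> (\<exists>j. {North i, West j} \<in> arcs D)"
    "up D i = East 0 \<longleftrightarrow> (\<exists>j. {North i, East j} \<in> arcs D)"
    "up D i = South 0 \<longleftrightarrow> (\<exists>j. {North i, South j} \<in> arcs D)"
    "up D i = North j \<longleftrightarrow> {North i, North j} \<in> arcs D"
    unfolding up_def b(2) eq by (cases b; auto)+
qed

lemma low_iff:
  assumes D: "sym_pseudodiagram m D" and i: "i \<in> {1..m}"
  shows "low D i = West 0 \<longleftrightarrow> (\<exists>j. {South i, West j} \<in> arcs D)"
    "low D i = East 0 \<longleftrightarrow> (\<exists>j. {South i, East j} \<in> arcs D)"
    "low D i = North 0 \<longleftrightarrow> (\<exists>j. {South i, North j} \<in> arcs D)"
    "low D i = South j \<longleftrightarrow> {South i, South j} \<in> arcs D"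
proof -
  obtain b where b: "{South i, b} \<in> arcs D" "partner D (South i) = b"
    using partner_arc[OF D, of "South i"] i by auto
  have eq: "{South i, c} \<in> arcs D \<longleftrightarrow> b = c" for c using b(1) sym_unique[OF D] by blast
  show "low D i = West 0 \<longleftrightarrow> (\<exists>j. {South i, West j} \<in> arcs D)"
    "low D i = East 0 \<longleftrightarrow> (\<exists>j. {South i, East j} \<in> arcs D)"
    "low D i = North 0 \<longleftrightarrow> (\<exists>j. {South i, North j} \<in> arcs D)"
    "low D i = South j \<longleftrightarrow> {South i, South j} \<in> arcs D"
    unfolding low_def b(2) eq by (cases b; auto)+
qed

lemma vertex_in_range:
  assumes D: "sym_pseudodiagram m D"
  shows "{North i, b} \<in> arcs D \<Longrightarrow> i \<in> {1..m}" "{South i, b} \<in> arcs D \<Longrightarrow> i \<in> {1..m}"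
    "{West i, b} \<in> arcs D \<Longrightarrow> i \<in> {1..wests D}" "{East i, b} \<in> arcs D \<Longrightarrow> i \<in> {1..easts D}"
  using sym_in_points(1)[OF D] in_points_iff by blast+

lemma vertex_in_range':
  assumes D: "sym_pseudodiagram m D"
  shows "{b, North i} \<in> arcs D \<Longrightarrow> i \<in> {1..m}" "{b, South i} \<in> arcs D \<Longrightarrow> i \<in> {1..m}"
    "{b, West i} \<in> arcs D \<Longrightarrow> i \<in> {1..wests D}" "{b, East i} \<in> arcs D \<Longrightarrow> i \<in> {1..easts D}"
  using sym_in_points(2)[OF D] in_points_iff by blast+

lemma lines_half:
  assumes D: "sym_pseudodiagram m D"
  shows "lines D North West = card {i \<in> {1..m}. up D i = West 0}"
    "lines D North East = card {i \<in> {1..m}. up D i = East 0}"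
    "lines D North South = card {i \<in> {1..m}. up D i = South 0}"
    "lines D South West = card {i \<in> {1..m}. low D i = West 0}"
    "lines D South East = card {i \<in> {1..m}. low D i = East 0}"
    "lines D South North = card {i \<in> {1..m}. low D i = North 0}"
proof -
  have "(\<exists>j. {North i, West j} \<in> arcs D) \<longleftrightarrow> i \<in> {1..m} \<and> up D i = West 0" for i
    using up_iff(1)[OF D] vertex_in_range(1)[OF D] by blast
  then show "lines D North West = card {i \<in> {1..m}. up D i = West 0}" unfolding lines_def by simp
  have "(\<exists>j. {North i, East j} \<in> arcs D) \<longleftrightarrow> i \<in> {1..m} \<and> up D i = East 0" for i
    using up_iff(2)[OF D] vertex_in_range(1)[OF D] by blast
  then show "lines D North East = card {i \<in> {1..m}. up D i = East 0}" unfolding lines_def by simp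
  have "(\<exists>j. {North i, South j} \<in> arcs D) \<longleftrightarrow> i \<in> {1..m} \<and> up D i = South 0" for i
    using up_iff(3)[OF D] vertex_in_range(1)[OF D] by blast
  then show "lines D North South = card {i \<in> {1..m}. up D i = South 0}" unfolding lines_def by simp
  have "(\<exists>j. {South i, West j} \<in> arcs D) \<longleftrightarrow> i \<in> {1..m} \<and> low D i = West 0" for i
    using low_iff(1)[OF D] vertex_in_range(2)[OF D] by blast
  then show "lines D South West = card {i \<in> {1..m}. low D i = West 0}" unfolding lines_def by simp
  have "(\<exists>j. {South i, East j} \<in> arcs D) \<longleftrightarrow> i \<in> {1..m} \<and> low D i = East 0" for i
    using low_iff(2)[OF D] vertex_in_range(2)[OF D] by blast
  then show "lines D South East = card {i \<in> {1..m}. low D i = East 0}" unfolding lines_def by simp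
  have "(\<exists>j. {South i, North j} \<in> arcs D) \<longleftrightarrow> i \<in> {1..m} \<and> low D i = North 0" for i
    using low_iff(3)[OF D] vertex_in_range(2)[OF D] by blast
  then show "lines D South North = card {i \<in> {1..m}. low D i = North 0}" unfolding lines_def by simp
qed

lemma num_prop_lines:
  assumes D: "sym_pseudodiagram m D"
  shows "num_prop D = lines D South North" "num_prop D = lines D North South"
  using num_prop_low[OF D] lines_half(6)[OF D] lines_commute[OF D, of South North] by (auto simp: inj_def)

lemma initial_segment:
  fixes A :: "nat set"
  assumes "A \<subseteq> {1..n}" and down: "\<And>i j. j \<in> A \<Longrightarrow> 1 \<le> i \<Longrightarrow> i < j \<Longrightarrow> i \<in> A"
  shows "A = {1..card A}"
proof (cases "A = {}")
  case False
  have fin: "finite A" using assms(1) finite_subset by auto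
  have "A = {1..Max A}"
  proof
    show "A \<subseteq> {1..Max A}" using assms(1) fin by auto
    show "{1..Max A} \<subseteq> A" using down[OF Max_in[OF fin False]] Max_in[OF fin False] by (auto simp: le_less)
  qed
  then show ?thesis by (metis card_atLeastAtMost diff_Suc_1)
qed simp

text \<open>A propagating line separates the two reflection lines, so no arc joins them. As a basis
  diagram has no contractible loops either, every crossing point belongs to a line from a vertex,
  and counting lines at the vertices determines both sides.\<close>

locale propagating_diagram =
  fixes m d
  assumes Bphi: "d \<in> Bphi m" and has_prop: "num_prop d > 0"
begin

lemmas sym = BphiD(1)[OF Bphi]

lemma ex_propagating: "\<exists>i j. {North i, South j} \<in> arcs d"
  using has_prop num_prop_lines(2)[OF sym] by (auto simp: lines_def card_gt_0_iff)

lemma no_side_arcs: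
  "{West i, West j} \<notin> arcs d" "{East i, East j} \<notin> arcs d" "{West i, East j} \<notin> arcs d" "{East i, West j} \<notin> arcs d"
proof -
  show "{West i, West j} \<notin> arcs d" "{East i, East j} \<notin> arcs d" using BphiD[OF Bphi] by blast+
  show WE: "{West i, East j} \<notin> arcs d" for i j
  proof
    assume a: "{West i, East j} \<in> arcs d"
    obtain p q where pq: "{North p, South q} \<in> arcs d" using ex_propagating by blast
    have "p \<in> {1..m}" "q \<in> {1..m}" "i \<in> {1..wests d}" "j \<in> {1..easts d}"
      using vertex_in_range[OF sym] pq a by (metis insert_commute)+
    moreover have "{East j, West i} \<in> arcs d" using a by (simp add: insert_commute)
    ultimately show False by (intro sym_not_crossing[OF sym pq]) auto
  qed
  then show "{East i, West j} \<notin> arcs d" using WE by (metis insert_commute)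
qed

lemma West_cases:
  assumes "j \<in> {1..wests d}"
  shows "(\<exists>i. {North i, West j} \<in> arcs d) \<noteq> (\<exists>i. {South i, West j} \<in> arcs d)"
proof -
  obtain b where b: "{West j, b} \<in> arcs d" using sym_ex[OF sym, of "West j"] assms by auto
  have "{c, West j} \<in> arcs d \<longleftrightarrow> b = c" for c using b sym_unique[OF sym] by (metis insert_commute)
  then show ?thesis using b no_side_arcs by (cases b) auto
qed

lemma East_cases:
  assumes "j \<in> {1..easts d}"
  shows "(\<exists>i. {North i, East j} \<in> arcs d) \<noteq> (\<exists>i. {South i, East j} \<in> arcs d)"
proof -
  obtain b where b: "{East j, b} \<in> arcs d" using sym_ex[OF sym, of "East j"] assms by auto
  have "{c, East j} \<in> arcs d \<longleftrightarrow> b = c" for c using b sym_unique[OF sym] by (metis insert_commute)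
  then show ?thesis using b no_side_arcs by (cases b) auto
qed

text \<open>A northern line ending below a southern one would cross it. So the crossing points of
  the northern lines come first, counted from the north.\<close>

lemma North_West_iff:
  "(\<exists>i. {North i, West j} \<in> arcs d) \<longleftrightarrow> 1 \<le> j \<and> j \<le> lines d North West"
proof -
  let ?A = "{j. \<exists>i. {North i, West j} \<in> arcs d}"
  have A: "?A = {1..card ?A}"
  proof (rule initial_segment)
    show "?A \<subseteq> {1..wests d}" using vertex_in_range'(3)[OF sym] by blast
    fix j j' assume "j' \<in> ?A" and j: "1 \<le> j" "j < j'"
    then obtain i where i: "{North i, West j'} \<in> arcs d" by blast
    have j': "j' \<in> {1..wests d}" "i \<in> {1..m}" using vertex_in_range[OF sym] i by (metis insert_commute)+
    show "j \<in> ?A"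
    proof (rule ccontr)
      assume "j \<notin> ?A"
      then obtain i' where i': "{South i', West j} \<in> arcs d" using West_cases[of j] j j' by auto
      have "i' \<in> {1..m}" using vertex_in_range[OF sym] i' by metis
      then show False using j j' by (intro sym_not_crossing[OF sym i i']) auto
    qed
  qed
  have card: "card ?A = lines d North West"
    using lines_commute[OF sym, of West North] by (auto simp: inj_def lines_def insert_commute)
  have "j \<in> ?A \<longleftrightarrow> j \<in> {1..lines d North West}" using A[unfolded card] by blast
  then show ?thesis by simp
qed

lemma North_East_iff:
  "(\<exists>i. {North i, East j} \<in> arcs d) \<longleftrightarrow> 1 \<le> j \<and> j \<le> lines d North East"
proof -
  let ?A = "{j. \<exists>i. {North i, East j} \<in> arcs d}"
  have A: "?A = {1..card ?A}"
  proof (rule initial_segment)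
    show "?A \<subseteq> {1..easts d}" using vertex_in_range'(4)[OF sym] by blast
    fix j j' assume "j' \<in> ?A" and j: "1 \<le> j" "j < j'"
    then obtain i where i: "{North i, East j'} \<in> arcs d" by blast
    have j': "j' \<in> {1..easts d}" "i \<in> {1..m}" using vertex_in_range[OF sym] i by (metis insert_commute)+
    show "j \<in> ?A"
    proof (rule ccontr)
      assume "j \<notin> ?A"
      then obtain i' where i': "{South i', East j} \<in> arcs d" using East_cases[of j] j j' by auto
      have "i' \<in> {1..m}" using vertex_in_range[OF sym] i' by metis
      moreover have "{East j, South i'} \<in> arcs d" using i' by (simp add: insert_commute)
      ultimately show False using j j' by (intro sym_not_crossing[OF sym i]) auto
    qed
  qed
  have card: "card ?A = lines d North East"
    using lines_commute[OF sym, of East North] by (auto simp: inj_def lines_def insert_commute)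
  have "j \<in> ?A \<longleftrightarrow> j \<in> {1..lines d North East}" using A[unfolded card] by blast
  then show ?thesis by simp
qed

lemma wests_eq: "wests d = lines d North West + lines d South West"
proof -
  define A where "A = {j. \<exists>i. {North i, West j} \<in> arcs d}"
  define B where "B = {j. \<exists>i. {South i, West j} \<in> arcs d}"
  have sub: "A \<subseteq> {1..wests d}" "B \<subseteq> {1..wests d}"
    unfolding A_def B_def using vertex_in_range'(3)[OF sym] by blast+
  have "{1..wests d} = A \<union> B" "A \<inter> B = {}"
    using sub West_cases unfolding A_def B_def by blast+
  moreover have "finite A" "finite B" using sub finite_subset by blast+
  ultimately have "wests d = card A + card B"
    using card_Un_disjoint[of A B] by (metis card_atLeastAtMost diff_Suc_1)
  then show ?thesis
    using lines_commute[OF sym, of West North] lines_commute[OF sym, of West South]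
    by (auto simp: inj_def lines_def A_def B_def insert_commute)
qed

lemma easts_eq: "easts d = lines d North East + lines d South East"
proof -
  define A where "A = {j. \<exists>i. {North i, East j} \<in> arcs d}"
  define B where "B = {j. \<exists>i. {South i, East j} \<in> arcs d}"
  have sub: "A \<subseteq> {1..easts d}" "B \<subseteq> {1..easts d}"
    unfolding A_def B_def using vertex_in_range'(4)[OF sym] by blast+
  have "{1..easts d} = A \<union> B" "A \<inter> B = {}"
    using sub East_cases unfolding A_def B_def by blast+
  moreover have "finite A" "finite B" using sub finite_subset by blast+
  ultimately have "easts d = card A + card B"
    using card_Un_disjoint[of A B] by (metis card_atLeastAtMost diff_Suc_1)
  then show ?thesis
    using lines_commute[OF sym, of East North] lines_commute[OF sym, of East South]
    by (auto simp: inj_def lines_def A_def B_def insert_commute)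
qed

lemma South_West_iff:
  "(\<exists>i. {South i, West j} \<in> arcs d) \<longleftrightarrow> lines d North West < j \<and> j \<le> wests d"
proof -
  have "1 \<le> j \<and> j \<le> wests d" if "{South i, West j} \<in> arcs d" for i
    using vertex_in_range(3)[OF sym, of j "South i"] that by (simp add: insert_commute)
  then show ?thesis using West_cases[of j] North_West_iff[of j] by auto
qed

lemma South_East_iff:
  "(\<exists>i. {South i, East j} \<in> arcs d) \<longleftrightarrow> lines d North East < j \<and> j \<le> easts d"
proof -
  have "1 \<le> j \<and> j \<le> easts d" if "{South i, East j} \<in> arcs d" for i
    using vertex_in_range(4)[OF sym, of j "South i"] that by (simp add: insert_commute)
  then show ?thesis using East_cases[of j] North_East_iff[of j] by auto
qed

text \<open>The arcs pair up all \<open>2 * m + easts d + wests d\<close> boundary points, and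
  \<open>easts d\<close> is even as the south-west corner is white.\<close>

lemma even_wests: "even (wests d)"
proof -
  have "\<And>c. c \<in> arcs d \<Longrightarrow> card c = 2" "disjoint (arcs d)"
    using sym unfolding sym_pseudodiagram_def partition_on_def by auto
  then have "2 * card (arcs d) = card (points m d)"
    using card_partition[of "arcs d" 2] finite_arcs[OF sym] finite_points Union_arcs[OF sym]
    by (metis disjointD)
  moreover have "card (points m d) = 2 * m + easts d + wests d"
  proof -
    have "pos m d ` points m d = {1..2 * m + easts d + wests d}"
      using pos_bounds ex_point_at by (auto simp: image_iff) metis+
    then show ?thesis using card_image[OF inj_on_pos[of m d]] by simp
  qed
  ultimately show ?thesis using BphiD(2)[OF Bphi] by presburger
qed

section \<open>The inner region\<close>

lemma enclosed_iff:
  assumes "pos m d a < pos m d b"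
  shows "enclosed m d {a, b} g \<longleftrightarrow> pos m d a \<le> g \<and> g < pos m d b"
  using assms unfolding enclosed_def by auto

text \<open>The region west of the closest propagating line touches the 0-reflection line exactly
  between the northern and the southern half lines ending there. Walking clockwise from the
  south-west corner, one passes all southern half lines before reaching it.\<close>

lemma inner_gap_iff: "inner_gap m d g \<longleftrightarrow> g = 2 * m + easts d + lines d South West"
proof -
  define p where "p = closest_prop d"
  define g0 where "g0 = 2 * m + easts d + lines d South West"
  have prop_iff: "North i \<in> \<Union>(propagating d) \<longleftrightarrow> (\<exists>j. {North i, South j} \<in> arcs d)" for i
    by (auto simp: propagating_def)
  have "\<exists>i. North i \<in> \<Union>(propagating d)" using ex_propagating prop_iff by blast
  then have "North p \<in> \<Union>(propagating d)" unfolding p_def closest_prop_def by (rule LeastI_ex)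
  then obtain q where pq: "{North p, South q} \<in> arcs d" using prop_iff by blast
  have least: "p \<le> i" if "{North i, South j} \<in> arcs d" for i j
    unfolding p_def closest_prop_def using that prop_iff by (intro Least_le) blast
  have bds: "p \<in> {1..m}" "q \<in> {1..m}" using vertex_in_range[OF sym] pq by (metis insert_commute)+
  note cross = sym_not_crossing[OF sym]
  have only: "b = South q" if "{North p, b} \<in> arcs d" for b using sym_unique[OF sym pq] that by metis
  have NN: "\<not> (i < p \<and> p \<le> j)" if "{North i, North j} \<in> arcs d" for i j
  proof
    assume ij: "i < p \<and> p \<le> j"
    have "j \<noteq> p" using only[of "North i"] that by (auto simp: insert_commute)
    then have "p < j" using ij by auto
    moreover have "j \<in> {1..m}" using vertex_in_range(1)[OF sym, of j "North i"] that by (simp add: insert_commute)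
    ultimately show False using ij bds by (intro cross[OF that pq]) auto
  qed
  have NW: "i < p" if a: "{North i, West j} \<in> arcs d" for i j
  proof (rule ccontr)
    assume "\<not> i < p"
    moreover have "i \<noteq> p" using only[of "West j"] a by auto
    moreover have "i \<in> {1..m}" "j \<in> {1..wests d}" using vertex_in_range[OF sym] a by (metis insert_commute)+
    ultimately show False using bds by (intro cross[OF pq a]) auto
  qed
  have NE: "p < i" if a: "{North i, East j} \<in> arcs d" for i j
  proof (rule ccontr)
    assume "\<not> p < i"
    moreover have "i \<noteq> p" using only[of "East j"] a by auto
    moreover have "i \<in> {1..m}" "j \<in> {1..easts d}" using vertex_in_range[OF sym] a by (metis insert_commute)+
    ultimately show False using bds by (intro cross[OF a pq]) auto
  qed
  \<comment> \<open>The gap \<open>p - 1\<close> is the one directly west of the closest propagating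
    line. Northern lines to the west enclose both gaps, and every other arc encloses
    neither.\<close>
  have same: "enclosed m d c g0 \<longleftrightarrow> enclosed m d c (p - 1)" if c: "c \<in> arcs d" for c
  proof -
    have range: "i \<in> {1..m}" if "c = {North i, b} \<or> c = {South i, b}" for i b
      using vertex_in_range[OF sym] that c by metis
    have rangeW: "i \<in> {1..wests d}" if "c = {b, West i}" for i b
      using vertex_in_range[OF sym] that c by (metis insert_commute)
    have rangeE: "i \<in> {1..easts d}" if "c = {b, East i}" for i b
      using vertex_in_range[OF sym] that c by (metis insert_commute)
    obtain x y where xy: "c = {x, y}" using sym_arc[OF sym c] by metis
    have "\<not> (\<exists>i j. c = {West i, West j} \<or> c = {East i, East j} \<or> c = {West i, East j})"
      using no_side_arcs c by blast
    then have "(\<exists>i j. c = {North i, North j} \<or> c = {North i, West j} \<or> c = {North i, South j}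
      \<or> c = {North i, East j} \<or> c = {South i, South j} \<or> c = {South i, West j} \<or> c = {South i, East j})"
      unfolding xy by (cases x; cases y) (auto simp: doubleton_eq_iff)
    then show ?thesis
    proof (elim exE disjE)
      fix i j assume e: "c = {North i, North j}"
      show ?thesis
    proof -
      have *: ?thesis if "c = {North i, North j}" "i < j" for i j
      proof -
        have "{North i, North j} \<in> arcs d" using that(1) c by simp
        then have "\<not> (i < p \<and> p \<le> j)" "j \<in> {1..m}" using NN vertex_in_range'(1)[OF sym] by metis+
        moreover have "enclosed m d c g \<longleftrightarrow> i \<le> g \<and> g < j" for g
          unfolding that(1) using enclosed_iff[of "North i" "North j"] that(2) by simp
        ultimately show ?thesis using bds by (simp add: g0_def; linarith)
      qed
      have "i \<noteq> j" using sym_in_points(3)[OF sym] c e by blast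
      then show ?thesis using *[of i j] *[of j i] e by (metis insert_commute linorder_neqE_nat)
    qed
    next
      fix i j assume e: "c = {North i, West j}"
      show ?thesis
    proof -
      have "j \<le> lines d North West" using North_West_iff[of j] c e by blast
      moreover have "i < p" using NW c e by blast
      ultimately show ?thesis
        using range[of i "West j"] rangeW[of "North i" j] e bds enclosed_iff[of "North i" "West j"] wests_eq
        by (auto simp: g0_def)
    qed
    next
      fix i j assume e: "c = {North i, South j}"
      show ?thesis
    proof -
      have "{North i, South j} \<in> arcs d" using e c by simp
      then have "p \<le> i" "i \<in> {1..m}" "j \<in> {1..m}"
        using least vertex_in_range(1)[OF sym] vertex_in_range'(2)[OF sym] by metis+
      then show ?thesis using e bds enclosed_iff[of "North i" "South j"] by (auto simp: g0_def)
    qed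
    next
      fix i j assume e: "c = {North i, East j}"
      show ?thesis
      using NE[of i j] range[of i "East j"] rangeE[of "North i" j] c e bds enclosed_iff[of "North i" "East j"]
      by (auto simp: g0_def)
    next
      fix i j assume e: "c = {South i, South j}"
      show ?thesis
    proof -
      have *: ?thesis if "c = {South i, South j}" "j < i" for i j
        using range[of i "South j"] vertex_in_range'(2)[OF sym, of "South i" j] c that bds
          enclosed_iff[of "South i" "South j"] by (auto simp: g0_def)
      have "i \<noteq> j" using sym_in_points(3)[OF sym] c e by blast
      then show ?thesis using *[of i j] *[of j i] e by (metis insert_commute linorder_neqE_nat)
    qed
    next
      fix i j assume e: "c = {South i, West j}"
      show ?thesis
    proof -
      have "lines d North West < j" using South_West_iff[of j] c e by blast
      then show ?thesis
        using range[of i "West j"] rangeW[of "South i" j] e bds enclosed_iff[of "South i" "West j"] wests_eq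
        by (auto simp: g0_def)
    qed
    next
      fix i j assume e: "c = {South i, East j}"
      show ?thesis
    proof -
      have e': "c = {East j, South i}" using e by (simp add: insert_commute)
      show ?thesis using range[of i "East j"] rangeE[of "South i" j] e bds enclosed_iff[of "East j" "South i"]
        unfolding e' by (auto simp: g0_def)
    qed
    qed
  qed
  have g0: "inner_gap m d g0"
    unfolding inner_gap_def p_def[symmetric] same_region_def using same wests_eq by (auto simp: g0_def)
  have "g = g0" if ig: "inner_gap m d g"
  proof -
    have g: "2 * m + easts d \<le> g" "g \<le> 2 * m + easts d + wests d" using ig by (auto simp: inner_gap_def)
    \<comment> \<open>Of the two gaps beside \<open>North p\<close>, the gap \<open>p\<close> is cut
      off from the 0-reflection line by the propagating line itself.\<close>
    have "enclosed m d {North p, South q} p" "\<not> enclosed m d {North p, South q} g"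
      using enclosed_iff[of "North p" "South q"] bds g by auto
    then have "\<not> same_region m d g p" using pq by (auto simp: same_region_def)
    then have sr: "same_region m d g (p - 1)" using ig by (auto simp: inner_gap_def p_def)
    \<comment> \<open>Gaps before \<open>g0\<close> are cut off by the topmost southern line to the
      west, gaps after it by the lowest northern one; their western ends have positions
      \<open>g0\<close> and \<open>g0 + 1\<close>.\<close>
    show "g = g0"
    proof (rule linorder_cases[of g g0])
      assume lt: "g < g0"
      then have "lines d South West > 0" using g by (auto simp: g0_def)
      then obtain i where i: "{South i, West (lines d North West + 1)} \<in> arcs d"
        using South_West_iff[of "lines d North West + 1"] wests_eq by auto
      have "i \<in> {1..m}" using vertex_in_range[OF sym] i by metis
      then have "pos m d (South i) \<le> 2 * m + easts d" "p - 1 < pos m d (South i)" using bds by auto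
      from this(1) have "pos m d (South i) < g0" using \<open>lines d South West > 0\<close> unfolding g0_def by linarith
      moreover have "pos m d (West (lines d North West + 1)) = g0" using wests_eq by (simp add: g0_def)
      ultimately have "enclosed m d {South i, West (lines d North West + 1)} h \<longleftrightarrow> pos m d (South i) \<le> h \<and> h < g0" for h
        using enclosed_iff[of "South i" "West (lines d North West + 1)"] by simp
      then have "enclosed m d {South i, West (lines d North West + 1)} g"
        "\<not> enclosed m d {South i, West (lines d North West + 1)} (p - 1)"
        using lt le_trans[OF \<open>pos m d (South i) \<le> 2 * m + easts d\<close> g(1)] \<open>p - 1 < pos m d (South i)\<close>
        by simp_all
      then show ?thesis using sr i by (auto simp: same_region_def)
    next
      assume gt: "g0 < g"
      then have "lines d North West > 0" using g wests_eq by (auto simp: g0_def)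
      then obtain i where i: "{North i, West (lines d North West)} \<in> arcs d"
        using North_West_iff[of "lines d North West"] by auto
      have "i \<in> {1..m}" "i < p" using vertex_in_range[OF sym] i NW by metis+
      moreover have "enclosed m d {North i, West (lines d North West)} h \<longleftrightarrow> i \<le> h \<and> h < g0 + 1" for h
        using enclosed_iff[of "North i" "West (lines d North West)"] \<open>i \<in> {1..m}\<close> wests_eq
        by (simp add: g0_def add.assoc)
      moreover have "i \<le> p - 1" "p - 1 < g0 + 1" "\<not> g < g0 + 1"
        using gt bds \<open>i < p\<close> unfolding g0_def by auto
      ultimately have "\<not> enclosed m d {North i, West (lines d North West)} g"
        "enclosed m d {North i, West (lines d North West)} (p - 1)" by blast+
      then show ?thesis using sr i by (auto simp: same_region_def)
    qed
  qed
  then show ?thesis using g0 unfolding g0_def by blast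
qed

end

text \<open>The south-west corner is white, and on the 0-reflection line the inner gap is
  \<open>lines d South West\<close> crossing points away from it.\<close>

lemma Bphi_idx_iff:
  assumes "l \<noteq> 0"
  shows "d \<in> Bphi_idx m l \<longleftrightarrow> d \<in> Bphi m \<and> int (num_prop d) = \<bar>l\<bar> \<and> (odd (lines d South West) \<longleftrightarrow> l > 0)"
proof (cases "d \<in> Bphi m \<and> int (num_prop d) = \<bar>l\<bar>")
  case True
  then interpret propagating_diagram m d using assms by unfold_locales auto
  have "white (2 * m + easts d + lines d South West) \<longleftrightarrow> even (lines d South West)"
    using BphiD(2)[OF Bphi] by (simp add: white_def)
  then show ?thesis using True assms by (auto simp: Bphi_idx_def inner_gap_iff)
qed (auto simp: Bphi_idx_def)

subsection \<open>Counting\<close>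

text \<open>These are the closing points of partial matchings. In contrast to
  \<open>ex_nc_matching\<close> no balance is required at the end: unmatched points will be the ends
  of lines that leave the northern edge.\<close>

definition ballot :: "nat \<Rightarrow> nat set \<Rightarrow> bool" where
  "ballot m C \<longleftrightarrow> C \<subseteq> {1..m} \<and> (\<forall>p\<le>m. 2 * card (C \<inter> {1..p}) \<le> p)"

lemma ballot_card: "ballot m C \<Longrightarrow> finite C \<and> 2 * card C \<le> m"
  unfolding ballot_def using finite_subset by (metis finite_atLeastAtMost inf.absorb1 order_refl)

lemma ballot_Suc_notin:
  assumes "Suc m \<notin> C" shows "ballot (Suc m) C \<longleftrightarrow> ballot m C"
proof -
  have sub: "C \<subseteq> {1..Suc m} \<longleftrightarrow> C \<subseteq> {1..m}" using assms by (auto simp: le_Suc_eq)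
  have "2 * card (C \<inter> {1..Suc m}) \<le> Suc m" if "C \<subseteq> {1..m}" "2 * card (C \<inter> {1..m}) \<le> m"
  proof -
    have "C \<inter> {1..Suc m} = C \<inter> {1..m}" using that(1) by auto
    then show ?thesis using that(2) by simp
  qed
  then show ?thesis unfolding ballot_def sub by (auto simp: le_Suc_eq)
qed

lemma ballot_Suc_insert:
  assumes "C \<subseteq> {1..m}"
  shows "ballot (Suc m) (insert (Suc m) C) \<longleftrightarrow> ballot m C \<and> 2 * Suc (card C) \<le> Suc m"
proof -
  have "insert (Suc m) C \<inter> {1..p} = C \<inter> {1..p}" if "p \<le> m" for p using that by auto
  moreover have "insert (Suc m) C \<inter> {1..Suc m} = insert (Suc m) C" using assms by auto
  moreover have "card (insert (Suc m) C) = Suc (card C)"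
    using assms finite_subset[OF assms] by (subst card_insert_disjoint) auto
  ultimately show ?thesis using assms unfolding ballot_def by (auto simp: le_Suc_eq)
qed

lemma finite_ballots: "finite {C. ballot m C \<and> Q C}"
  by (rule finite_subset[of _ "Pow {1..m}"]) (auto simp: ballot_def)

text \<open>Pascal's rule, according to whether the last point closes an arc. The bound
  \<open>card C \<le> s\<close>, in place of equality, is what makes the two parts binomial
  coefficients.\<close>

lemma card_ballots: "2 * s \<le> m \<Longrightarrow> card {C. ballot m C \<and> card C \<le> s} = m choose s"
proof (induction m arbitrary: s)
  case 0
  have "{C. ballot 0 C \<and> card C \<le> s} = {{}}" by (auto simp: ballot_def)
  then show ?case using 0 by simp
next
  case (Suc m)
  show ?case
  proof (cases s)
    case 0
    have "ballot (Suc m) {}" by (simp add: ballot_def)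
    moreover have "C = {}" if "ballot (Suc m) C" "card C \<le> s" for C
      using ballot_card[OF that(1)] that(2) 0 by simp
    ultimately have "{C. ballot (Suc m) C \<and> card C \<le> s} = {{}}" using 0 by auto
    then show ?thesis using 0 by simp
  next
    case (Suc r)
    let ?A = "{C. ballot m C \<and> card C \<le> s}" and ?B = "{C. ballot m C \<and> card C \<le> r}"
    have "{C. ballot (Suc m) C \<and> card C \<le> s} = ?A \<union> insert (Suc m) ` ?B"
    proof (rule Set.set_eqI)
      fix C
      show "C \<in> {C. ballot (Suc m) C \<and> card C \<le> s} \<longleftrightarrow> C \<in> ?A \<union> insert (Suc m) ` ?B"
      proof (cases "Suc m \<in> C")
        case False
        then show ?thesis using ballot_Suc_notin by auto
      next
        case True
        have "C \<notin> ?A" using True by (auto simp: ballot_def)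
        moreover have "C \<in> insert (Suc m) ` ?B" if C: "ballot (Suc m) C" "card C \<le> s"
        proof -
          have sub: "C - {Suc m} \<subseteq> {1..m}" using C by (auto simp: ballot_def le_Suc_eq)
          have C': "C = insert (Suc m) (C - {Suc m})" using True by auto
          then have "ballot m (C - {Suc m})" using ballot_Suc_insert[OF sub] C by metis
          moreover have "card (C - {Suc m}) \<le> r" using C ballot_card[OF C(1)] True Suc by simp
          ultimately show ?thesis using C' by blast
        qed
        moreover have "ballot (Suc m) C \<and> card C \<le> s" if CB: "C \<in> insert (Suc m) ` ?B"
        proof -
          obtain C' where C': "C = insert (Suc m) C'" "ballot m C'" "card C' \<le> r" using CB by blast
          then have sub: "C' \<subseteq> {1..m}" by (simp add: ballot_def)
          have "card C = Suc (card C')" unfolding C'(1) using sub finite_subset[OF sub]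
            by (subst card_insert_disjoint) auto
          then show ?thesis using ballot_Suc_insert[OF sub] C' Suc Suc.prems by auto
        qed
        ultimately show ?thesis by blast
      qed
    qed
    moreover have "?A \<inter> insert (Suc m) ` ?B = {}" by (auto simp: ballot_def)
    moreover have "inj_on (insert (Suc m)) ?B"
    proof (rule inj_onI)
      fix C C' assume *: "C \<in> ?B" "C' \<in> ?B" "insert (Suc m) C = insert (Suc m) C'"
      then have "Suc m \<notin> C" "Suc m \<notin> C'" by (auto simp: ballot_def)
      then show "C = C'" using *(3) by (simp add: insert_ident)
    qed
    ultimately have sum: "card {C. ballot (Suc m) C \<and> card C \<le> s} = card ?A + card ?B"
      by (simp add: card_Un_disjoint finite_ballots card_image)
    have B: "card ?B = m choose r" using Suc.IH[of r] Suc.prems Suc by auto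
    have A: "card ?A = m choose s"
    proof (cases "2 * s \<le> m")
      case False
      then have m: "m = 2 * r + 1" using Suc.prems Suc by auto
      have "?A = ?B" using ballot_card Suc m by fastforce
      moreover have "m choose s = m choose r"
        using binomial_symmetric[of s m] m Suc by auto
      ultimately show ?thesis using B by simp
    qed (rule Suc.IH)
    show ?thesis using sum A B Suc by simp
  qed
qed

text \<open>Put \<open>s = card C + (a - par) div 2\<close>. Then \<open>a\<close> is recovered from
  \<open>s\<close> and \<open>C\<close>, the inequality becomes an upper bound for \<open>s\<close>
  alone, and \<open>C\<close> ranges over the ballot sets with at most \<open>s\<close>
  elements.\<close>

lemma card_ballots_parity:
  assumes "x + par \<le> m"
  shows "card {(C, a). ballot m C \<and> 2 * card C + a + x \<le> m \<and> par \<le> a \<and> even (a - par)} =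
    (\<Sum>i = 0..(m - x - par) div 2. m choose i)" (is "card ?T = _")
proof -
  let ?k = "(m - x - par) div 2"
  let ?S = "SIGMA s:{0..?k}. {C. ballot m C \<and> card C \<le> s}"
  have "bij_betw (\<lambda>(s, C). (C, par + 2 * (s - card C))) ?S ?T"
  proof (rule bij_betw_byWitness[where f' = "\<lambda>(C, a). (card C + (a - par) div 2, C)"])
    show "\<forall>p\<in>?S. (\<lambda>(C, a). (card C + (a - par) div 2, C)) ((\<lambda>(s, C). (C, par + 2 * (s - card C))) p) = p" by auto
    show "\<forall>p\<in>?T. (\<lambda>(s, C). (C, par + 2 * (s - card C))) ((\<lambda>(C, a). (card C + (a - par) div 2, C)) p) = p" by auto
    show "(\<lambda>(s, C). (C, par + 2 * (s - card C))) ` ?S \<subseteq> ?T"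
    proof (rule image_subsetI)
      fix q assume "q \<in> ?S"
      then obtain s C where q: "q = (s, C)" "ballot m C" "s \<le> ?k" "card C \<le> s" by auto
      then have "2 * s \<le> m - x - par" by linarith
      then have "2 * card C + (par + 2 * (s - card C)) + x \<le> m" using assms q(4) by linarith
      then show "(\<lambda>(s, C). (C, par + 2 * (s - card C))) q \<in> ?T" using q by simp
    qed
    show "(\<lambda>(C, a). (card C + (a - par) div 2, C)) ` ?T \<subseteq> ?S"
    proof (rule image_subsetI)
      fix q assume "q \<in> ?T"
      then obtain C a where q: "q = (C, a)" "ballot m C" "2 * card C + a + x \<le> m" "par \<le> a" "even (a - par)"
        by auto
      then have "card C + (a - par) div 2 \<le> ?k" by linarith
      then show "(\<lambda>(C, a). (card C + (a - par) div 2, C)) q \<in> ?S" using q by simp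
    qed
  qed
  then have "card ?T = card ?S" by (rule bij_betw_same_card[symmetric])
  also have "\<dots> = (\<Sum>s = 0..?k. card {C. ballot m C \<and> card C \<le> s})"
    by (rule card_SigmaI) (auto simp: finite_ballots)
  also have "\<dots> = (\<Sum>s = 0..?k. m choose s)"
    by (intro sum.cong refl card_ballots) auto
  finally show ?thesis .
qed

subsection \<open>Diagrams with a given lower half\<close>

lemma closer_iff:
  assumes D: "sym_pseudodiagram m D" and a: "a \<in> points m D"
  shows "pos m D a \<in> snd ` matching m D \<longleftrightarrow> (\<exists>b. {a, b} \<in> arcs D \<and> pos m D b < pos m D a)"
proof
  assume "pos m D a \<in> snd ` matching m D"
  then obtain x b where b: "pos m D x = pos m D a" "{b, x} \<in> arcs D" "pos m D b < pos m D x"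
    unfolding matching_def by auto
  then have "x = a" using pos_eq_iff[OF _ a] sym_in_points(2)[OF D b(2)] by blast
  then show "\<exists>b. {a, b} \<in> arcs D \<and> pos m D b < pos m D a" using b by (metis insert_commute)
next
  assume "\<exists>b. {a, b} \<in> arcs D \<and> pos m D b < pos m D a"
  then obtain b where b: "{b, a} \<in> arcs D" "pos m D b < pos m D a" by (metis insert_commute)
  then have "(pos m D b, pos m D a) \<in> matching m D" by (auto simp: matching_def)
  then show "pos m D a \<in> snd ` matching m D" by force
qed

definition north_closers :: "pseudodiagram \<Rightarrow> nat set" where
  "north_closers D = {i. \<exists>j<i. {North i, North j} \<in> arcs D}"

lemma closer_North:
  assumes D: "sym_pseudodiagram m D" and "i \<in> {1..m}"
  shows "i \<in> snd ` matching m D \<longleftrightarrow> i \<in> north_closers D"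
proof -
  have "pos m D b < i \<longleftrightarrow> (\<exists>j<i. b = North j)" if "{North i, b} \<in> arcs D" for b
    using sym_in_points(2)[OF D that] assms(2) by (cases b) auto
  then show ?thesis
    using closer_iff[OF D, of "North i"] assms(2) unfolding north_closers_def by auto
qed

section \<open>Closing points on the four sides\<close>

context propagating_diagram
begin

lemma closer_East:
  assumes "j \<in> {1..easts d}"
  shows "m + j \<in> snd ` matching m d \<longleftrightarrow> j \<le> lines d North East"
proof -
  have "pos m d b < m + j \<longleftrightarrow> (\<exists>i. b = North i)" if "{East j, b} \<in> arcs d" for b
    using sym_in_points(2)[OF sym that] assms that no_side_arcs by (cases b) auto
  then have "m + j \<in> snd ` matching m d \<longleftrightarrow> (\<exists>i. {East j, North i} \<in> arcs d)"
    using closer_iff[OF sym, of "East j"] assms by auto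
  then show ?thesis using North_East_iff[of j] assms by (auto simp: insert_commute)
qed

text \<open>The point of this form is that the right-hand side depends only on the lower
  half.\<close>

lemma closer_South:
  assumes "i \<in> {1..m}"
  shows "2 * m + easts d + 1 - i \<in> snd ` matching m d \<longleftrightarrow>
    low d i = North 0 \<or> low d i = East 0 \<or> (\<exists>j>i. low d i = South j)"
proof -
  obtain b where b: "{South i, b} \<in> arcs d" "partner d (South i) = b"
    using partner_arc[OF sym, of "South i"] assms by auto
  have "{South i, b'} \<in> arcs d \<longleftrightarrow> b' = b" for b' using b(1) sym_unique[OF sym b(1)] by blast
  then have "2 * m + easts d + 1 - i \<in> snd ` matching m d \<longleftrightarrow> pos m d b < 2 * m + easts d + 1 - i"
    using closer_iff[OF sym, of "South i"] assms by simp
  also have "\<dots> \<longleftrightarrow> low d i = North 0 \<or> low d i = East 0 \<or> (\<exists>j>i. low d i = South j)"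
    using sym_in_points(2)[OF sym b(1)] assms unfolding low_def b(2) by (cases b) auto
  finally show ?thesis .
qed

text \<open>The western side comes last in the numbering and no arc joins two of its points.\<close>

lemma closer_West:
  assumes "j \<in> {1..wests d}"
  shows "2 * m + easts d + wests d + 1 - j \<in> snd ` matching m d"
proof -
  obtain b where b: "{West j, b} \<in> arcs d" "b \<in> points m d" using sym_ex[OF sym, of "West j"] assms by auto
  have "b \<noteq> West k" for k using b no_side_arcs by auto
  then have "pos m d b < pos m d (West j)" using b(2) assms by (cases b) auto
  then show ?thesis using closer_iff[OF sym, of "West j"] b assms by auto
qed

abbreviation "N \<equiv> 2 * m + easts d + wests d"

lemmas nc = nc_matching_matching[OF sym]

lemma finite_matching: "finite (matching m d)"
proof -
  have "matching m d \<subseteq> {1..N} \<times> {1..N}" using nc_matchingD(1)[OF nc] by fastforce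
  then show ?thesis by (rule finite_subset) simp
qed

lemma closers_north: "snd ` matching m d \<inter> {1..m} = north_closers d"
proof -
  have "north_closers d \<subseteq> {1..m}"
    unfolding north_closers_def using vertex_in_range(1)[OF sym] by blast
  then show ?thesis using closer_North[OF sym] by blast
qed

text \<open>This is \<open>nc_matching_height\<close> at the north-east corner: the arcs passing
  over it are the lines leaving the northern edge, sorted by the side on which they end.\<close>

lemma north_count:
  "m = 2 * card (north_closers d) + lines d North West + lines d North East + lines d North South"
proof -
  let ?H = "{(a, b) \<in> matching m d. a \<le> m \<and> m < b}"
  have "m = 2 * card (north_closers d) + card ?H"
    using nc_matching_height[OF nc, of m] closers_north by simp
  moreover have "card ?H = card (fst ` ?H)"
    using nc_matchingD(3)[OF nc] by (intro card_image[symmetric]) (auto simp: inj_on_def)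
  moreover have "fst ` ?H = {i \<in> {1..m}. up d i = West 0} \<union> {i \<in> {1..m}. up d i = East 0} \<union> {i \<in> {1..m}. up d i = South 0}"
    (is "_ = ?R")
  proof
    show "fst ` ?H \<subseteq> ?R"
    proof
      fix i assume "i \<in> fst ` ?H"
      then obtain b where "(i, b) \<in> matching m d" and i: "i \<le> m" "m < b" by auto
      then obtain x y where xy: "i = pos m d x" "b = pos m d y" "x \<in> points m d" "y \<in> points m d" "{x, y} \<in> arcs d"
        using matching_obtain[OF sym] by metis
      then have "x = North i" "i \<in> {1..m}" using i by (cases x; auto)+
      moreover have "\<not> (\<exists>j. y = North j)" using xy i by auto
      ultimately show "i \<in> ?R" using xy(5) partner_eq[OF sym] by (cases y) (auto simp: up_def)
    qed
    show "?R \<subseteq> fst ` ?H"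
    proof
      fix i assume "i \<in> ?R"
      then have i: "i \<in> {1..m}" "\<not> (\<exists>j. partner d (North i) = North j)" by (auto simp: up_def)
      let ?b = "partner d (North i)"
      have arc: "{North i, ?b} \<in> arcs d" using partner_arc[OF sym, of "North i"] i by auto
      then have "m < pos m d ?b" using sym_in_points(2)[OF sym arc] i by (cases ?b) auto
      then have "(i, pos m d ?b) \<in> ?H" using arc i matching_iff[OF sym, of "North i" ?b] sym_in_points[OF sym arc] by auto
      then show "i \<in> fst ` ?H" by force
    qed
  qed
  moreover have "card ?R = lines d North West + lines d North East + lines d North South"
    unfolding lines_half[OF sym] by (subst card_Un_disjoint; (subst card_Un_disjoint)?) auto
  ultimately show ?thesis by simp
qed

lemma ballot_north_closers: "ballot m (north_closers d)"
  unfolding ballot_def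
proof (intro conjI allI impI)
  show "north_closers d \<subseteq> {1..m}" using closers_north by blast
  fix p assume "p \<le> m"
  then have "north_closers d \<inter> {1..p} = snd ` matching m d \<inter> {1..p}" unfolding closers_north[symmetric] by auto
  then show "2 * card (north_closers d \<inter> {1..p}) \<le> p"
    using nc_matching_height[OF nc, of p] \<open>p \<le> m\<close> by simp
qed

text \<open>The segment counted here starts behind the eastern ends of the northern lines. It
  consists of the eastern ends of the southern lines followed by the southern vertices, and it is
  the part of the boundary that is copied when the upper half is exchanged.\<close>

definition south_closers :: "nat \<Rightarrow> nat" where
  "south_closers s = card (snd ` matching m d \<inter> {m + lines d North East + 1..m + lines d North East + s})"

lemma closers_up_to:
  assumes "s \<le> lines d South East + m"
  shows "card (snd ` matching m d \<inter> {1..m + lines d North East + s}) =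
    card (north_closers d) + lines d North East + south_closers s"
proof -
  let ?M = "snd ` matching m d" and ?a = "lines d North East"
  have "?M \<inter> {m + 1..m + ?a} = {m + 1..m + ?a}"
  proof -
    have "p \<in> ?M" if "p \<in> {m + 1..m + ?a}" for p
    proof -
      have "p - m \<in> {1..easts d}" "p - m \<le> ?a" "m + (p - m) = p" using that easts_eq by auto
      then show ?thesis using closer_East[of "p - m"] by simp
    qed
    then show ?thesis by blast
  qed
  then have "card (?M \<inter> {m + 1..m + ?a}) = ?a" by simp
  moreover have "?M \<inter> {1..m + ?a + s} = (?M \<inter> {1..m}) \<union> (?M \<inter> {m + 1..m + ?a}) \<union> (?M \<inter> {m + ?a + 1..m + ?a + s})"
    by auto
  moreover have "card \<dots> = card (?M \<inter> {1..m}) + card (?M \<inter> {m + 1..m + ?a}) + card (?M \<inter> {m + ?a + 1..m + ?a + s})"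
    by (subst card_Un_disjoint; (subst card_Un_disjoint)?) auto
  ultimately have "card (?M \<inter> {1..m + ?a + s}) = card (?M \<inter> {1..m}) + ?a + card (?M \<inter> {m + ?a + 1..m + ?a + s})"
    by simp
  then show ?thesis unfolding closers_north south_closers_def .
qed

text \<open>An arc closed in the segment was opened there or is a propagating line, so the closing
  points outnumber the opening ones by at most \<open>lines d North South\<close>. The proof reads
  this off the heights, since the northern lines to the west stay open over the whole
  segment.\<close>

lemma south_closers_le:
  assumes s: "s \<le> lines d South East + m"
  shows "2 * south_closers s \<le> s + lines d North South"
proof -
  let ?q = "m + lines d North East + s"
  let ?H = "{(a, b) \<in> matching m d. a \<le> ?q \<and> ?q < b}"
  have q: "?q \<le> 2 * m + easts d" using s easts_eq by simp
  have "card {i. \<exists>j. {North i, West j} \<in> arcs d} \<le> card (fst ` ?H)"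
  proof (rule card_mono)
    have "?H \<subseteq> matching m d" by auto
    then show "finite (fst ` ?H)" using finite_matching finite_subset by blast
    show "{i. \<exists>j. {North i, West j} \<in> arcs d} \<subseteq> fst ` ?H"
    proof
      fix i assume "i \<in> {i. \<exists>j. {North i, West j} \<in> arcs d}"
      then obtain j where ij: "{North i, West j} \<in> arcs d" by blast
      have r: "i \<in> {1..m}" "j \<in> {1..wests d}" using vertex_in_range(1)[OF sym ij] vertex_in_range'(3)[OF sym ij] by auto
      have "(pos m d (North i), pos m d (West j)) \<in> matching m d"
        using ij r unfolding matching_def by fastforce
      moreover have "pos m d (North i) \<le> ?q" "?q < pos m d (West j)" using r q by auto
      ultimately have "(i, pos m d (West j)) \<in> ?H" by simp
      then show "i \<in> fst ` ?H" by force
    qed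
  qed
  also have "\<dots> = card ?H"
    using nc_matchingD(3)[OF nc] by (intro card_image) (auto simp: inj_on_def)
  finally have 1: "lines d North West \<le> card ?H" by (simp only: lines_def[of d North West])
  have 2: "?q = 2 * (card (north_closers d) + lines d North East + south_closers s) + card ?H"
    using nc_matching_height[OF nc, of ?q] q closers_up_to[OF s] by simp
  have "2 * K \<le> s + S" if "w \<le> h" "m + E + s = 2 * (c + E + K) + h" "m = 2 * c + w + E + S" for c E K w S h :: nat
    using that by presburger
  from this[OF 1 2 north_count] show ?thesis .
qed

text \<open>At the end nothing stays open and all western points close. What the segment itself
  leaves open is therefore accounted for by the southern lines to the west.\<close>

lemma south_closers_all:
  "2 * south_closers (lines d South East + m) + lines d South West = lines d South East + m + lines d North South"
proof -
  let ?M = "snd ` matching m d"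
  let ?q = "m + lines d North East + (lines d South East + m)"
  have q: "?q = 2 * m + easts d" using easts_eq by simp
  have "{(a, b) \<in> matching m d. a \<le> N \<and> N < b} = {}" using nc_matchingD(1)[OF nc] by fastforce
  then have 1: "N = 2 * card (?M \<inter> {1..N})" using nc_matching_height[OF nc order_refl] by (simp only: card.empty add_0_right)
  have "?M \<inter> {?q + 1..N} = {?q + 1..N}"
  proof -
    have "p \<in> ?M" if "p \<in> {?q + 1..N}" for p
    proof -
      have "N + 1 - p \<in> {1..wests d}" "N + 1 - (N + 1 - p) = p" using that q by auto
      then show ?thesis using closer_West[of "N + 1 - p"] by simp
    qed
    then show ?thesis by blast
  qed
  then have "card (?M \<inter> {?q + 1..N}) = card {?q + 1..N}" by simp
  also have "\<dots> = wests d" using q by simp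
  finally have "card (?M \<inter> {?q + 1..N}) = wests d" .
  moreover have "?M \<inter> {1..N} = (?M \<inter> {1..?q}) \<union> (?M \<inter> {?q + 1..N})" using q by auto
  moreover have "card \<dots> = card (?M \<inter> {1..?q}) + card (?M \<inter> {?q + 1..N})"
    by (subst card_Un_disjoint) auto
  ultimately have "N = 2 * (card (north_closers d) + lines d North East + south_closers (lines d South East + m) + wests d)"
    using 1 closers_up_to[OF order_refl] by simp
  then have "N = 2 * card (north_closers d) + 2 * lines d North East
      + 2 * south_closers (lines d South East + m) + 2 * wests d" by simp
  then show ?thesis using north_count wests_eq easts_eq by linarith
qed

end

text \<open>The lower half fixes the numbers of southern and propagating lines;
  \<open>north_count\<close> then leaves one value for the northern lines to the east. So the sizes
  of the sides agree, and so do the closing points on each of the four sides.\<close>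

lemma diagram_determined:
  assumes e: "propagating_diagram m e" and e': "propagating_diagram m e'"
    and low: "\<And>i. i \<in> {1..m} \<Longrightarrow> low e i = low e' i"
    and C: "north_closers e = north_closers e'" and NW: "lines e North West = lines e' North West"
  shows "e = e'"
proof -
  interpret e: propagating_diagram m e by (rule e)
  interpret e': propagating_diagram m e' by (rule e')
  have "lines e South West = lines e' South West" "lines e South East = lines e' South East"
    "lines e South North = lines e' South North"
    unfolding lines_half[OF e.sym] lines_half[OF e'.sym]
    using low by (auto intro!: arg_cong[where f = card])
  then have S: "lines e South West = lines e' South West" "lines e South East = lines e' South East"
    "lines e North South = lines e' North South"
    using num_prop_lines[OF e.sym] num_prop_lines[OF e'.sym] by auto
  then have NE: "lines e North East = lines e' North East"
    using e.north_count e'.north_count C NW by simp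
  have we: "wests e = wests e'" "easts e = easts e'"
    using e.wests_eq e'.wests_eq e.easts_eq e'.easts_eq S NE NW by auto
  have iff: "pos m e a \<in> snd ` matching m e \<longleftrightarrow> pos m e a \<in> snd ` matching m e'" if a: "a \<in> points m e" for a
  proof (cases a)
    case (North i)
    then show ?thesis using a closer_North[OF e.sym, of i] closer_North[OF e'.sym, of i] C by auto
  next
    case (East j)
    then show ?thesis using a e.closer_East[of j] e'.closer_East[of j] we NE by auto
  next
    case (South i)
    then have i: "i \<in> {1..m}" using a by auto
    show ?thesis using e.closer_South[OF i] e'.closer_South[OF i] South low[OF i] we by auto
  next
    case (West j)
    then show ?thesis using a e.closer_West[of j] e'.closer_West[of j] we by auto
  qed
  have sub: "snd ` matching m e \<subseteq> pos m e ` points m e"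
  proof
    fix p assume "p \<in> snd ` matching m e"
    then obtain q where "(q, p) \<in> matching m e" by auto
    then obtain b where "p = pos m e b" "b \<in> points m e" using matching_obtain[OF e.sym] by metis
    then show "p \<in> pos m e ` points m e" by auto
  qed
  have sub': "snd ` matching m e' \<subseteq> pos m e ` points m e"
  proof
    fix p assume "p \<in> snd ` matching m e'"
    then obtain q where "(q, p) \<in> matching m e'" by auto
    then obtain b where "p = pos m e' b" "b \<in> points m e'" using matching_obtain[OF e'.sym] by metis
    then show "p \<in> pos m e ` points m e" using pos_cong[OF we] points_cong[OF we] by auto
  qed
  have "p \<in> snd ` matching m e \<longleftrightarrow> p \<in> snd ` matching m e'" for p
  proof (cases "p \<in> pos m e ` points m e")
    case True
    then obtain a where "a \<in> points m e" "p = pos m e a" by blast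
    then show ?thesis using iff by simp
  next
    case False
    then show ?thesis using sub sub' by blast
  qed
  then have "snd ` matching m e = snd ` matching m e'" by (rule Set.set_eqI)
  then show ?thesis using diagram_eqI[OF e.sym e'.sym we] BphiD(3)[OF e.Bphi] BphiD(3)[OF e'.Bphi] by simp
qed

section \<open>Attaching a new upper half to a given lower half\<close>

context propagating_diagram
begin

text \<open>\<open>Z\<close> prescribes the closing points clockwise: \<open>C\<close> in the north,
  then the \<open>a\<close> eastern ends of northern lines, then a copy of the southern segment of
  \<open>d\<close>, then all western points. The copy is displaced because \<open>a\<close> replaces
  \<open>lines d North East\<close>; \<open>a\<close> is subtracted first, which is exact behind
  position \<open>m + a\<close>.\<close>

lemma ex_closers:
  assumes C: "ballot m C" and m: "m = 2 * card C + lines d North South + w + a"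
  defines "n \<equiv> 2 * m + (a + lines d South East) + (w + lines d South West)"
  defines "Z \<equiv> {p \<in> {1..n}. if p \<le> m then p \<in> C else if p \<le> m + a then True
    else if p \<le> 2 * m + a + lines d South East
    then p - a + lines d North East \<in> snd ` matching m d else True}"
  shows "\<exists>M. nc_matching n M \<and> snd ` M = Z"
proof (rule ex_nc_matching)
  let ?x = "lines d North South" and ?b = "lines d South East" and ?v = "lines d South West"
  let ?f = "lines d North East"
  have C_sub: "C \<subseteq> {1..m}" "finite C" using C ballot_card[OF C] by (simp_all add: ballot_def)
  show "Z \<subseteq> {1..n}" by (auto simp: Z_def)
  have Z1: "Z \<inter> {1..p} = C \<inter> {1..p}" if "p \<le> m" for p
    using that C_sub by (auto simp: Z_def n_def)
  have Z2: "card (Z \<inter> {1..m + t}) = card C + t" if "t \<le> a" for t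
  proof -
    have "Z \<inter> {1..m + t} = C \<union> {m + 1..m + t}" using that C_sub by (auto simp: Z_def n_def)
    moreover have "C \<inter> {m + 1..m + t} = {}" using C_sub by auto
    ultimately show ?thesis using C_sub by (simp add: card_Un_disjoint)
  qed
  have Z3: "card (Z \<inter> {1..m + a + s}) = card C + a + south_closers s" if s: "s \<le> ?b + m" for s
  proof -
    let ?S = "snd ` matching m d \<inter> {m + ?f + 1..m + ?f + s}"
    have "Z \<inter> {m + a + 1..m + a + s} = (\<lambda>q. q - ?f + a) ` ?S"
    proof
      show "Z \<inter> {m + a + 1..m + a + s} \<subseteq> (\<lambda>q. q - ?f + a) ` ?S"
      proof
        fix p assume p: "p \<in> Z \<inter> {m + a + 1..m + a + s}"
        then have "p - a + ?f \<in> ?S" using s by (auto simp: Z_def)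
        moreover have "p = (p - a + ?f) - ?f + a" using p by auto
        ultimately show "p \<in> (\<lambda>q. q - ?f + a) ` ?S" by (rule rev_image_eqI)
      qed
      show "(\<lambda>q. q - ?f + a) ` ?S \<subseteq> Z \<inter> {m + a + 1..m + a + s}"
      proof (rule image_subsetI)
        fix q assume q: "q \<in> ?S"
        then have "q - ?f + a - a + ?f = q" by auto
        moreover have "m + a + 1 \<le> q - ?f + a" "q - ?f + a \<le> m + a + s" using q by auto
        ultimately show "q - ?f + a \<in> Z \<inter> {m + a + 1..m + a + s}" using q s by (auto simp: Z_def n_def)
      qed
    qed
    moreover have "inj_on (\<lambda>q. q - ?f + a) ?S" by (auto simp: inj_on_def)
    ultimately have "card (Z \<inter> {m + a + 1..m + a + s}) = south_closers s"
      unfolding south_closers_def by (simp only: card_image)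
    moreover have "Z \<inter> {1..m + a + s} = (Z \<inter> {1..m + a}) \<union> (Z \<inter> {m + a + 1..m + a + s})" by auto
    moreover have "card \<dots> = card (Z \<inter> {1..m + a}) + card (Z \<inter> {m + a + 1..m + a + s})"
      by (rule card_Un_disjoint) auto
    ultimately show ?thesis using Z2[OF order_refl] by simp
  qed
  have Z4: "card (Z \<inter> {1..2 * m + a + ?b + t}) = card C + a + south_closers (?b + m) + t" if t: "t \<le> w + ?v" for t
  proof -
    let ?q = "2 * m + a + ?b"
    have "Z \<inter> {?q + 1..?q + t} = {?q + 1..?q + t}" using t by (auto simp: Z_def n_def)
    then have "card (Z \<inter> {?q + 1..?q + t}) = t" by simp
    moreover have "Z \<inter> {1..?q + t} = (Z \<inter> {1..?q}) \<union> (Z \<inter> {?q + 1..?q + t})" by auto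
    moreover have "card \<dots> = card (Z \<inter> {1..?q}) + card (Z \<inter> {?q + 1..?q + t})"
      by (rule card_Un_disjoint) auto
    ultimately have "card (Z \<inter> {1..?q + t}) = card (Z \<inter> {1..?q}) + t" by simp
    moreover have "m + a + (?b + m) = ?q" by simp
    ultimately show ?thesis using Z3[OF order_refl] by (simp only:)
  qed
  note all = south_closers_all
  show "2 * card (Z \<inter> {1..p}) \<le> p" if p: "p \<le> n" for p
  proof -
    consider "p \<le> m" | t where "t \<le> a" "p = m + t" | s where "s \<le> ?b + m" "p = m + a + s"
      | t where "t \<le> w + ?v" "p = 2 * m + a + ?b + t"
    proof -
      have "p \<le> m \<or> (m \<le> p \<and> p - m \<le> a) \<or> (m + a \<le> p \<and> p - (m + a) \<le> ?b + m) \<or>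
          (2 * m + a + ?b \<le> p \<and> p - (2 * m + a + ?b) \<le> w + ?v)" using p by (auto simp: n_def)
      then show thesis using that by (metis le_add_diff_inverse)
    qed
    then show ?thesis
    proof cases
      case 1
      then show ?thesis using Z1 C by (simp add: ballot_def)
    next
      case 2
      then show ?thesis using Z2 m by simp
    next
      \<comment> \<open>The segment may close up to \<open>lines d North South\<close> arcs opened
        in the north. Exactly this many are reserved in the decomposition of \<open>m\<close>,
        besides the \<open>w\<close> lines to the west.\<close>
      case 3
      then show ?thesis using Z3 m south_closers_le[of s] by simp
    next
      \<comment> \<open>After the segment precisely \<open>w + lines d South West\<close> arcs are
        open, one for each western point.\<close>
      case 4
      then show ?thesis using Z4 m all by simp
    qed
  qed
  have "Z \<inter> {1..2 * m + a + ?b + (w + ?v)} = Z" by (auto simp: Z_def n_def)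
  then show "2 * card Z = n" using Z4[OF order_refl] m all by (simp add: n_def)
qed

text \<open>Inside the southern segment \<open>e\<close> has the arcs of \<open>d\<close>, because
  the closing points there agree. A southern vertex whose line leaves the segment is joined to the
  north if it closes and to the west if it opens, so the whole lower half is that of
  \<open>d\<close>.\<close>

lemma ex_diagram_upper_half:
  assumes C: "ballot m C" and le: "2 * card C + w + lines d North South \<le> m"
    and parity: "even (w + lines d South West)"
  shows "\<exists>e\<in>Bphi m. num_prop e = num_prop d \<and> (\<forall>i\<in>{1..m}. low e i = low d i) \<and>
    north_closers e = C \<and> lines e North West = w"
proof -
  let ?x = "lines d North South" and ?b = "lines d South East" and ?v = "lines d South West"
  let ?f = "lines d North East"
  define a where "a = m - 2 * card C - ?x - w"
  have m: "m = 2 * card C + ?x + w + a" using le by (simp add: a_def)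
  define n where "n = 2 * m + (a + ?b) + (w + ?v)"
  define Z where "Z = {p \<in> {1..n}. if p \<le> m then p \<in> C else if p \<le> m + a then True
    else if p \<le> 2 * m + a + ?b then p - a + ?f \<in> snd ` matching m d else True}"
  obtain M where M: "nc_matching n M" "snd ` M = Z"
    using ex_closers[OF C m] unfolding n_def Z_def by blast
  obtain e where e: "sym_pseudodiagram m e" "wests e = w + ?v" "easts e = a + ?b" "loop_pairs e = 0" "matching m e = M"
    using ex_diagram M(1) unfolding n_def by metis
  have m_pos: "1 \<le> m" using ex_propagating vertex_in_range(1)[OF sym] by fastforce
  have Z_north: "p \<in> Z \<longleftrightarrow> p \<in> C" if "p \<in> {1..m}" for p using that by (auto simp: Z_def n_def)
  have Z_east: "p \<in> Z" if "p \<in> {m + 1..m + a}" for p using that by (auto simp: Z_def n_def)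
  have Z_low: "p \<in> Z \<longleftrightarrow> p - a + ?f \<in> snd ` matching m d" if "p \<in> {m + a + 1..2 * m + a + ?b}" for p
    using that by (auto simp: Z_def n_def)
  have Z_west: "p \<in> Z" if "p \<in> {2 * m + a + ?b + 1..n}" for p using that by (auto simp: Z_def n_def)
  have opener: "pos m e p \<notin> Z" "pos m e q \<in> Z" if "{p, q} \<in> arcs e" "pos m e p < pos m e q" for p q
  proof -
    have "(pos m e p, pos m e q) \<in> M" using that e(5) by (auto simp: matching_def)
    then show "pos m e p \<notin> Z" "pos m e q \<in> Z" using nc_matchingD(5)[OF M(1)] M(2) by force+
  qed
  \<comment> \<open>\<open>R\<close> is the southern segment of the boundary of \<open>d\<close>,
    and \<open>shift\<close> its copy in \<open>e\<close>. Only eastern indices change, because a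
    different number of northern lines ends above them.\<close>
  define shift where "shift p = (case p of East j \<Rightarrow> East (j - ?f + a) | _ \<Rightarrow> p)" for p
  define R where "R = {p \<in> points m d. m + ?f < pos m d p \<and> pos m d p \<le> 2 * m + easts d}"
  have R_shift: "shift p \<in> points m e \<and> pos m e (shift p) + ?f = pos m d p + a" if "p \<in> R" for p
    using that easts_eq e(2,3) by (cases p) (auto simp: R_def shift_def)
  have R_surj: "\<exists>p\<in>R. shift p = q" if "q \<in> points m e" "m + a < pos m e q" "pos m e q \<le> 2 * m + a + ?b" for q
  proof (cases q)
    case (East j)
    then show ?thesis using that easts_eq e(2,3)
      by (intro bexI[of _ "East (j - a + ?f)"]) (auto simp: R_def shift_def)
  next
    case (South i)
    then show ?thesis using that easts_eq e(2,3) by (intro bexI[of _ q]) (auto simp: R_def shift_def)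
  qed (use that e in auto)
  \<comment> \<open>The common segment has \<open>lines d South East + m\<close> points, so the
    largest offset is one less; \<open>m_pos\<close> makes this subtraction exact.\<close>
  have local: "(m + ?f + 1 + i, m + ?f + 1 + j) \<in> matching m d \<longleftrightarrow> (m + a + 1 + i, m + a + 1 + j) \<in> M"
    if j: "j \<le> ?b + m - 1" for i j
  proof -
    have cl: "m + ?f + 1 + i \<in> snd ` matching m d \<longleftrightarrow> m + a + 1 + i \<in> snd ` M" if "i \<le> ?b + m - 1" for i
    proof -
      have "m + a + 1 + i \<in> {m + a + 1..2 * m + a + ?b}" using that m_pos by auto
      moreover have "m + a + 1 + i - a + ?f = m + ?f + 1 + i" by simp
      ultimately show ?thesis unfolding M(2) using Z_low by metis
    qed
    have b1: "m + ?f + 1 + (?b + m - 1) \<le> N" "1 \<le> m + ?f + 1" using m_pos easts_eq by auto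
    have b2: "m + a + 1 + (?b + m - 1) \<le> n" "1 \<le> m + a + 1" using m_pos by (auto simp: n_def)
    show ?thesis
      using nc_matching_local[OF nc M(1) b1(2,1) b2(2,1) cl _ j, of i]
        nc_matching_local[OF M(1) nc b2(2,1) b1(2,1) cl[symmetric] _ j, of i] by blast
  qed
  have transfer: "{p, q} \<in> arcs d \<longleftrightarrow> {shift p, shift q} \<in> arcs e" if pq: "p \<in> R" "q \<in> R" for p q
  proof -
    have *: "{p, q} \<in> arcs d \<and> pos m d p < pos m d q \<longleftrightarrow> {shift p, shift q} \<in> arcs e \<and> pos m e (shift p) < pos m e (shift q)"
      if pq: "p \<in> R" "q \<in> R" for p q
    proof -
      let ?i = "pos m d p - (m + ?f + 1)" and ?j = "pos m d q - (m + ?f + 1)"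
      have i: "pos m d p = m + ?f + 1 + ?i" "pos m d q = m + ?f + 1 + ?j" "?j \<le> ?b + m - 1"
        using pq easts_eq by (auto simp: R_def)
      have i': "pos m e (shift p) = m + a + 1 + ?i" "pos m e (shift q) = m + a + 1 + ?j"
        using R_shift[OF pq(1)] R_shift[OF pq(2)] i by linarith+
      have "p \<in> points m d" "q \<in> points m d" using pq by (auto simp: R_def)
      then have "{p, q} \<in> arcs d \<and> pos m d p < pos m d q \<longleftrightarrow> (pos m d p, pos m d q) \<in> matching m d"
        using matching_iff[OF sym] by blast
      also have "\<dots> \<longleftrightarrow> (pos m e (shift p), pos m e (shift q)) \<in> matching m e"
        unfolding e(5) i' using local[OF i(3), of ?i] i(1,2) by metis
      also have "\<dots> \<longleftrightarrow> {shift p, shift q} \<in> arcs e \<and> pos m e (shift p) < pos m e (shift q)"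
        using matching_iff[OF e(1)] R_shift pq by blast
      finally show ?thesis .
    qed
    have "p = q \<or> pos m d p < pos m d q \<or> pos m d q < pos m d p"
      using pos_eq_iff pq unfolding R_def by (metis (no_types, lifting) linorder_neqE_nat mem_Collect_eq)
    moreover have "pos m e (shift p) < pos m e (shift q) \<longleftrightarrow> pos m d p < pos m d q"
      "pos m e (shift q) < pos m e (shift p) \<longleftrightarrow> pos m d q < pos m d p"
      using R_shift[OF pq(1)] R_shift[OF pq(2)] by linarith+
    moreover have "{p, p} \<notin> arcs d" "{shift p, shift p} \<notin> arcs e"
      using sym_in_points(3)[OF sym] sym_in_points(3)[OF e(1)] by blast+
    ultimately show ?thesis using *[OF pq] *[OF pq(2,1)] by (metis insert_commute)
  qed
  have low: "low e i = low d i" if i: "i \<in> {1..m}" for i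
  proof -
    have SR: "South i \<in> R" "shift (South i) = South i" using i easts_eq by (auto simp: R_def shift_def)
    have inR: "q \<in> R \<Longrightarrow> {South i, shift q} \<in> arcs e \<longleftrightarrow> {South i, q} \<in> arcs d" for q
      using transfer[OF SR(1)] SR(2) by metis
    obtain b' where b': "{South i, b'} \<in> arcs d" "b' \<in> points m d" using sym_ex[OF sym, of "South i"] i by auto
    obtain c where c: "{South i, c} \<in> arcs e" "c \<in> points m e" using sym_ex[OF e(1), of "South i"] i by auto
    have pos_S: "pos m e (South i) = 2 * m + a + ?b + 1 - i" using e(3) by simp
    have S_Z: "pos m e (South i) \<in> Z \<longleftrightarrow> 2 * m + easts d + 1 - i \<in> snd ` matching m d"
    proof -
      have "2 * m + a + ?b + 1 - i \<in> {m + a + 1..2 * m + a + ?b}" using i by auto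
      moreover have "2 * m + a + ?b + 1 - i - a + ?f = 2 * m + easts d + 1 - i" using i easts_eq by auto
      ultimately show ?thesis unfolding pos_S using Z_low by metis
    qed
    \<comment> \<open>A line leaving the segment in \<open>d\<close> also leaves it in
      \<open>e\<close>: an arc of \<open>e\<close> inside the segment would be carried back by
      \<open>transfer\<close>.\<close>
    have c_out: "pos m e c \<le> m + a \<or> 2 * m + a + ?b < pos m e c" if "b' \<notin> R"
    proof (rule ccontr)
      assume "\<not> ?thesis"
      then obtain q where "q \<in> R" "shift q = c" using R_surj[OF c(2)] by auto
      then have "{South i, q} \<in> arcs d" using inR c(1) by blast
      then show False using sym_unique[OF sym b'(1)] \<open>q \<in> R\<close> that by blast
    qed
    have S_pos: "m + a < pos m e (South i)" "pos m e (South i) \<le> 2 * m + a + ?b" unfolding pos_S using i by auto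
    show ?thesis
    proof (cases b')
      case (South k)
      then have "b' \<in> R" "shift b' = South k" using b' easts_eq by (auto simp: R_def shift_def)
      then have "{South i, South k} \<in> arcs e" using inR b'(1) by metis
      then show ?thesis using low_iff(4)[OF e(1) i] low_iff(4)[OF sym i] b'(1) South by metis
    next
      case (East j)
      then have "?f < j" using South_East_iff[of j] b'(1) by auto
      then have "b' \<in> R" "shift b' = East (j - ?f + a)" using b' East by (auto simp: R_def shift_def)
      then have "{South i, East (j - ?f + a)} \<in> arcs e" using inR b'(1) by metis
      then show ?thesis using low_iff(2)[OF e(1) i] low_iff(2)[OF sym i] b'(1) East by metis
    next
      \<comment> \<open>Here \<open>South i\<close> closes, so its partner in \<open>e\<close> lies
        before the segment. The eastern points there are closing points themselves, which leaves a
        northern vertex.\<close>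
      case (North k)
      then have d: "low d i = North 0" using low_iff(3)[OF sym i] b'(1) by metis
      then have "pos m e (South i) \<in> Z" using S_Z closer_South[OF i] by simp
      then have "\<not> pos m e (South i) < pos m e c" using opener(1)[OF c(1)] by blast
      then have "pos m e c < pos m e (South i)"
        using pos_eq_iff[OF _ c(2), of "South i"] sym_in_points(1,3)[OF e(1) c(1)] by auto
      moreover have "b' \<notin> R" using North b' by (auto simp: R_def)
      ultimately have "pos m e c \<le> m + a" using c_out S_pos by linarith
      moreover have "pos m e c \<notin> Z"
        using opener(1)[of c "South i"] \<open>pos m e c < pos m e (South i)\<close> c(1) by (simp add: insert_commute)
      ultimately have "pos m e c \<le> m" using Z_east[of "pos m e c"] by force
      then obtain k' where "c = North k'" using c(2) by (cases c) auto
      then show ?thesis using low_iff(3)[OF e(1) i] c(1) d by metis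
    next
      \<comment> \<open>Here \<open>South i\<close> opens, so its partner in \<open>e\<close> lies
        behind the segment, on the western side.\<close>
      case (West j)
      then have d: "low d i = West 0" using low_iff(1)[OF sym i] b'(1) by metis
      then have "pos m e (South i) \<notin> Z" using S_Z closer_South[OF i] by simp
      then have "\<not> pos m e c < pos m e (South i)" using opener(2)[of c "South i"] c(1) by (auto simp: insert_commute)
      moreover have "b' \<notin> R" using West b' by (auto simp: R_def)
      ultimately have "2 * m + a + ?b < pos m e c" using c_out S_pos by linarith
      then obtain k' where "c = West k'" using c(2) e(3) by (cases c) auto
      then show ?thesis using low_iff(1)[OF e(1) i] c(1) d by metis
    qed
  qed
  have East_Z: "m + j \<in> Z \<longleftrightarrow> j \<le> a" if j: "j \<in> {1..easts e}" for j
  proof (cases "j \<le> a")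
    case False
    then have "m + j \<in> {m + a + 1..2 * m + a + ?b}" using j e(3) by auto
    then have "m + j \<in> Z \<longleftrightarrow> m + (j - a + ?f) \<in> snd ` matching m d"
      using Z_low False by (metis Nat.add_diff_assoc add.assoc linear)
    moreover have "j - a + ?f \<in> {1..easts d}" using False j e(3) easts_eq by auto
    ultimately show ?thesis using closer_East[of "j - a + ?f"] False by simp
  qed (use j Z_east[of "m + j"] in auto)
  have West_Z: "pos m e (West j) \<in> Z" if "j \<in> {1..wests e}" for j
    using that e(2,3) by (intro Z_west) (auto simp: n_def)
  have "{West i, West j} \<notin> arcs e" for i j
  proof
    assume a: "{West i, West j} \<in> arcs e"
    have r: "i \<in> {1..wests e}" "j \<in> {1..wests e}" using vertex_in_range(3)[OF e(1) a] vertex_in_range'(3)[OF e(1) a] by auto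
    have "pos m e (West i) \<noteq> pos m e (West j)" using pos_eq_iff sym_in_points[OF e(1) a] by metis
    then show False using opener(1)[OF a] opener(1)[of "West j" "West i"] a West_Z r
      by (metis insert_commute linorder_neqE_nat)
  qed
  moreover have "{East i, East j} \<notin> arcs e" for i j
  proof
    assume a: "{East i, East j} \<in> arcs e"
    have False if a: "{East i, East j} \<in> arcs e" and "i < j" for i j
    proof -
      have "i \<in> {1..easts e}" "j \<in> {1..easts e}" using vertex_in_range(4)[OF e(1) a] vertex_in_range'(4)[OF e(1) a] by auto
      then show False using opener[OF a] \<open>i < j\<close> East_Z[of i] East_Z[of j] by auto
    qed
    moreover have "i \<noteq> j" using sym_in_points(3)[OF e(1) a] by auto
    ultimately show False using a by (metis insert_commute linorder_neqE_nat)
  qed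
  \<comment> \<open>An opening eastern point of \<open>e\<close> belongs to the copied segment and
    is joined to a southern vertex there, like its original in \<open>d\<close>.\<close>
  moreover have "{West i, East j} \<notin> arcs e" for i j
  proof
    assume "{West i, East j} \<in> arcs e"
    then have a: "{East j, West i} \<in> arcs e" by (simp add: insert_commute)
    have r: "j \<in> {1..easts e}" "i \<in> {1..wests e}" using vertex_in_range(4)[OF e(1) a] vertex_in_range'(3)[OF e(1) a] by auto
    then have "pos m e (East j) < pos m e (West i)" by auto
    then have "\<not> j \<le> a" using opener(1)[OF a] East_Z[of j] r by auto
    then have j': "?f < j - a + ?f" "j - a + ?f \<le> easts d" using r e(3) easts_eq by auto
    then obtain k where k: "{South k, East (j - a + ?f)} \<in> arcs d" using South_East_iff by blast
    have "South k \<in> R" "East (j - a + ?f) \<in> R" "shift (East (j - a + ?f)) = East j" "shift (South k) = South k"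
      using j' \<open>\<not> j \<le> a\<close> vertex_in_range(2)[OF sym k] easts_eq by (auto simp: R_def shift_def)
    then have "{South k, East j} \<in> arcs e" using transfer k by metis
    then show False using sym_unique[OF e(1) a, of "South k"] by (simp add: insert_commute)
  qed
  ultimately have "contractible e = {}" "noncontractible e = {}"
    by (auto simp: contractible_def noncontractible_def)
  \<comment> \<open>By the two expressions for \<open>m\<close>, \<open>a\<close> and
    \<open>lines d North East\<close> differ by an even number, since \<open>w\<close> and
    \<open>lines d North West\<close> both have the parity of
    \<open>lines d South West\<close>.\<close>
  moreover have "even (easts e)"
  proof -
    have 1: "even (lines d North East + ?b)" and 2: "even (lines d North West + ?v)"
      using BphiD(2)[OF Bphi] easts_eq even_wests wests_eq by auto
    have "even (a + b)" if "even (f + b)" "even (c + v)" "m = 2 * s + c + f + x"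
      "m = 2 * t + x + w + a" "even (w + v)" for a b f c v s t x w :: nat
      using that by presburger
    from this[OF 1 2 north_count m parity] show ?thesis unfolding e(3) .
  qed
  ultimately have eB: "e \<in> Bphi m" using e by (auto simp: Bphi_def CC_def white_def)
  have np: "num_prop e = num_prop d"
    unfolding num_prop_low[OF e(1)] num_prop_low[OF sym] using low by (auto intro!: arg_cong[where f = card])
  interpret e: propagating_diagram m e using eB np has_prop by unfold_locales auto
  have "lines e South West = ?v"
    unfolding lines_half[OF e(1)] lines_half[OF sym] using low by (auto intro!: arg_cong[where f = card])
  then have "lines e North West = w" using e.wests_eq e(2) by simp
  moreover have "north_closers e = C"
  proof -
    have "north_closers e \<subseteq> {1..m}" "C \<subseteq> {1..m}" using e.closers_north C by (auto simp: ballot_def)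
    moreover have "i \<in> north_closers e \<longleftrightarrow> i \<in> C" if "i \<in> {1..m}" for i
      using closer_North[OF e(1) that] Z_north[OF that] M(2) e(5) by auto
    ultimately show ?thesis by blast
  qed
  ultimately show ?thesis using eB np low by blast
qed

end

text \<open>With the lower half fixed, a diagram is labelled by its northern closing points and its
  number of northern lines to the west. As the total number of western crossing points is even, the
  parity of the second label is that of \<open>lines d South West\<close>.\<close>

lemma card_same_lower_half:
  assumes "propagating_diagram m d"
  defines "E \<equiv> {e \<in> Bphi m. num_prop e = num_prop d \<and> (\<forall>i\<in>{1..m}. low e i = low d i)}"
    and "par \<equiv> lines d South West mod 2"
  assumes "num_prop d + par \<le> m"
  shows "finite E" "card E = (\<Sum>i = 0..(m - num_prop d - par) div 2. m choose i)"
proof -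
  interpret propagating_diagram m d by fact
  let ?T = "{(C, a). ballot m C \<and> 2 * card C + a + num_prop d \<le> m \<and> par \<le> a \<and> even (a - par)}"
  have np: "num_prop d = lines d North South" by (rule num_prop_lines(2)[OF sym])
  \<comment> \<open>The inequality excludes \<open>a = 0\<close> for odd parity, where the truncated
    difference \<open>a - par\<close> would be even.\<close>
  have par_iff: "par \<le> a \<and> even (a - par) \<longleftrightarrow> even (a + lines d South West)" for a
    unfolding par_def by (cases "even (lines d South West)"; cases a) (auto simp: odd_iff_mod_2_eq_one)
  have bij: "bij_betw (\<lambda>e. (north_closers e, lines e North West)) E ?T"
  proof (rule bij_betw_imageI)
    have prop_E: "propagating_diagram m e" if "e \<in> E" for e
      using that has_prop by unfold_locales (auto simp: E_def)
    show "inj_on (\<lambda>e. (north_closers e, lines e North West)) E"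
    proof (rule inj_onI)
      fix e e' assume "e \<in> E" "e' \<in> E" "(north_closers e, lines e North West) = (north_closers e', lines e' North West)"
      then show "e = e'" using diagram_determined[OF prop_E prop_E, of e e'] by (auto simp: E_def)
    qed
    show "(\<lambda>e. (north_closers e, lines e North West)) ` E = ?T"
    proof
      show "(\<lambda>e. (north_closers e, lines e North West)) ` E \<subseteq> ?T"
      proof (rule image_subsetI)
        fix e assume e: "e \<in> E"
        interpret e: propagating_diagram m e by (rule prop_E[OF e])
        have "lines e South West = lines d South West"
          unfolding lines_half[OF e.sym] lines_half[OF sym] using e by (auto simp: E_def intro!: arg_cong[where f = card])
        then have "even (lines e North West + lines d South West)"
          using e.even_wests e.wests_eq by simp
        moreover have "num_prop d = lines e North South" using e num_prop_lines(2)[OF e.sym] by (simp add: E_def)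
        ultimately show "(north_closers e, lines e North West) \<in> ?T"
          using e.ballot_north_closers e.north_count par_iff by auto
      qed
      show "?T \<subseteq> (\<lambda>e. (north_closers e, lines e North West)) ` E"
      proof
        fix q assume "q \<in> ?T"
        then obtain C a where q: "q = (C, a)" "ballot m C" "2 * card C + a + lines d North South \<le> m" "par \<le> a \<and> even (a - par)"
          using np by auto
        then obtain e where "e \<in> E" "north_closers e = C" "lines e North West = a"
          using ex_diagram_upper_half[of C a] par_iff by (auto simp: E_def)
        then show "q \<in> (\<lambda>e. (north_closers e, lines e North West)) ` E" using q(1) by auto
      qed
    qed
  qed
  have "?T \<subseteq> Pow {1..m} \<times> {..m}" by (auto simp: ballot_def)
  then have "finite ?T" by (rule finite_subset) simp
  then show "finite E" using bij bij_betw_finite by blast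
  show "card E = (\<Sum>i = 0..(m - num_prop d - par) div 2. m choose i)"
    using bij_betw_same_card[OF bij] card_ballots_parity[OF assms(4)] by simp
qed

text \<open>To reach \<open>e\<close> the product need not be worked out:
  \<open>halves_stack_mirrored\<close> gives it the two halves of \<open>e\<close>, and
  \<open>diagram_determined\<close> turns this into equality, whatever loops the reduction has
  removed.\<close>

lemma reachable_iff:
  assumes d: "propagating_diagram m d"
  shows "(\<lambda>d'. reduce (stack d' d)) ` Bphi m - {e \<in> Bphi m. num_prop e < num_prop d} =
    {e \<in> Bphi m. num_prop e = num_prop d \<and> (\<forall>i\<in>{1..m}. low e i = low d i)}" (is "?R - ?S = ?E")
proof
  interpret propagating_diagram m d by (rule d)
  show "?R - ?S \<subseteq> ?E"
  proof
    fix e assume e: "e \<in> ?R - ?S"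
    then obtain d' where d': "d' \<in> Bphi m" "e = reduce (stack d' d)" by auto
    have "e \<in> Bphi m" unfolding d'(2) using stack_reduce_in_Bphi[OF d'(1) Bphi] .
    moreover have "num_prop e = num_prop d"
      using num_prop_stack_le(1)[OF Bphi d'(1)] e calculation d'(2) by auto
    ultimately show "e \<in> ?E" using num_prop_stack_le(2)[OF Bphi d'(1)] d'(2) by auto
  qed
  show "?E \<subseteq> ?R - ?S"
  proof
    fix e assume e: "e \<in> ?E"
    then have eB: "e \<in> Bphi m" and np: "num_prop e = num_prop d"
      and low: "\<And>i. i \<in> {1..m} \<Longrightarrow> low e i = low d i" by auto
    interpret e: propagating_diagram m e using eB np has_prop by unfold_locales auto
    have flip_flip: "flip_type (flip_type p) = p" for p by (cases p) auto
    note fsym = sym_flip[OF sym]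
    \<comment> \<open>The upper half of \<open>flip d\<close> mirrors the lower half of
      \<open>d\<close>, which is that of \<open>e\<close>; so \<open>d1\<close> has the upper half
      of \<open>e\<close> and a lower half mirroring the upper half of \<open>d\<close>. Both
      gluings are thus of mirrored halves.\<close>
    define d1 where "d1 = reduce (stack e (flip d))"
    have d1B: "d1 \<in> Bphi m" unfolding d1_def by (rule stack_reduce_in_Bphi[OF eB flip_in_Bphi[OF Bphi]])
    note d1sym = BphiD(1)[OF d1B]
    have mirror1: "low e i = flip_type (up (flip d) i)" if "i \<in> {1..m}" for i
      using low[OF that] halves_flip(2)[OF sym that] flip_flip by simp
    have d1: "up d1 i = up e i" "low d1 i = flip_type (up d i)" if i: "i \<in> {1..m}" for i
    proof -
      have "up (stack e (flip d)) i = up e i" "low (stack e (flip d)) i = low (flip d) i"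
        using halves_stack_mirrored[OF e.sym fsym _ i] mirror1 by blast+
      then show "up d1 i = up e i" "low d1 i = flip_type (up d i)"
        using halves_reduce[OF sym_stack[OF e.sym fsym] i] halves_flip(1)[OF sym i] by (simp_all add: d1_def)
    qed
    define e' where "e' = reduce (stack d1 d)"
    have e'B: "e' \<in> Bphi m" unfolding e'_def by (rule stack_reduce_in_Bphi[OF d1B Bphi])
    have e': "up e' i = up e i" "low e' i = low e i" if i: "i \<in> {1..m}" for i
    proof -
      have "up (stack d1 d) i = up d1 i" "low (stack d1 d) i = low d i"
        using halves_stack_mirrored[OF d1sym sym _ i] d1(2) by blast+
      then show "up e' i = up e i" "low e' i = low e i"
        using halves_reduce[OF sym_stack[OF d1sym sym] i] d1(1)[OF i] low[OF i] by (simp_all add: e'_def)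
    qed
    note e'sym = BphiD(1)[OF e'B]
    have "num_prop e' = num_prop e"
      unfolding num_prop_low[OF e'sym] num_prop_low[OF e.sym] using e'(2) by (auto intro!: arg_cong[where f = card])
    then have pe': "propagating_diagram m e'" using e'B np has_prop by unfold_locales auto
    have "lines e' North West = lines e North West"
      unfolding lines_half[OF e'sym] lines_half[OF e.sym] using e'(1) by (auto intro!: arg_cong[where f = card])
    moreover have "north_closers e' = north_closers e"
    proof -
      have "{North i, North j} \<in> arcs e' \<longleftrightarrow> {North i, North j} \<in> arcs e" for i j
      proof (cases "i \<in> {1..m}")
        case True
        then show ?thesis using up_iff(4)[OF e'sym True] up_iff(4)[OF e.sym True] e'(1)[OF True] by metis
      next
        case False
        then show ?thesis using vertex_in_range(1)[OF e'sym] vertex_in_range(1)[OF e.sym] by blast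
      qed
      then show ?thesis by (simp add: north_closers_def)
    qed
    ultimately have "e' = e" using diagram_determined[OF pe' e.propagating_diagram_axioms e'(2)] by blast
    then have "e \<in> ?R" using d1B by (auto simp: e'_def)
    then show "e \<in> ?R - ?S" using np by auto
  qed
qed

text \<open>Provides members of the index sets. On both horizontal edges the first \<open>a\<close>
  vertices are joined to the west, the next \<open>x\<close> straight through, and the remaining
  \<open>b\<close> to the east.\<close>

lemma ex_diagram_of_type:
  assumes "0 < x" "x + a \<le> m"
  shows "\<exists>d\<in>Bphi m. num_prop d = x \<and> lines d South West = a"
proof -
  define b where "b = m - x - a"
  have m: "m = x + a + b" using assms by (simp add: b_def)
  \<comment> \<open>Five bundles of nested arcs, in this order: north to west, north to south, north
    to east, east to south, south to west. In each bundle the positions of the two ends have a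
    constant sum.\<close>
  define M where "M = {(p, q). (1 \<le> p \<and> p \<le> a \<and> p + q = 2 * m + 2 * b + 2 * a + 1) \<or>
    (a < p \<and> p \<le> a + x \<and> p + q = 2 * m + 2 * b + 1) \<or>
    (a + x < p \<and> p \<le> m \<and> p + q = 2 * m + 1) \<or>
    (m + b < p \<and> p \<le> m + 2 * b \<and> p + q = 2 * m + 4 * b + 1) \<or>
    (2 * m + 2 * b < p + a \<and> p \<le> 2 * m + 2 * b \<and> p + q = 4 * m + 4 * b + 1)}"
  have M_iff: "(p, q) \<in> M \<longleftrightarrow> (1 \<le> p \<and> p \<le> a \<and> p + q = 2 * m + 2 * b + 2 * a + 1) \<or>
    (a < p \<and> p \<le> a + x \<and> p + q = 2 * m + 2 * b + 1) \<or>
    (a + x < p \<and> p \<le> m \<and> p + q = 2 * m + 1) \<or>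
    (m + b < p \<and> p \<le> m + 2 * b \<and> p + q = 2 * m + 4 * b + 1) \<or>
    (2 * m + 2 * b < p + a \<and> p \<le> 2 * m + 2 * b \<and> p + q = 4 * m + 4 * b + 1)" for p q
    by (simp add: M_def)
  have "nc_matching (2 * m + 2 * b + 2 * a) M"
    unfolding nc_matching_def
  proof (intro conjI allI impI ballI)
    fix p assume "p \<in> {1..2 * m + 2 * b + 2 * a}"
    then have p: "1 \<le> p" "p \<le> 2 * m + 2 * b + 2 * a" by auto
    \<comment> \<open>The ten cases are the two ends of each bundle.\<close>
    consider "p \<le> a"
      | "a < p \<and> p \<le> a + x"
      | "a + x < p \<and> p \<le> m"
      | "m < p \<and> p \<le> m + b"
      | "m + b < p \<and> p \<le> m + 2 * b"
      | "m + 2 * b < p \<and> p \<le> m + 3 * b"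
      | "m + 3 * b < p \<and> p \<le> m + 3 * b + x"
      | "m + 3 * b + x < p \<and> p \<le> 2 * m + 2 * b"
      | "2 * m + 2 * b < p \<and> p \<le> 2 * m + 2 * b + a"
      | "2 * m + 2 * b + a < p"
      by linarith
    then show "\<exists>q. (p, q) \<in> M \<or> (q, p) \<in> M"
    proof cases
      case 1
      have "(p, 2 * m + 2 * b + 2 * a + 1 - p) \<in> M"
        unfolding M_iff by (rule disjI1, intro conjI; use 1 p m in linarith)
      then show ?thesis by blast
    next
      case 2
      have "(p, 2 * m + 2 * b + 1 - p) \<in> M"
        unfolding M_iff by (rule disjI2, rule disjI1, intro conjI; use 2 p m in linarith)
      then show ?thesis by blast
    next
      case 3
      have "(p, 2 * m + 1 - p) \<in> M"
        unfolding M_iff by (rule disjI2, rule disjI2, rule disjI1, intro conjI; use 3 p m in linarith)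
      then show ?thesis by blast
    next
      case 4
      have "(2 * m + 1 - p, p) \<in> M"
        unfolding M_iff by (rule disjI2, rule disjI2, rule disjI1, intro conjI; use 4 p m in linarith)
      then show ?thesis by blast
    next
      case 5
      have "(p, 2 * m + 4 * b + 1 - p) \<in> M"
        unfolding M_iff by (rule disjI2, rule disjI2, rule disjI2, rule disjI1, intro conjI; use 5 p m in linarith)
      then show ?thesis by blast
    next
      case 6
      have "(2 * m + 4 * b + 1 - p, p) \<in> M"
        unfolding M_iff by (rule disjI2, rule disjI2, rule disjI2, rule disjI1, intro conjI; use 6 p m in linarith)
      then show ?thesis by blast
    next
      case 7
      have "(2 * m + 2 * b + 1 - p, p) \<in> M"
        unfolding M_iff by (rule disjI2, rule disjI1, intro conjI; use 7 p m in linarith)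
      then show ?thesis by blast
    next
      case 8
      have "(p, 4 * m + 4 * b + 1 - p) \<in> M"
        unfolding M_iff by (rule disjI2, rule disjI2, rule disjI2, rule disjI2, intro conjI; use 8 p m in linarith)
      then show ?thesis by blast
    next
      case 9
      have "(4 * m + 4 * b + 1 - p, p) \<in> M"
        unfolding M_iff by (rule disjI2, rule disjI2, rule disjI2, rule disjI2, intro conjI; use 9 p m in linarith)
      then show ?thesis by blast
    next
      case 10
      have "(2 * m + 2 * b + 2 * a + 1 - p, p) \<in> M"
        unfolding M_iff by (rule disjI1, intro conjI; use 10 p m in linarith)
      then show ?thesis by blast
    qed
  next
    fix p q p' q' assume "(p, q) \<in> M" "(p', q') \<in> M"
    then show "\<not> (p < p' \<and> p' < q \<and> q < q')" using m unfolding M_iff by (elim disjE) linarith+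
  next
    fix p q q' assume "(p, q) \<in> M" "(p, q') \<in> M"
    then show "q = q'" using m unfolding M_iff by (elim disjE) linarith+
  next
    fix p q q' assume "(q, p) \<in> M" "(q', p) \<in> M"
    then show "q = q'" using m unfolding M_iff by (elim disjE) linarith+
  next
    fix p q q' assume *: "(p, q) \<in> M"
    show "(q', p) \<notin> M"
    proof
      assume "(q', p) \<in> M"
      then show False using * m unfolding M_iff by (elim disjE) linarith+
    qed
  next
    fix p q assume "(p, q) \<in> M"
    then show "1 \<le> p" "p < q" "q \<le> 2 * m + 2 * b + 2 * a" using m unfolding M_iff by linarith+
  qed
  then obtain d where d: "sym_pseudodiagram m d" "wests d = 2 * a" "easts d = 2 * b" "loop_pairs d = 0" "matching m d = M"
    using ex_diagram by metis
  have arc: "(pos m d p, pos m d q) \<in> M \<or> (pos m d q, pos m d p) \<in> M" if "{p, q} \<in> arcs d" for p q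
  proof -
    have "pos m d p \<noteq> pos m d q" using pos_eq_iff sym_in_points[OF d(1) that] by metis
    then have "(pos m d p, pos m d q) \<in> matching m d \<or> (pos m d q, pos m d p) \<in> matching m d"
      using that unfolding matching_def by (auto simp: insert_commute) (metis insert_commute linorder_neqE_nat)
    then show ?thesis unfolding d(5) .
  qed
  have "{West i, West j} \<notin> arcs d" for i j
  proof
    assume a: "{West i, West j} \<in> arcs d"
    have r: "i \<in> {1..2 * a}" "j \<in> {1..2 * a}" using sym_in_points[OF d(1) a] d by auto
    then have "2 * m + 2 * b < pos m d (West i)" "2 * m + 2 * b < pos m d (West j)" using d by auto
    then show False using arc[OF a] m unfolding M_iff by linarith
  qed
  moreover have "{East i, East j} \<notin> arcs d" for i j
  proof
    assume a: "{East i, East j} \<in> arcs d"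
    have r: "i \<in> {1..2 * b}" "j \<in> {1..2 * b}" using sym_in_points[OF d(1) a] d by auto
    then show False using arc[OF a] m unfolding M_iff pos.simps by (simp; linarith)
  qed
  moreover have "{West i, East j} \<notin> arcs d" for i j
  proof
    assume a: "{West i, East j} \<in> arcs d"
    have r: "i \<in> {1..2 * a}" "j \<in> {1..2 * b}" using sym_in_points[OF d(1) a] d by auto
    then have "2 * m + 2 * b < pos m d (West i)" "m < pos m d (East j)" "pos m d (East j) \<le> m + 2 * b" using d by auto
    then show False using arc[OF a] m unfolding M_iff by linarith
  qed
  ultimately have "contractible d = {}" "noncontractible d = {}"
    by (auto simp: contractible_def noncontractible_def)
  then have dB: "d \<in> Bphi m" using d by (auto simp: Bphi_def CC_def white_def)
  have "{i. \<exists>j. {North i, South j} \<in> arcs d} = {a + 1..a + x}"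
  proof
    show "{i. \<exists>j. {North i, South j} \<in> arcs d} \<subseteq> {a + 1..a + x}"
    proof
      fix i assume "i \<in> {i. \<exists>j. {North i, South j} \<in> arcs d}"
      then obtain j where a: "{North i, South j} \<in> arcs d" by blast
      have r: "i \<in> {1..m}" "j \<in> {1..m}" using sym_in_points[OF d(1) a] by auto
      then have q: "m + 2 * b < pos m d (South j)" "pos m d (South j) \<le> 2 * m + 2 * b" using d by auto
      have r': "1 \<le> i" "i \<le> m" using r by auto
      have "(i, pos m d (South j)) \<in> M \<or> (pos m d (South j), i) \<in> M" using arc[OF a] by simp
      then consider "(i, pos m d (South j)) \<in> M" | "(pos m d (South j), i) \<in> M" by blast
      then have "a < i \<and> i \<le> a + x"
      proof cases
        case 1
        then show ?thesis unfolding M_iff using m q r' by (elim disjE conjE) simp_all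
      next
        case 2
        then show ?thesis unfolding M_iff using m q r' by (elim disjE conjE) simp_all
      qed
      then show "i \<in> {a + 1..a + x}" by simp
    qed
    show "{a + 1..a + x} \<subseteq> {i. \<exists>j. {North i, South j} \<in> arcs d}"
    proof
      fix i assume "i \<in> {a + 1..a + x}"
      then have r: "i \<in> {1..m}" and "(i, 2 * m + 2 * b + 1 - i) \<in> M" using m unfolding M_iff by auto
      then have "(pos m d (North i), pos m d (South i)) \<in> matching m d" using d by simp
      then show "i \<in> {i. \<exists>j. {North i, South j} \<in> arcs d}" using matching_iff[OF d(1), of "North i" "South i"] r by auto
    qed
  qed
  then have "num_prop d = x" using num_prop_lines(2)[OF d(1)] by (simp add: lines_def)
  moreover have "{i. \<exists>j. {South i, West j} \<in> arcs d} = {1..a}"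
  proof
    show "{i. \<exists>j. {South i, West j} \<in> arcs d} \<subseteq> {1..a}"
    proof
      fix i assume "i \<in> {i. \<exists>j. {South i, West j} \<in> arcs d}"
      then obtain j where a: "{South i, West j} \<in> arcs d" by blast
      have r: "i \<in> {1..m}" "j \<in> {1..2 * a}" using sym_in_points[OF d(1) a] d by auto
      then have q: "pos m d (South i) + i = 2 * m + 2 * b + 1" "2 * m + 2 * b < pos m d (West j)" using d by auto
      have r': "1 \<le> i" "i \<le> m" using r by auto
      consider "(pos m d (South i), pos m d (West j)) \<in> M" | "(pos m d (West j), pos m d (South i)) \<in> M"
        using arc[OF a] by blast
      then have "i \<le> a"
      proof cases
        case 1
        then show ?thesis unfolding M_iff using m q r' by (elim disjE conjE) linarith+
      next
        case 2
        then show ?thesis unfolding M_iff using m q r' by (elim disjE conjE) linarith+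
      qed
      then show "i \<in> {1..a}" using r by simp
    qed
    show "{1..a} \<subseteq> {i. \<exists>j. {South i, West j} \<in> arcs d}"
    proof
      fix i assume i: "i \<in> {1..a}"
      then have r: "i \<in> {1..m}" "2 * a + 1 - i \<in> {1..2 * a}" using m by auto
      moreover have "(2 * m + 2 * b + 1 - i, 2 * m + 2 * b + 2 * a + 1 - (2 * a + 1 - i)) \<in> M"
        using i m unfolding M_iff by auto
      ultimately have "(pos m d (South i), pos m d (West (2 * a + 1 - i))) \<in> matching m d" using d by simp
      then show "i \<in> {i. \<exists>j. {South i, West j} \<in> arcs d}"
        using matching_iff[OF d(1), of "South i" "West (2 * a + 1 - i)"] r d by auto
    qed
  qed
  ultimately show ?thesis using dB by (auto simp: lines_def)
qed

theorem corollary8p5p3: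
  fixes P :: "'k::field parameters" and m x :: nat and l \<epsilon> k :: int
  assumes "m \<ge> 1"
    and "\<delta> P \<noteq> 0" and "\<delta>\<^sub>L P \<noteq> 0" and "\<delta>\<^sub>R P \<noteq> 0"
    and "\<kappa>\<^sub>L P \<noteq> 0" and "\<kappa>\<^sub>R P \<noteq> 0" and "\<kappa>\<^sub>L\<^sub>R P \<noteq> 0"
    and "l \<in> {- int m .. int m - 1}"
    and "x > 0" and "l = int x \<or> l = - int x"
    and "\<epsilon> = (if odd (int m - int x) then 1 else if l > 0 then 2 else 0)"
    and "k = (int m - (int x + \<epsilon>)) div 2"
  shows "Bphi_idx m l \<noteq> {} \<and>
    (\<forall>d\<in>Bphi_idx m l. has_dimension (prestandard m P l d) (\<Sum>i = 0..nat k. m choose i))"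
proof
  \<comment> \<open>The prescribed parity of the number of southern half lines ending on the
    0-reflection line: the inner region is to be black exactly for positive
    \<open>l\<close>.\<close>
  define par :: nat where "par = (if l > 0 then 1 else 0)"
  have l: "l \<noteq> 0" "\<bar>l\<bar> = int x" using assms(9,10) by auto
  \<comment> \<open>For positive \<open>l\<close> the bound \<open>l \<le> m - 1\<close> leaves room
    for this one half line.\<close>
  have par_le: "x + par \<le> m" using assms(8,9,10) by (auto simp: par_def)
  \<comment> \<open>If \<open>m - x\<close> is odd, both values of \<open>par\<close> give the same
    integer part. If it is even, \<epsilon> equals \<open>2 * par\<close>, and subtracting 1 or 2
    from an even number gives the same integer part after halving.\<close>
  have k: "nat k = (m - x - par) div 2"
  proof -
    define y where "y = int m - int x"
    have "k = (y - \<epsilon>) div 2" using assms(12) by (simp add: y_def algebra_simps)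
    also have "\<dots> = (y - int par) div 2"
    proof (cases "odd y")
      case True
      then have "\<epsilon> = 1" using assms(11) by (simp add: y_def)
      moreover have "(y - 1) div 2 = y div 2" using True by (elim oddE) simp
      ultimately show ?thesis by (simp add: par_def)
    next
      case False
      then obtain z where z: "y = 2 * z" by (auto elim: evenE)
      have "(2 * z - 2) div 2 = (2 * z - 1) div 2" by presburger
      then show ?thesis using assms(11) False z by (simp add: y_def par_def)
    qed
    also have "y - int par = int (m - x - par)" using par_le by (simp add: y_def)
    finally have "k = int ((m - x - par) div 2)" by (simp add: zdiv_int)
    then show ?thesis by simp
  qed
  obtain d where "d \<in> Bphi m" "num_prop d = x" "lines d South West = par"
    using ex_diagram_of_type[OF assms(9) par_le] by blast
  then have "d \<in> Bphi_idx m l" using l by (simp add: Bphi_idx_iff par_def)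
  then show "Bphi_idx m l \<noteq> {}" by blast
  show "\<forall>d\<in>Bphi_idx m l. has_dimension (prestandard m P l d) (\<Sum>i = 0..nat k. m choose i)"
  proof
    fix d assume "d \<in> Bphi_idx m l"
    then have d: "d \<in> Bphi m" "num_prop d = x" "odd (lines d South West) \<longleftrightarrow> l > 0"
      using l by (auto simp: Bphi_idx_iff)
    then have par: "lines d South West mod 2 = par" by (auto simp: par_def odd_iff_mod_2_eq_one)
    have pd: "propagating_diagram m d" using d assms(9) by unfold_locales auto
    let ?R = "(\<lambda>d'. reduce (stack d' d)) ` Bphi m"
    let ?S = "{e \<in> Bphi m. num_prop e < num_prop d}"
    have T: "Tspan m (\<bar>l\<bar> - 1) = {a :: pseudodiagram \<Rightarrow>\<^sub>0 'k. Poly_Mapping.keys a \<subseteq> ?S}"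
      unfolding Tspan_def l(2) d(2) by (intro Collect_cong) auto
    have factor: "factor m P D \<noteq> 0" for D using factor_nonzero assms(2-7) by blast
    have fin: "finite (?R - ?S)" and card: "card (?R - ?S) = (\<Sum>i = 0..nat k. m choose i)"
      unfolding reachable_iff[OF pd] k
      using card_same_lower_half[OF pd, unfolded par d(2), OF par_le] d(2) by auto
    show "has_dimension (prestandard m P l d) (\<Sum>i = 0..nat k. m choose i)"
      unfolding prestandard_def T left_multiples_add_span[OF factor] card[symmetric]
      by (rule has_dimension_quotient_space[OF fin])
  qed
qed

end
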